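(* If $P$ is a closed AL$\pi$ process, then $[\![P]\!]_\emptyset\simeq P$, where $\simeq$ is weak similarity equivalence (weak similarity in both directions).
   Context: AL$\pi$ (simply-typed Asynchronous Localised $\pi$-calculus): processes $P::=0\mid P\mid Q\mid a(x).P\mid\overline{b}\langle c\rangle\mid(\nu a)P\mid\ !a(x).P$ with the standard asynchronous $\pi$-calculus LTS, subject to the constraint that only output capabilities are communicated: in $a(x).P$ and $!a(x).P$ the received name $x$ never occurs free in $P$ as the subject of an input. Value types are $T::=o\,T\mid\mathsf{unit}$, restricted names having a type allowing both input and output. AW$\pi$: besides success names (O-names carrying only $\star$, never restricted), each name is an I-name (only input subject) or an O-name (only output subject); processes $P ::= 0 \mid P \mid Q \mid a(x).P \mid \overline{b}\langle \tilde v\rangle \mid (\nu\, a \leftrightarrow b)P \mid\ !a(x).P$ (polyadic communication allowed), where $(\nu\,a\leftrightarrow b)$ connects I-name $a$ with O-name $b$; its reduction semantics: $(\nu\,a\leftrightarrow b)(a(\tilde x).P\mid\overline{b}\langle\tilde v\rangle\mid Q)\to(\nu\,a\leftrightarrow b)(P\{\tilde v/\tilde x\}\mid Q)$, analogously for persistent $!a(\tilde x).P$, closed under parallel composition, restriction and structural congruence. Encoding $[\![\cdot]\!]_f$ from AL$\pi$ to AW$\pi$, parametrised by a finite map $f$ on names, each AL$\pi$ name being treated as an O-name of AW$\pi$: $[\![(\nu a)P]\!]_f=(\nu\,\hat a\leftrightarrow a)(\nu\,\hat b\leftrightarrow b)(\nu\,\hat c\leftrightarrow c)\big([\![P]\!]_{f[a\mapsto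 b]}\mid\overline{c}\langle\hat a,\hat b\rangle\mid\ !\hat c(a',b').a'(x).b'(y).(\overline{c}\langle a',b'\rangle\mid\overline{y}\langle x\rangle)\big)$, with $\hat a,\hat b,\hat c$ fresh I-names and $b,c$ fresh O-names; $[\![a(y).P]\!]_f=(\nu\,z\leftrightarrow z')\big(\overline{f(a)}\langle z'\rangle\mid z(y).[\![P]\!]_f\big)$ with $z,z'$ fresh; $[\![!a(y).P]\!]_f=(\nu\,d\leftrightarrow d')\big(\overline{d'}\langle\star\rangle\mid\ !d(u).(\overline{d'}\langle\star\rangle\mid[\![a(y).P]\!]_f)\big)$ with $d,d'$ fresh; $[\![\overline{a}\langle b\rangle]\!]_f=\overline{a}\langle b\rangle$; $[\![P\mid Q]\!]_f=[\![P]\!]_f\mid[\![Q]\!]_f$; $[\![0]\!]_f=0$. A closed process has only success names free (success names are not changed by the encoding). On closed processes of both calculi the observable actions are $\tau$ (a reduction) and outputs $\overline{\omega}\langle\star\rangle$ at success names; a weak simulation is a relation $\mathcal{S}$ such that $P\,\mathcal{S}\,Q$ and $P\xrightarrow{\mu}P'$ imply $Q\Rightarrow\xrightarrow{\mu}\Rightarrow Q'$ (just $Q\Rightarrow Q'$ if $\mu=\tau$) with $P'\,\mathcal{S}\,Q'$; $P\simeq Q$ iff each is weakly simulated by the other. *)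

theory Defs
  imports Main
begin

text \<open>
  Processes of both calculi are represented with de Bruijn indices, so alpha-equivalent
  processes are equal and the freshness side conditions of the paper become index shifts.
  Success names are never bound in either calculus; they are constants taken from an arbitrary
  type \<open>'s\<close>, shared by the two calculi.

  \<open>'s val\<close> is the type of values of ALpi and also of the O-values of AWpi: the unit
  value, a success name, or the (bound or free) name with a given index.
\<close>

datatype 's val = Star | Succ 's | Ix nat

primrec sub_val :: "(nat \<Rightarrow> 's val) \<Rightarrow> 's val \<Rightarrow> 's val" where
  "sub_val \<sigma> Star = Star"
| "sub_val \<sigma> (Succ s) = Succ s"
| "sub_val \<sigma> (Ix i) = \<sigma> i"

definition shift_val :: "nat \<Rightarrow> 's val \<Rightarrow> 's val" where
  "shift_val n = sub_val (\<lambda>i. Ix (i + n))"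

text \<open>Lifting of a simultaneous substitution under \<open>n\<close> binders.\<close>

definition up :: "nat \<Rightarrow> (nat \<Rightarrow> 's val) \<Rightarrow> nat \<Rightarrow> 's val" where
  "up n \<sigma> i = (if i < n then Ix i else shift_val n (\<sigma> (i - n)))"

definition swap01 :: "nat \<Rightarrow> nat" where
  "swap01 i = (if i = 0 then 1 else if i = 1 then 0 else i)"


section \<open>The calculus ALpi\<close>

datatype 's al =
    ALNil
  | ALPar "'s al" "'s al"
  | ALIn "'s val" "'s al"      \<comment> \<open>\<open>a(x).P\<close>: binds index 0 in \<open>P\<close>\<close>
  | ALOut "'s val" "'s val"
  | ALNu "'s al"               \<comment> \<open>binds index 0\<close>
  | ALRep "'s val" "'s al"     \<comment> \<open>\<open>!a(x).P\<close>: binds index 0 in \<open>P\<close>\<close>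

primrec al_sub :: "(nat \<Rightarrow> 's val) \<Rightarrow> 's al \<Rightarrow> 's al" where
  "al_sub \<sigma> ALNil = ALNil"
| "al_sub \<sigma> (ALPar P Q) = ALPar (al_sub \<sigma> P) (al_sub \<sigma> Q)"
| "al_sub \<sigma> (ALIn a P) = ALIn (sub_val \<sigma> a) (al_sub (up 1 \<sigma>) P)"
| "al_sub \<sigma> (ALOut a v) = ALOut (sub_val \<sigma> a) (sub_val \<sigma> v)"
| "al_sub \<sigma> (ALNu P) = ALNu (al_sub (up 1 \<sigma>) P)"
| "al_sub \<sigma> (ALRep a P) = ALRep (sub_val \<sigma> a) (al_sub (up 1 \<sigma>) P)"

definition al_shift :: "'s al \<Rightarrow> 's al" where
  "al_shift = al_sub (\<lambda>i. Ix (i + 1))"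

definition al_swap :: "'s al \<Rightarrow> 's al" where
  "al_swap = al_sub (\<lambda>i. Ix (swap01 i))"

text \<open>\<open>P{v/x}\<close>, where \<open>x\<close> is index 0 of \<open>P\<close>.\<close>

definition al_inst :: "'s val \<Rightarrow> 's al \<Rightarrow> 's al" where
  "al_inst v = al_sub (\<lambda>i. case i of 0 \<Rightarrow> v | Suc j \<Rightarrow> Ix j)"


subsection \<open>Localisation, closedness and types\<close>

definition val_fn :: "'s val \<Rightarrow> nat set" where
  "val_fn v = {i. v = Ix i}"

definition unbind :: "nat set \<Rightarrow> nat set" where
  "unbind A = {i. Suc i \<in> A}"

primrec al_fn :: "'s al \<Rightarrow> nat set" where
  "al_fn ALNil = {}"
| "al_fn (ALPar P Q) = al_fn P \<union> al_fn Q"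
| "al_fn (ALIn a P) = val_fn a \<union> unbind (al_fn P)"
| "al_fn (ALOut a v) = val_fn a \<union> val_fn v"
| "al_fn (ALNu P) = unbind (al_fn P)"
| "al_fn (ALRep a P) = val_fn a \<union> unbind (al_fn P)"

text \<open>The free names in input-subject position.\<close>

primrec al_inputs :: "'s al \<Rightarrow> nat set" where
  "al_inputs ALNil = {}"
| "al_inputs (ALPar P Q) = al_inputs P \<union> al_inputs Q"
| "al_inputs (ALIn a P) = val_fn a \<union> unbind (al_inputs P)"
| "al_inputs (ALOut a v) = {}"
| "al_inputs (ALNu P) = unbind (al_inputs P)"
| "al_inputs (ALRep a P) = val_fn a \<union> unbind (al_inputs P)"

primrec localised :: "'s al \<Rightarrow> bool" where
  "localised ALNil \<longleftrightarrow> True"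
| "localised (ALPar P Q) \<longleftrightarrow> localised P \<and> localised Q"
| "localised (ALIn a P) \<longleftrightarrow> 0 \<notin> al_inputs P \<and> localised P"
| "localised (ALOut a v) \<longleftrightarrow> True"
| "localised (ALNu P) \<longleftrightarrow> localised P"
| "localised (ALRep a P) \<longleftrightarrow> 0 \<notin> al_inputs P \<and> localised P"

text \<open>
  A typing environment assigns to a name either a value type (received names) or a type
  \<open>Both T\<close> allowing input and output of values of type \<open>T\<close> (restricted names). A name of type
  \<open>Both T\<close> can be used as a value of type \<open>OT T\<close>: only the output capability is communicated.
  Success names have type \<open>OT UnitT\<close>.
\<close>

datatype vtype = UnitT | OT vtype

datatype ntype = Val vtype | Both vtype

definition bind_type :: "ntype \<Rightarrow> (nat \<Rightarrow> ntype) \<Rightarrow> nat \<Rightarrow> ntype" where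
  "bind_type T \<Gamma> i = (case i of 0 \<Rightarrow> T | Suc j \<Rightarrow> \<Gamma> j)"

inductive val_typed :: "(nat \<Rightarrow> ntype) \<Rightarrow> 's val \<Rightarrow> vtype \<Rightarrow> bool" where
  vt_star: "val_typed \<Gamma> Star UnitT"
| vt_succ: "val_typed \<Gamma> (Succ s) (OT UnitT)"
| vt_val: "\<Gamma> i = Val T \<Longrightarrow> val_typed \<Gamma> (Ix i) T"
| vt_both: "\<Gamma> i = Both T \<Longrightarrow> val_typed \<Gamma> (Ix i) (OT T)"

inductive al_typed :: "(nat \<Rightarrow> ntype) \<Rightarrow> 's al \<Rightarrow> bool" where
  t_nil: "al_typed \<Gamma> ALNil"
| t_par: "al_typed \<Gamma> P \<Longrightarrow> al_typed \<Gamma> Q \<Longrightarrow> al_typed \<Gamma> (ALPar P Q)"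
| t_in: "\<Gamma> i = Both T \<Longrightarrow> al_typed (bind_type (Val T) \<Gamma>) P \<Longrightarrow> al_typed \<Gamma> (ALIn (Ix i) P)"
| t_out: "val_typed \<Gamma> a (OT T) \<Longrightarrow> val_typed \<Gamma> v T \<Longrightarrow> al_typed \<Gamma> (ALOut a v)"
| t_nu: "al_typed (bind_type (Both T) \<Gamma>) P \<Longrightarrow> al_typed \<Gamma> (ALNu P)"
| t_rep: "\<Gamma> i = Both T \<Longrightarrow> al_typed (bind_type (Val T) \<Gamma>) P \<Longrightarrow> al_typed \<Gamma> (ALRep (Ix i) P)"

definition al_process :: "'s al \<Rightarrow> bool" where
  "al_process P \<longleftrightarrow> localised P \<and> (\<exists>\<Gamma>. al_typed \<Gamma> P)"

text \<open>No free names except success names (which are not indices).\<close>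

definition al_closed :: "'s al \<Rightarrow> bool" where
  "al_closed P \<longleftrightarrow> al_fn P = {}"


subsection \<open>Labelled transitions\<close>

datatype 's al_act =
    LTau
  | LIn "'s val" "'s val"
  | LOut "'s val" "'s val"
  | LBOut "'s val"  \<comment> \<open>bound output: index 0 of the derivative is the extruded name,
                        and the other indices of the derivative are shifted by one\<close>

primrec is_bout :: "'s al_act \<Rightarrow> bool" where
  "is_bout LTau = False"
| "is_bout (LIn a v) = False"
| "is_bout (LOut a v) = False"
| "is_bout (LBOut a) = True"

primrec act_shift :: "'s al_act \<Rightarrow> 's al_act" where
  "act_shift LTau = LTau"
| "act_shift (LIn a v) = LIn (shift_val 1 a) (shift_val 1 v)"
| "act_shift (LOut a v) = LOut (shift_val 1 a) (shift_val 1 v)"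
| "act_shift (LBOut a) = LBOut (shift_val 1 a)"

text \<open>
  The early transition system. A shifted action does not mention index 0, so the conditions
  that the restricted name does not occur in the action are implicit in the rules for
  restriction. In \<open>res_b\<close> the two outermost indices of the derivative (the extruded and the
  restricted name) have to be exchanged.
\<close>

inductive al_lts :: "'s al \<Rightarrow> 's al_act \<Rightarrow> 's al \<Rightarrow> bool" where
  inp: "al_lts (ALIn a P) (LIn a v) (al_inst v P)"
| rep: "al_lts (ALRep a P) (LIn a v) (ALPar (al_inst v P) (ALRep a P))"
| out: "al_lts (ALOut a v) (LOut a v) ALNil"
| par1: "al_lts P \<alpha> P' \<Longrightarrow> \<not> is_bout \<alpha> \<Longrightarrow> al_lts (ALPar P Q) \<alpha> (ALPar P' Q)"
| par2: "al_lts Q \<alpha> Q' \<Longrightarrow> \<not> is_bout \<alpha> \<Longrightarrow> al_lts (ALPar P Q) \<alpha> (ALPar P Q')"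
| par1_b: "al_lts P (LBOut a) P' \<Longrightarrow> al_lts (ALPar P Q) (LBOut a) (ALPar P' (al_shift Q))"
| par2_b: "al_lts Q (LBOut a) Q' \<Longrightarrow> al_lts (ALPar P Q) (LBOut a) (ALPar (al_shift P) Q')"
| comm1: "al_lts P (LOut a v) P' \<Longrightarrow> al_lts Q (LIn a v) Q' \<Longrightarrow>
    al_lts (ALPar P Q) LTau (ALPar P' Q')"
| comm2: "al_lts P (LIn a v) P' \<Longrightarrow> al_lts Q (LOut a v) Q' \<Longrightarrow>
    al_lts (ALPar P Q) LTau (ALPar P' Q')"
| close1: "al_lts P (LBOut a) P' \<Longrightarrow> al_lts (al_shift Q) (LIn (shift_val 1 a) (Ix 0)) Q' \<Longrightarrow>
    al_lts (ALPar P Q) LTau (ALNu (ALPar P' Q'))"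
| close2: "al_lts (al_shift P) (LIn (shift_val 1 a) (Ix 0)) P' \<Longrightarrow> al_lts Q (LBOut a) Q' \<Longrightarrow>
    al_lts (ALPar P Q) LTau (ALNu (ALPar P' Q'))"
| res: "al_lts P (act_shift \<alpha>) P' \<Longrightarrow> \<not> is_bout \<alpha> \<Longrightarrow> al_lts (ALNu P) \<alpha> (ALNu P')"
| res_b: "al_lts P (LBOut (shift_val 1 a)) P' \<Longrightarrow> al_lts (ALNu P) (LBOut a) (ALNu (al_swap P'))"
| opn: "al_lts P (LOut (shift_val 1 a) (Ix 0)) P' \<Longrightarrow> al_lts (ALNu P) (LBOut a) P'"


section \<open>The calculus AWpi\<close>

text \<open>
  I-names and O-names have separate index spaces, so the requirement that I-names occur only as
  subjects of inputs and O-names only as subjects of outputs is enforced by the syntax.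
  A restriction \<open>(\<nu> a \<leftrightarrow> b)\<close> binds I-index 0 (\<open>a\<close>) and O-index 0 (\<open>b\<close>).
  An input prefix lists the kinds of its parameters; the parameters of each kind bind, in order
  of occurrence, the indices 0, 1, \<open>\<dots>\<close> of that kind. A parameter of kind \<open>KO\<close> may receive an
  O-name, a success name or the unit value.
\<close>

datatype kind = KI | KO

datatype 's wval = WI nat | WO "'s val"

datatype 's aw =
    AWNil
  | AWPar "'s aw" "'s aw"
  | AWIn nat "kind list" "'s aw"
  | AWOut "'s val" "'s wval list"
  | AWNu "'s aw"
  | AWRep nat "kind list" "'s aw"

primrec kind_of :: "'s wval \<Rightarrow> kind" where
  "kind_of (WI i) = KI"
| "kind_of (WO v) = KO"

primrec sub_wval :: "(nat \<Rightarrow> nat) \<Rightarrow> (nat \<Rightarrow> 's val) \<Rightarrow> 's wval \<Rightarrow> 's wval" where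
  "sub_wval \<rho> \<sigma> (WI i) = WI (\<rho> i)"
| "sub_wval \<rho> \<sigma> (WO v) = WO (sub_val \<sigma> v)"

definition up_i :: "nat \<Rightarrow> (nat \<Rightarrow> nat) \<Rightarrow> nat \<Rightarrow> nat" where
  "up_i n \<rho> i = (if i < n then i else \<rho> (i - n) + n)"

text \<open>Simultaneous substitution of I-names by \<open>\<rho>\<close> and of O-names by \<open>\<sigma>\<close>.\<close>

primrec aw_sub :: "(nat \<Rightarrow> nat) \<Rightarrow> (nat \<Rightarrow> 's val) \<Rightarrow> 's aw \<Rightarrow> 's aw" where
  "aw_sub \<rho> \<sigma> AWNil = AWNil"
| "aw_sub \<rho> \<sigma> (AWPar P Q) = AWPar (aw_sub \<rho> \<sigma> P) (aw_sub \<rho> \<sigma> Q)"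
| "aw_sub \<rho> \<sigma> (AWIn a ks P) =
    AWIn (\<rho> a) ks (aw_sub (up_i (count_list ks KI) \<rho>) (up (count_list ks KO) \<sigma>) P)"
| "aw_sub \<rho> \<sigma> (AWOut b vs) = AWOut (sub_val \<sigma> b) (map (sub_wval \<rho> \<sigma>) vs)"
| "aw_sub \<rho> \<sigma> (AWNu P) = AWNu (aw_sub (up_i 1 \<rho>) (up 1 \<sigma>) P)"
| "aw_sub \<rho> \<sigma> (AWRep a ks P) =
    AWRep (\<rho> a) ks (aw_sub (up_i (count_list ks KI) \<rho>) (up (count_list ks KO) \<sigma>) P)"

definition aw_shift :: "'s aw \<Rightarrow> 's aw" where
  "aw_shift = aw_sub (\<lambda>i. i + 1) (\<lambda>i. Ix (i + 1))"

definition aw_swap :: "'s aw \<Rightarrow> 's aw" where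
  "aw_swap = aw_sub swap01 (\<lambda>i. Ix (swap01 i))"

definition i_args :: "'s wval list \<Rightarrow> nat list" where
  "i_args vs = concat (map (\<lambda>v. case v of WI i \<Rightarrow> [i] | WO w \<Rightarrow> []) vs)"

definition o_args :: "'s wval list \<Rightarrow> 's val list" where
  "o_args vs = concat (map (\<lambda>v. case v of WI i \<Rightarrow> [] | WO w \<Rightarrow> [w]) vs)"

text \<open>Instantiation of the parameters of an input by the (kind-correct) values \<open>vs\<close>.\<close>

definition aw_inst :: "'s wval list \<Rightarrow> 's aw \<Rightarrow> 's aw" where
  "aw_inst vs =
    (let xs = i_args vs; ys = o_args vs in
     aw_sub (\<lambda>i. if i < length xs then xs ! i else i - length xs)
            (\<lambda>i. if i < length ys then ys ! i else Ix (i - length ys)))"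

inductive aw_cong :: "'s aw \<Rightarrow> 's aw \<Rightarrow> bool" where
  c_refl: "aw_cong P P"
| c_sym: "aw_cong P Q \<Longrightarrow> aw_cong Q P"
| c_trans: "aw_cong P Q \<Longrightarrow> aw_cong Q R \<Longrightarrow> aw_cong P R"
| c_par: "aw_cong P P' \<Longrightarrow> aw_cong Q Q' \<Longrightarrow> aw_cong (AWPar P Q) (AWPar P' Q')"
| c_in: "aw_cong P P' \<Longrightarrow> aw_cong (AWIn a ks P) (AWIn a ks P')"
| c_nu: "aw_cong P P' \<Longrightarrow> aw_cong (AWNu P) (AWNu P')"
| c_rep: "aw_cong P P' \<Longrightarrow> aw_cong (AWRep a ks P) (AWRep a ks P')"
| par_nil: "aw_cong (AWPar P AWNil) P"
| par_comm: "aw_cong (AWPar P Q) (AWPar Q P)"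
| par_assoc: "aw_cong (AWPar (AWPar P Q) R) (AWPar P (AWPar Q R))"
| nu_nil: "aw_cong (AWNu AWNil) AWNil"
| nu_swap: "aw_cong (AWNu (AWNu P)) (AWNu (AWNu (aw_swap P)))"
| nu_par: "aw_cong (AWPar (AWNu P) Q) (AWNu (AWPar P (aw_shift Q)))"

inductive aw_red :: "'s aw \<Rightarrow> 's aw \<Rightarrow> bool" where
  r_comm: "map kind_of vs = ks \<Longrightarrow>
    aw_red (AWNu (AWPar (AWIn 0 ks P) (AWPar (AWOut (Ix 0) vs) Q)))
           (AWNu (AWPar (aw_inst vs P) Q))"
| r_rep: "map kind_of vs = ks \<Longrightarrow>
    aw_red (AWNu (AWPar (AWRep 0 ks P) (AWPar (AWOut (Ix 0) vs) Q)))
           (AWNu (AWPar (AWRep 0 ks P) (AWPar (aw_inst vs P) Q)))"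
| r_par: "aw_red P P' \<Longrightarrow> aw_red (AWPar P Q) (AWPar P' Q)"
| r_nu: "aw_red P P' \<Longrightarrow> aw_red (AWNu P) (AWNu P')"
| r_cong: "aw_cong P P' \<Longrightarrow> aw_red P' Q' \<Longrightarrow> aw_cong Q' Q \<Longrightarrow> aw_red P Q"

text \<open>Output of the unit value at the success name \<open>s\<close>.\<close>

inductive aw_succ :: "'s \<Rightarrow> 's aw \<Rightarrow> 's aw \<Rightarrow> bool" for s where
  s_out: "aw_succ s (AWOut (Succ s) [WO Star]) AWNil"
| s_par: "aw_succ s P P' \<Longrightarrow> aw_succ s (AWPar P Q) (AWPar P' Q)"
| s_nu: "aw_succ s P P' \<Longrightarrow> aw_succ s (AWNu P) (AWNu P')"
| s_cong: "aw_cong P P' \<Longrightarrow> aw_succ s P' Q' \<Longrightarrow> aw_cong Q' Q \<Longrightarrow> aw_succ s P Q"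


section \<open>Weak similarity\<close>

datatype 's obs = Tau | Success 's

definition al_obs :: "'s al \<Rightarrow> 's obs \<Rightarrow> 's al \<Rightarrow> bool" where
  "al_obs P \<mu> P' =
    (case \<mu> of Tau \<Rightarrow> al_lts P LTau P' | Success s \<Rightarrow> al_lts P (LOut (Succ s) Star) P')"

definition aw_obs :: "'s aw \<Rightarrow> 's obs \<Rightarrow> 's aw \<Rightarrow> bool" where
  "aw_obs P \<mu> P' = (case \<mu> of Tau \<Rightarrow> aw_red P P' | Success s \<Rightarrow> aw_succ s P P')"

definition taus :: "('p \<Rightarrow> 's obs \<Rightarrow> 'p \<Rightarrow> bool) \<Rightarrow> 'p \<Rightarrow> 'p \<Rightarrow> bool" where
  "taus tr = (\<lambda>P P'. tr P Tau P')\<^sup>*\<^sup>*"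

definition weak :: "('p \<Rightarrow> 's obs \<Rightarrow> 'p \<Rightarrow> bool) \<Rightarrow> 'p \<Rightarrow> 's obs \<Rightarrow> 'p \<Rightarrow> bool" where
  "weak tr P \<mu> P' =
    (if \<mu> = Tau then taus tr P P'
     else (\<exists>P1 P2. taus tr P P1 \<and> tr P1 \<mu> P2 \<and> taus tr P2 P'))"

definition weak_simulation ::
  "('p \<Rightarrow> 's obs \<Rightarrow> 'p \<Rightarrow> bool) \<Rightarrow> ('q \<Rightarrow> 's obs \<Rightarrow> 'q \<Rightarrow> bool) \<Rightarrow> ('p \<Rightarrow> 'q \<Rightarrow> bool) \<Rightarrow> bool" where
  "weak_simulation tr1 tr2 S \<longleftrightarrow>
    (\<forall>P Q \<mu> P'. S P Q \<longrightarrow> tr1 P \<mu> P' \<longrightarrow> (\<exists>Q'. weak tr2 Q \<mu> Q' \<and> S P' Q'))"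

definition weakly_simulated ::
  "('p \<Rightarrow> 's obs \<Rightarrow> 'p \<Rightarrow> bool) \<Rightarrow> ('q \<Rightarrow> 's obs \<Rightarrow> 'q \<Rightarrow> bool) \<Rightarrow> 'p \<Rightarrow> 'q \<Rightarrow> bool" where
  "weakly_simulated tr1 tr2 P Q \<longleftrightarrow> (\<exists>S. weak_simulation tr1 tr2 S \<and> S P Q)"

definition sim_equiv :: "'s aw \<Rightarrow> 's al \<Rightarrow> bool" (infix "\<simeq>" 50) where
  "W \<simeq> P \<longleftrightarrow> weakly_simulated aw_obs al_obs W P \<and> weakly_simulated al_obs aw_obs P W"


section \<open>The encoding\<close>

text \<open>
  \<open>encode \<rho> f P\<close> is the encoding of \<open>P\<close> with parameter \<open>f\<close>. In the paper every ALpi name is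
  itself an O-name of AWpi; here \<open>\<rho> i\<close> is the O-index under which the ALpi name with index
  \<open>i\<close> is available in the current AWpi context, which has additional O-names. The partial map
  \<open>f\<close> takes the index of an ALpi name to an O-index (it has a finite domain in all recursive
  calls if it has one initially). When going under binders, \<open>enter r n \<rho>\<close>
  and \<open>enter_f x n f\<close> shift by the number \<open>n\<close> of new O-binders and give the values for the new
  ALpi name.
\<close>

definition shift_f :: "nat \<Rightarrow> (nat \<rightharpoonup> nat) \<Rightarrow> (nat \<rightharpoonup> nat)" where
  "shift_f n f i = map_option (\<lambda>j. j + n) (f i)"

definition enter :: "nat \<Rightarrow> nat \<Rightarrow> (nat \<Rightarrow> nat) \<Rightarrow> nat \<Rightarrow> nat" where
  "enter r n \<rho> i = (case i of 0 \<Rightarrow> r | Suc j \<Rightarrow> \<rho> j + n)"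

definition enter_f :: "nat option \<Rightarrow> nat \<Rightarrow> (nat \<rightharpoonup> nat) \<Rightarrow> (nat \<rightharpoonup> nat)" where
  "enter_f x n f i = (case i of 0 \<Rightarrow> x | Suc j \<Rightarrow> shift_f n f j)"

text \<open>Meaningful only if the subject is in the domain of \<open>f\<close>.\<close>

definition f_at :: "(nat \<rightharpoonup> nat) \<Rightarrow> 's val \<Rightarrow> nat" where
  "f_at f a = (case a of Ix i \<Rightarrow> the (f i) | _ \<Rightarrow> undefined)"

text \<open>
  The process \<open>c\<langle>A,B\<rangle> | !C(a',b').a'(x).b'(y).(c\<langle>a',b'\<rangle> | y\<langle>x\<rangle>)\<close> (outputs without
  overline; \<open>A\<close>, \<open>B\<close>, \<open>C\<close> are the I-names written with a hat in the paper) under the binders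
  \<open>(\<nu> A \<leftrightarrow> a)\<close>, \<open>(\<nu> B \<leftrightarrow> b)\<close>, \<open>(\<nu> C \<leftrightarrow> c)\<close>, of indices 2, 1 and 0, respectively. Under \<open>(a',b')\<close>, \<open>(x)\<close> and \<open>(y)\<close>, the I-indices 0 and 1
  are \<open>a'\<close> and \<open>b'\<close>, and the O-indices 0, 1 and 2 are \<open>y\<close>, \<open>x\<close> and \<open>c\<close>.
\<close>

definition handler :: "'s aw" where
  "handler =
    AWPar (AWOut (Ix 0) [WI 2, WI 1])
      (AWRep 0 [KI, KI]
        (AWIn 0 [KO]
          (AWIn 1 [KO]
            (AWPar (AWOut (Ix 2) [WI 0, WI 1]) (AWOut (Ix 0) [WO (Ix 1)])))))"

text \<open>Termination measure making \<open>!a(y).P\<close> larger than \<open>a(y).P\<close>.\<close>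

primrec al_weight :: "'s al \<Rightarrow> nat" where
  "al_weight ALNil = 0"
| "al_weight (ALPar P Q) = al_weight P + al_weight Q + 1"
| "al_weight (ALIn a P) = al_weight P + 1"
| "al_weight (ALOut a v) = 0"
| "al_weight (ALNu P) = al_weight P + 1"
| "al_weight (ALRep a P) = al_weight P + 2"

function encode :: "(nat \<Rightarrow> nat) \<Rightarrow> (nat \<rightharpoonup> nat) \<Rightarrow> 's al \<Rightarrow> 's aw" where
  "encode \<rho> f ALNil = AWNil"
| "encode \<rho> f (ALPar P Q) = AWPar (encode \<rho> f P) (encode \<rho> f Q)"
| "encode \<rho> f (ALOut a v) =
    AWOut (sub_val (\<lambda>i. Ix (\<rho> i)) a) [WO (sub_val (\<lambda>i. Ix (\<rho> i)) v)]"
| "encode \<rho> f (ALNu P) =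
    AWNu (AWNu (AWNu (AWPar (encode (enter 2 3 \<rho>) (enter_f (Some 1) 3 f) P) handler)))"
| "encode \<rho> f (ALIn a P) =
    AWNu (AWPar (AWOut (Ix (f_at f a + 1)) [WO (Ix 0)])
                (AWIn 0 [KO] (encode (enter 0 2 \<rho>) (enter_f None 2 f) P)))"
| "encode \<rho> f (ALRep a P) =
    AWNu (AWPar (AWOut (Ix 0) [WO Star])
                (AWRep 0 [KO]
                  (AWPar (AWOut (Ix 1) [WO Star])
                         (encode (\<lambda>i. \<rho> i + 2) (shift_f 2 f) (ALIn a P)))))"
  by pat_completeness auto
termination
  by (relation "measure (\<lambda>(\<rho>, f, P). al_weight P)") auto

end

theory Submission
  imports Defs "HOL-Library.Multiset"
begin

text \<open>
  A process of either calculus is flattened into a configuration, that is, a multiset of prefixed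
  atoms over globally unique names: every unguarded restriction is given its own name. For
  AWpi this is invariant under structural congruence, so the reductions of a process, which may
  use structural congruence anywhere, can be read off from the multiset, and conversely; for
  ALpi, scope extrusion disappears in the same way.

  The configuration of an encoded process is a sum of components: for every restricted name a
  relay, which is idle, waiting for a message, or holding a message; pending messages; pending
  inputs, which request a message on a fresh name; messages on their way to such an input; and
  replication servers. Only the last step of the protocol, the delivery of a message to an input,
  corresponds to a communication of ALpi; a held message and the request that it has been
  matched with are still present on the ALpi side until then. Since a relay may commit to a message
  before there is an input, the two processes need not be bisimilar, but they simulate each other:
  for the simulation of ALpi only configurations in which all relays are idle are needed.
\<close>

section \<open>Substitutions\<close>

text \<open>The obstacle on the AWpi side is \<open>r_cong\<close>: congruence may be used around
  every reduction, and \<open>nu_nil\<close> lets it create and delete restrictions. The set of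
  global names is thus not an invariant, and statements carry a finite set of names that garbage has
  to avoid. Congruence also acts below prefixes, so an atom fixes its continuation only up to
  \<open>aw_cong\<close>. Localisation makes the partial map of the encoding sufficient: a received
  name gets no entry, and none is looked up, as it is never the subject of an input. Hence
  instantiating an encoded body yields the encoding of the instance, as an equality. A server spawns
  copies of its input without any communication of ALpi, so a copy has no ALpi atom; a delivery to a
  copy is matched by the replicated input itself. Name 0 is the image of all free indices, and
  restricted names differ from it. The two simulations need different invariants: starting from AWpi
  every possible redex must be classified, which requires unique identifiers; starting from ALpi a
  single protocol run must be exhibited, and it leaves the relay idle again.\<close>

lemma sub_val_sub_val: "sub_val \<sigma> (sub_val \<tau> v) = sub_val (sub_val \<sigma> \<circ> \<tau>) v"
  by (cases v) auto

lemma sub_val_Ix [simp]: "sub_val Ix v = v"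
  by (cases v) auto

lemma shift_val_simps [simp]:
  "shift_val n Star = Star" "shift_val n (Succ s) = Succ s" "shift_val n (Ix i) = Ix (i + n)"
  by (auto simp: shift_val_def)

lemma shift_val_0 [simp]: "shift_val 0 v = v"
  by (cases v) auto

lemma shift_val_shift_val [simp]: "shift_val m (shift_val n v) = shift_val (m + n) v"
  by (cases v) auto

lemma sub_val_up_shift [simp]: "sub_val (up n \<sigma>) (shift_val n v) = shift_val n (sub_val \<sigma> v)"
  by (cases v) (auto simp: up_def)

lemma sub_val_up_up: "sub_val (up n \<sigma>) (up n \<tau> i) = up n (sub_val \<sigma> \<circ> \<tau>) i"
  by (cases "i < n") (auto simp: up_def[of n \<tau>] up_def[of n "sub_val \<sigma> \<circ> \<tau>"], simp add: up_def)

lemma up_comp: "sub_val (up n \<sigma>) \<circ> up n \<tau> = up n (sub_val \<sigma> \<circ> \<tau>)"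
  by (rule ext) (simp add: sub_val_up_up)

lemma up_i_comp: "up_i n \<rho> \<circ> up_i n \<rho>' = up_i n (\<rho> \<circ> \<rho>')"
  by (rule ext) (auto simp: up_i_def)

lemma up_Ix [simp]: "up n Ix = Ix"
  by (rule ext) (auto simp: up_def)

lemma up_i_id [simp]: "up_i n (\<lambda>i. i) = (\<lambda>i. i)"
  by (rule ext) (auto simp: up_i_def)

lemma up_0 [simp]: "up 0 \<sigma> = \<sigma>"
  by (rule ext) (auto simp: up_def)

lemma up_i_0 [simp]: "up_i 0 \<rho> = \<rho>"
  by (rule ext) (auto simp: up_i_def)

lemma up_1: "up (Suc 0) \<sigma> = case_nat (Ix 0) (\<lambda>i. shift_val 1 (\<sigma> i))"
  by (rule ext) (auto simp: up_def split: nat.split)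

lemma up_i_1: "up_i (Suc 0) \<rho> = case_nat 0 (\<lambda>i. Suc (\<rho> i))"
  by (rule ext) (auto simp: up_i_def split: nat.split)

lemma up_up: "up m (up n \<sigma>) = up (m + n) \<sigma>"
  by (rule ext) (auto simp: up_def)

lemma up_i_up_i: "up_i m (up_i n \<rho>) = up_i (m + n) \<rho>"
  by (rule ext) (auto simp: up_i_def)

lemma sub_val_case_nat_shift [simp]: "sub_val (case_nat u \<sigma>) (shift_val (Suc 0) v) = sub_val \<sigma> v"
  by (cases v) auto

text \<open>The shape in which a lifted substitution meets an environment extended by a global name,
  when \<open>conf_sub\<close> and \<open>aconf_sub\<close> pass a restriction.\<close>

lemma case_nat_comp_up: "sub_val (case_nat u \<sigma>) \<circ> up 1 \<tau> = case_nat u (sub_val \<sigma> \<circ> \<tau>)"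
  by (rule ext) (auto simp: up_1 split: nat.split)

lemma case_nat_comp_up_i: "case_nat g \<eta> \<circ> up_i 1 \<rho> = case_nat g (\<eta> \<circ> \<rho>)"
  by (rule ext) (auto simp: up_i_1 split: nat.split)

lemma case_nat_swap01: "case_nat x (case_nat y \<eta>) (swap01 i) = case_nat y (case_nat x \<eta>) i"
  by (auto simp: swap01_def split: nat.split)

lemma al_sub_al_sub: "al_sub \<sigma> (al_sub \<tau> P) = al_sub (sub_val \<sigma> \<circ> \<tau>) P"
  by (induction P arbitrary: \<sigma> \<tau>) (simp_all add: sub_val_sub_val up_comp)

lemma al_sub_Ix [simp]: "al_sub Ix P = P"
  by (induction P) auto

lemma sub_wval_sub_wval:
  "sub_wval \<eta> \<zeta> (sub_wval \<rho> \<sigma> v) = sub_wval (\<eta> \<circ> \<rho>) (sub_val \<zeta> \<circ> \<sigma>) v"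
  by (cases v) (auto simp: sub_val_sub_val)

lemma sub_wval_comp: "sub_wval \<eta> \<zeta> \<circ> sub_wval \<rho> \<sigma> = sub_wval (\<eta> \<circ> \<rho>) (sub_val \<zeta> \<circ> \<sigma>)"
  by (rule ext) (simp add: sub_wval_sub_wval)

lemma sub_wval_id [simp]: "sub_wval (\<lambda>i. i) Ix = (\<lambda>v. v)"
proof
  show "sub_wval (\<lambda>i. i) Ix v = v" for v :: "'s wval" by (cases v) auto
qed

lemma aw_sub_aw_sub:
  "aw_sub \<eta> \<zeta> (aw_sub \<rho> \<sigma> P) = aw_sub (\<eta> \<circ> \<rho>) (sub_val \<zeta> \<circ> \<sigma>) P"
  by (induction P arbitrary: \<eta> \<zeta> \<rho> \<sigma>)
     (simp_all add: sub_val_sub_val up_comp up_i_comp sub_wval_sub_wval)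

lemma aw_sub_id [simp]: "aw_sub (\<lambda>i. i) Ix P = P"
  by (induction P) auto

lemma kind_of_sub_wval [simp]: "kind_of (sub_wval \<rho> \<sigma> v) = kind_of v"
  by (cases v) auto

lemma map_kind_of_sub [simp]: "map (kind_of \<circ> sub_wval \<rho> \<sigma>) vs = map kind_of vs"
  by simp

lemma args_sub:
  "i_args (map (sub_wval \<rho> \<sigma>) vs) = map \<rho> (i_args vs)"
  "o_args (map (sub_wval \<rho> \<sigma>) vs) = map (sub_val \<sigma>) (o_args vs)"
  by (induction vs) (auto simp: i_args_def o_args_def split: wval.split)

lemma length_args:
  "length (i_args vs) = count_list (map kind_of vs) KI"
  "length (o_args vs) = count_list (map kind_of vs) KO"
  by (induction vs) (auto simp: i_args_def o_args_def split: wval.split)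

text \<open>Matching kinds make the numbers of I- and O-arguments equal to the numbers of indices
  bound by the prefix, so that lifting by \<open>count_list\<close> and instantiation by list
  position fit together.\<close>

lemma aw_sub_aw_inst:
  assumes "map kind_of vs = ks"
  shows "aw_sub \<eta> \<zeta> (aw_inst vs P) =
    aw_inst (map (sub_wval \<eta> \<zeta>) vs) (aw_sub (up_i (count_list ks KI) \<eta>) (up (count_list ks KO) \<zeta>) P)"
proof -
  have l: "count_list ks KI = length (i_args vs)" "count_list ks KO = length (o_args vs)"
    using assms by (auto simp: length_args)
  have "sub_val (\<lambda>i. if i < n then ys ! i else Ix (i - n)) (shift_val n v) = v"
    for n and ys :: "'a val list" and v
    by (cases v) auto
  then show ?thesis
    unfolding aw_inst_def Let_def l aw_sub_aw_sub args_sub length_map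
    by (intro arg_cong2[where f = "\<lambda>x y. aw_sub x y P"] ext) (auto simp: up_i_def up_def)
qed

lemma al_sub_al_inst: "al_sub \<sigma> (al_inst v P) = al_inst (sub_val \<sigma> v) (al_sub (up 1 \<sigma>) P)"
  unfolding al_inst_def al_sub_al_sub
  by (rule arg_cong[where f = "\<lambda>x. al_sub x P"], rule ext)
     (auto simp: up_1 shift_val_def sub_val_sub_val comp_def split: nat.split)

lemma swap01_swap01 [simp]: "swap01 (swap01 i) = i"
  by (auto simp: swap01_def)

lemma aw_sub_aw_shift: "aw_sub \<eta> \<zeta> (aw_shift P) = aw_sub (\<lambda>i. \<eta> (Suc i)) (\<lambda>i. \<zeta> (Suc i)) P"
  by (simp add: aw_shift_def aw_sub_aw_sub comp_def)

lemma aw_shift_aw_sub: "aw_shift (aw_sub \<eta> \<zeta> P) = aw_sub (up_i 1 \<eta>) (up 1 \<zeta>) (aw_shift P)"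
  by (simp add: aw_shift_def aw_sub_aw_sub comp_def up_1 up_i_1 shift_val_def)

lemma aw_swap_aw_sub:
  "aw_swap (aw_sub (up_i 1 (up_i 1 \<eta>)) (up 1 (up 1 \<zeta>)) P) =
   aw_sub (up_i 1 (up_i 1 \<eta>)) (up 1 (up 1 \<zeta>)) (aw_swap P)"
proof -
  have "sub_val (\<lambda>i. Ix (swap01 i)) (shift_val (Suc (Suc 0)) v) = shift_val (Suc (Suc 0)) v"
    for v :: "'a val"
    by (cases v) (auto simp: swap01_def)
  note [simp] = this[unfolded swap01_def]
  show ?thesis
    unfolding aw_swap_def aw_sub_aw_sub up_up up_i_up_i
    by (intro arg_cong2[where f = "\<lambda>x y. aw_sub x y P"] ext)
       (auto simp: up_i_def up_def swap01_def)
qed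

text \<open>Atoms store continuations after substitution of the environment, whereas
  \<open>c_in\<close> and \<open>c_rep\<close> relate them before it; this bridges the two.\<close>

lemma aw_cong_aw_sub: "aw_cong P Q \<Longrightarrow> aw_cong (aw_sub \<rho> \<sigma> P) (aw_sub \<rho> \<sigma> Q)"
proof (induction arbitrary: \<rho> \<sigma> rule: aw_cong.induct)
  case (nu_swap P)
  show ?case
    using aw_cong.nu_swap[of "aw_sub (up_i 1 (up_i 1 \<rho>)) (up 1 (up 1 \<sigma>)) P"]
    by (simp only: aw_sub.simps aw_swap_aw_sub)
next
  case (nu_par P Q)
  show ?case
    using aw_cong.nu_par[of "aw_sub (up_i 1 \<rho>) (up 1 \<sigma>) P" "aw_sub \<rho> \<sigma> Q"]
    by (simp only: aw_sub.simps aw_shift_aw_sub)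
next
  case (c_trans P Q R)
  then show ?case
    by (blast intro: aw_cong.c_trans)
qed (auto intro: aw_cong.intros)

section \<open>Configurations of AWpi processes\<close>

text \<open>
  \<open>conf \<eta> \<zeta> P X M\<close>: under the environments \<open>\<eta>\<close> and \<open>\<zeta>\<close> for I- and O-names, with the global
  names \<open>X\<close> given to its unguarded restrictions, \<open>P\<close> consists of the atoms \<open>M\<close>. Continuations
  are determined only up to structural congruence, so that congruent processes have the same
  \<open>M\<close>; \<open>X\<close> can differ by the names of restrictions that are garbage.
\<close>

inductive conf ::
  "(nat \<Rightarrow> nat) \<Rightarrow> (nat \<Rightarrow> 's val) \<Rightarrow> 's aw \<Rightarrow> nat set \<Rightarrow> 's aw multiset \<Rightarrow> bool" where
  conf_nil: "conf \<eta> \<zeta> AWNil {} {#}"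
| conf_par: "conf \<eta> \<zeta> P X M \<Longrightarrow> conf \<eta> \<zeta> Q Y N \<Longrightarrow> X \<inter> Y = {} \<Longrightarrow>
    conf \<eta> \<zeta> (AWPar P Q) (X \<union> Y) (M + N)"
| conf_nu: "conf (case_nat g \<eta>) (case_nat (Ix g) \<zeta>) P X M \<Longrightarrow> g \<notin> X \<Longrightarrow>
    conf \<eta> \<zeta> (AWNu P) (insert g X) M"
| conf_out: "conf \<eta> \<zeta> (AWOut b vs) {} {#AWOut (sub_val \<zeta> b) (map (sub_wval \<eta> \<zeta>) vs)#}"
| conf_in: "aw_cong (aw_sub (up_i (count_list ks KI) \<eta>) (up (count_list ks KO) \<zeta>) P) Q \<Longrightarrow>
    conf \<eta> \<zeta> (AWIn a ks P) {} {#AWIn (\<eta> a) ks Q#}"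
| conf_rep: "aw_cong (aw_sub (up_i (count_list ks KI) \<eta>) (up (count_list ks KO) \<zeta>) P) Q \<Longrightarrow>
    conf \<eta> \<zeta> (AWRep a ks P) {} {#AWRep (\<eta> a) ks Q#}"

inductive_simps conf_simps:
  "conf \<eta> \<zeta> AWNil X M"
  "conf \<eta> \<zeta> (AWPar P Q) X M"
  "conf \<eta> \<zeta> (AWNu P) X M"
  "conf \<eta> \<zeta> (AWOut b vs) X M"
  "conf \<eta> \<zeta> (AWIn a ks P) X M"
  "conf \<eta> \<zeta> (AWRep a ks P) X M"

text \<open>Atoms contain the environment already substituted, so a substitution can be absorbed
  into the environment without any change of names or atoms.\<close>

lemma conf_sub:
  "conf \<eta> \<zeta> (aw_sub \<rho> \<sigma> P) X M \<longleftrightarrow> conf (\<eta> \<circ> \<rho>) (sub_val \<zeta> \<circ> \<sigma>) P X M"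
  by (induction P arbitrary: \<eta> \<zeta> \<rho> \<sigma> X M)
     (simp_all add: conf_simps aw_sub_aw_sub up_comp up_i_comp sub_val_sub_val sub_wval_sub_wval
        case_nat_comp_up[simplified] case_nat_comp_up_i[simplified] sub_wval_comp)

text \<open>With identity environments, a continuation taken out of an atom can be decomposed
  without knowing where the atom came from.\<close>

lemma conf_iff_conf_id: "conf \<eta> \<zeta> P X M \<longleftrightarrow> conf (\<lambda>i. i) Ix (aw_sub \<eta> \<zeta> P) X M"
  by (simp add: conf_sub) (simp add: comp_def)

lemma conf_aw_shift [simp]:
  "conf (case_nat g \<eta>) (case_nat u \<zeta>) (aw_shift Q) X M \<longleftrightarrow> conf \<eta> \<zeta> Q X M"
  by (simp add: aw_shift_def conf_sub) (simp add: comp_def)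

lemma conf_finite: "conf \<eta> \<zeta> P X M \<Longrightarrow> finite X"
  by (induction rule: conf.induct) auto

text \<open>The set \<open>F\<close> makes the relation compositional: names that \<open>P'\<close>
  has in excess of \<open>X\<close> can be kept away from any finite set in use elsewhere. Equality
  of the name sets would fail for \<open>nu_nil\<close>.\<close>

definition conf_le :: "'s aw \<Rightarrow> 's aw \<Rightarrow> bool" where
  "conf_le P P' \<longleftrightarrow> (\<forall>\<eta> \<zeta> X M F. finite F \<longrightarrow> conf \<eta> \<zeta> P X M \<longrightarrow>
     (\<exists>X'. conf \<eta> \<zeta> P' X' M \<and> X' \<inter> F \<subseteq> X))"

lemma conf_leI:
  assumes "\<And>\<eta> \<zeta> X M. conf \<eta> \<zeta> P X M \<Longrightarrow> conf \<eta> \<zeta> P' X M"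
  shows "conf_le P P'"
  using assms unfolding conf_le_def by blast

lemma conf_leD:
  assumes "conf_le P P'" "finite F" "conf \<eta> \<zeta> P X M"
  obtains X' where "conf \<eta> \<zeta> P' X' M" "X' \<inter> F \<subseteq> X"
  using assms unfolding conf_le_def by blast

lemma conf_le_refl: "conf_le P P"
  by (rule conf_leI)

lemma conf_le_trans: "conf_le P Q \<Longrightarrow> conf_le Q R \<Longrightarrow> conf_le P R"
  unfolding conf_le_def by (meson order_trans le_inf_iff Int_lower2)

lemma conf_le_par:
  assumes "conf_le P P'" "conf_le Q Q'"
  shows "conf_le (AWPar P Q) (AWPar P' Q')"
  unfolding conf_le_def
proof (intro allI impI)
  fix \<eta> \<zeta> X M and F :: "nat set"
  assume F: "finite F" and "conf \<eta> \<zeta> (AWPar P Q) X M"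
  then obtain X1 M1 X2 M2 where
    c: "conf \<eta> \<zeta> P X1 M1" "conf \<eta> \<zeta> Q X2 M2" "X1 \<inter> X2 = {}" "X = X1 \<union> X2" "M = M1 + M2"
    by (auto simp: conf_simps)
  \<comment> \<open>The new names on the left are chosen first, away from the old ones on the right;
    then those on the right, away from the new ones on the left. A common name would have to lie in
    both \<open>X1\<close> and \<open>X2\<close>.\<close>
  obtain X1' where 1: "conf \<eta> \<zeta> P' X1' M1" "X1' \<inter> (F \<union> X2) \<subseteq> X1"
    using conf_leD[OF assms(1) _ c(1), of "F \<union> X2"] F c(2) conf_finite by blast
  obtain X2' where 2: "conf \<eta> \<zeta> Q' X2' M2" "X2' \<inter> (F \<union> X1') \<subseteq> X2"
    using conf_leD[OF assms(2) _ c(2), of "F \<union> X1'"] F 1(1) conf_finite by blast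
  have "X1' \<inter> X2' = {}"
    using 1(2) 2(2) c(3) by blast
  then have "conf \<eta> \<zeta> (AWPar P' Q') (X1' \<union> X2') M"
    unfolding c using 1(1) 2(1) by (blast intro: conf_par)
  moreover have "(X1' \<union> X2') \<inter> F \<subseteq> X"
    unfolding c using 1(2) 2(2) by blast
  ultimately show "\<exists>X'. conf \<eta> \<zeta> (AWPar P' Q') X' M \<and> X' \<inter> F \<subseteq> X"
    by blast
qed

lemma conf_le_nu:
  assumes "conf_le P P'"
  shows "conf_le (AWNu P) (AWNu P')"
  unfolding conf_le_def
proof (intro allI impI)
  fix \<eta> \<zeta> X M and F :: "nat set"
  assume F: "finite F" and "conf \<eta> \<zeta> (AWNu P) X M"
  then obtain g Y where
    c: "conf (case_nat g \<eta>) (case_nat (Ix g) \<zeta>) P Y M" "g \<notin> Y" "X = insert g Y"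
    by (auto simp: conf_simps)
  obtain Y' where 1: "conf (case_nat g \<eta>) (case_nat (Ix g) \<zeta>) P' Y' M" "Y' \<inter> (insert g F) \<subseteq> Y"
    using conf_leD[OF assms _ c(1), of "insert g F"] F by blast
  then have "conf \<eta> \<zeta> (AWNu P') (insert g Y') M"
    using c by (blast intro: conf_nu)
  moreover have "insert g Y' \<inter> F \<subseteq> X"
    using 1 c by blast
  ultimately show "\<exists>X'. conf \<eta> \<zeta> (AWNu P') X' M \<and> X' \<inter> F \<subseteq> X"
    by blast
qed

lemma case_nat_comp_swap:
  "case_nat g (case_nat h \<eta>) \<circ> swap01 = case_nat h (case_nat g \<eta>)"
  by (rule ext) (simp add: case_nat_swap01)

lemma aw_swap_aw_swap [simp]: "aw_swap (aw_swap P) = P"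
  by (simp add: aw_swap_def aw_sub_aw_sub comp_def)

lemma conf_aw_swap:
  "conf (case_nat g (case_nat h \<eta>)) (case_nat (Ix g) (case_nat (Ix h) \<zeta>)) (aw_swap P) X M \<longleftrightarrow>
   conf (case_nat h (case_nat g \<eta>)) (case_nat (Ix h) (case_nat (Ix g) \<zeta>)) P X M"
  by (simp add: aw_swap_def conf_sub case_nat_comp_swap) (simp add: comp_def case_nat_swap01)

lemma conf_nu_swap:
  assumes "conf \<eta> \<zeta> (AWNu (AWNu P)) X M"
  shows "conf \<eta> \<zeta> (AWNu (AWNu (aw_swap P))) X M"
proof -
  obtain g h Y where
    c: "conf (case_nat g (case_nat h \<eta>)) (case_nat (Ix g) (case_nat (Ix h) \<zeta>)) P Y M"
    and n: "h \<notin> Y" "g \<notin> insert h Y" "X = insert g (insert h Y)"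
    using assms by (auto simp: conf_simps)
  have "conf (case_nat h (case_nat g \<eta>)) (case_nat (Ix h) (case_nat (Ix g) \<zeta>)) (aw_swap P) Y M"
    using c by (simp only: conf_aw_swap)
  then show ?thesis
    unfolding n by (intro conf_nu n)
qed

text \<open>Scope extrusion keeps the global name \<open>g\<close>: the shift of \<open>Q\<close>
  skips exactly the index that the extended environment maps to \<open>g\<close>.\<close>

lemma conf_nu_par:
  "conf \<eta> \<zeta> (AWPar (AWNu P) Q) X M \<longleftrightarrow> conf \<eta> \<zeta> (AWNu (AWPar P (aw_shift Q))) X M"
proof
  assume "conf \<eta> \<zeta> (AWPar (AWNu P) Q) X M"
  then obtain g X1 M1 X2 M2 where
    c: "conf (case_nat g \<eta>) (case_nat (Ix g) \<zeta>) P X1 M1" "conf \<eta> \<zeta> Q X2 M2"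
    and n: "g \<notin> X1" "insert g X1 \<inter> X2 = {}" "X = insert g X1 \<union> X2" "M = M1 + M2"
    by (auto simp: conf_simps)
  have "conf \<eta> \<zeta> (AWNu (AWPar P (aw_shift Q))) (insert g (X1 \<union> X2)) (M1 + M2)"
    using c n by (intro conf_nu conf_par) auto
  then show "conf \<eta> \<zeta> (AWNu (AWPar P (aw_shift Q))) X M"
    using n by simp
next
  assume "conf \<eta> \<zeta> (AWNu (AWPar P (aw_shift Q))) X M"
  then obtain g X1 M1 X2 M2 where
    c: "conf (case_nat g \<eta>) (case_nat (Ix g) \<zeta>) P X1 M1" "conf \<eta> \<zeta> Q X2 M2"
    and n: "g \<notin> X1 \<union> X2" "X1 \<inter> X2 = {}" "X = insert g (X1 \<union> X2)" "M = M1 + M2"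
    by (force simp: conf_simps)
  have "conf \<eta> \<zeta> (AWPar (AWNu P) Q) (insert g X1 \<union> X2) (M1 + M2)"
    using c n by (intro conf_nu conf_par) auto
  then show "conf \<eta> \<zeta> (AWPar (AWNu P) Q) X M"
    using n by simp
qed

lemma conf_nu_nil: "conf_le AWNil (AWNu AWNil)" "conf_le (AWNu AWNil) AWNil"
proof -
  show "conf_le AWNil (AWNu AWNil)"
    unfolding conf_le_def
  proof (intro allI impI)
    fix \<eta> \<zeta> X M and F :: "nat set"
    assume "finite F" "conf \<eta> \<zeta> AWNil X M"
    \<comment> \<open>The new restriction guards no atom, so any name outside \<open>F\<close> can
      be given to it.\<close>
    moreover obtain g where "g \<notin> F"
      using ex_new_if_finite[OF infinite_UNIV_nat \<open>finite F\<close>] by blast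
    ultimately show "\<exists>X'. conf \<eta> \<zeta> (AWNu AWNil) X' M \<and> X' \<inter> F \<subseteq> X"
      by (intro exI[of _ "{g}"]) (auto simp: conf_simps)
  qed
qed (auto simp: conf_le_def conf_simps)

text \<open>Proving both directions at once makes \<open>c_sym\<close> trivial. Congruence under a
  prefix is absorbed by the rules \<open>conf_in\<close> and \<open>conf_rep\<close>; among the
  axioms, only \<open>nu_nil\<close> affects the set of names.\<close>

lemma conf_cong_le: "aw_cong P Q \<Longrightarrow> conf_le P Q \<and> conf_le Q P"
proof (induction rule: aw_cong.induct)
  case (c_in P P' a ks)
  have "conf_le (AWIn a ks P) (AWIn a ks Q)" if "aw_cong P Q" for P Q :: "'a aw"
    unfolding conf_le_def conf_simps
    using aw_cong_aw_sub[OF c_sym[OF that]] by (metis c_trans inf_le1)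
  with c_in show ?case
    by (blast intro: c_sym)
next
  case (c_rep P P' a ks)
  have "conf_le (AWRep a ks P) (AWRep a ks Q)" if "aw_cong P Q" for P Q :: "'a aw"
    unfolding conf_le_def conf_simps
    using aw_cong_aw_sub[OF c_sym[OF that]] by (metis c_trans inf_le1)
  with c_rep show ?case
    by (blast intro: c_sym)
next
  case (par_comm P Q)
  have "conf_le (AWPar P Q) (AWPar Q P)" for P Q :: "'a aw"
  proof (rule conf_leI)
    fix \<eta> \<zeta> X M
    assume "conf \<eta> \<zeta> (AWPar P Q) X M"
    then obtain X1 M1 X2 M2 where
      c: "conf \<eta> \<zeta> P X1 M1" "conf \<eta> \<zeta> Q X2 M2" "X1 \<inter> X2 = {}" "X = X1 \<union> X2" "M = M1 + M2"
      by (auto simp: conf_simps)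
    then have "X2 \<inter> X1 = {}" "X = X2 \<union> X1" "M = M2 + M1"
      by (auto simp: add.commute)
    with c(1,2) show "conf \<eta> \<zeta> (AWPar Q P) X M"
      by (simp add: conf_par)
  qed
  then show ?case
    by blast
next
  case (par_assoc P Q R)
  have "conf_le (AWPar (AWPar P Q) R) (AWPar P (AWPar Q R))"
  proof (rule conf_leI)
    fix \<eta> \<zeta> X M
    assume "conf \<eta> \<zeta> (AWPar (AWPar P Q) R) X M"
    then obtain X1 M1 X2 M2 X3 M3 where
      c: "conf \<eta> \<zeta> P X1 M1" "conf \<eta> \<zeta> Q X2 M2" "conf \<eta> \<zeta> R X3 M3"
      and n: "(X1 \<union> X2) \<inter> X3 = {}" "X1 \<inter> X2 = {}" "X = X1 \<union> X2 \<union> X3" "M = M1 + M2 + M3"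
      by (auto simp: conf_simps)
    have "conf \<eta> \<zeta> (AWPar P (AWPar Q R)) (X1 \<union> (X2 \<union> X3)) (M1 + (M2 + M3))"
      using c n by (intro conf_par) auto
    then show "conf \<eta> \<zeta> (AWPar P (AWPar Q R)) X M"
      using n by (simp add: Un_assoc add.assoc)
  qed
  moreover have "conf_le (AWPar P (AWPar Q R)) (AWPar (AWPar P Q) R)"
  proof (rule conf_leI)
    fix \<eta> \<zeta> X M
    assume "conf \<eta> \<zeta> (AWPar P (AWPar Q R)) X M"
    then obtain X1 M1 X2 M2 X3 M3 where
      c: "conf \<eta> \<zeta> P X1 M1" "conf \<eta> \<zeta> Q X2 M2" "conf \<eta> \<zeta> R X3 M3"
      and n: "X1 \<inter> (X2 \<union> X3) = {}" "X2 \<inter> X3 = {}" "X = X1 \<union> (X2 \<union> X3)" "M = M1 + (M2 + M3)"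
      by (auto simp: conf_simps)
    have "conf \<eta> \<zeta> (AWPar (AWPar P Q) R) (X1 \<union> X2 \<union> X3) (M1 + M2 + M3)"
      using c n by (intro conf_par) auto
    then show "conf \<eta> \<zeta> (AWPar (AWPar P Q) R) X M"
      using n by (simp add: Un_assoc add.assoc)
  qed
  ultimately show ?case
    by blast
next
  case (nu_swap P)
  have "conf_le (AWNu (AWNu Q)) (AWNu (AWNu (aw_swap Q)))" for Q :: "'a aw"
    by (blast intro: conf_leI conf_nu_swap)
  from this[of P] this[of "aw_swap P"] show ?case
    by simp
next
  case (nu_par P Q)
  show ?case
    by (blast intro: conf_leI conf_nu_par[THEN iffD1] conf_nu_par[THEN iffD2])
next
  case (par_nil P)
  show ?case
    by (auto intro!: conf_leI simp: conf_simps)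
next
  case (c_trans P Q R)
  then show ?case by (blast intro: conf_le_trans)
qed (auto intro: conf_le_par conf_le_nu conf_nu_nil simp: conf_le_refl)

lemma conf_cong:
  assumes "conf \<eta> \<zeta> P X M" "aw_cong P Q" "finite F"
  obtains X' where "conf \<eta> \<zeta> Q X' M" "X' \<inter> F \<subseteq> X"
  using conf_cong_le assms conf_leD by meson

section \<open>Reductions and redexes in AWpi\<close>

text \<open>\<open>R\<close> is what remains next to the continuation and keeps a replicated input.
  The continuation \<open>Q\<close> is not yet decomposed, because its restrictions receive names
  only later, through \<open>residual\<close>.\<close>

inductive redex :: "nat \<Rightarrow> 's aw multiset \<Rightarrow> 's wval list \<Rightarrow> 's aw \<Rightarrow> 's aw multiset \<Rightarrow> bool" where
  redex_in: "map kind_of vs = ks \<Longrightarrow>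
    redex g (add_mset (AWIn g ks Q) (add_mset (AWOut (Ix g) vs) R)) vs Q R"
| redex_rep: "map kind_of vs = ks \<Longrightarrow>
    redex g (add_mset (AWRep g ks Q) (add_mset (AWOut (Ix g) vs) R)) vs Q (add_mset (AWRep g ks Q) R)"

lemma redex_union: "redex g M vs Q R \<Longrightarrow> redex g (M + N) vs Q (R + N)"
  by (induction rule: redex.induct) (auto intro: redex.intros)

lemma aw_cong_aw_inst: "aw_cong P Q \<Longrightarrow> aw_cong (aw_inst vs P) (aw_inst vs Q)"
  by (simp add: aw_inst_def Let_def aw_cong_aw_sub)

text \<open>Names chosen for the instance of the continuation stored in an atom are transferred to
  the instance in the process itself; the two differ by a congruence, hence possibly by
  garbage.\<close>

lemma conf_aw_inst:
  assumes "aw_cong (aw_sub (up_i (count_list ks KI) \<eta>) (up (count_list ks KO) \<zeta>) P) Q"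
    and "map kind_of vs = ks" "finite F"
    and "conf (\<lambda>i. i) Ix (aw_inst (map (sub_wval \<eta> \<zeta>) vs) Q) X M"
  obtains X' where "conf \<eta> \<zeta> (aw_inst vs P) X' M" "X' \<inter> F \<subseteq> X"
proof -
  obtain X' where "conf (\<lambda>i. i) Ix (aw_inst (map (sub_wval \<eta> \<zeta>) vs)
      (aw_sub (up_i (count_list ks KI) \<eta>) (up (count_list ks KO) \<zeta>) P)) X' M" "X' \<inter> F \<subseteq> X"
    using conf_cong[OF assms(4) aw_cong_aw_inst[OF c_sym[OF assms(1)]] assms(3)] by blast
  then show ?thesis
    using that conf_iff_conf_id[of \<eta> \<zeta> "aw_inst vs P"] by (simp add: aw_sub_aw_inst[OF assms(2)])
qed

text \<open>
  \<open>P'\<close> is the rest \<open>R\<close> together with the instantiated continuation \<open>Q\<close>, for every choice of the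
  names of the restrictions of \<open>Q\<close> outside of a finite set \<open>G\<close>. Names of \<open>F\<close> are not used for
  garbage.
\<close>

definition residual ::
  "(nat \<Rightarrow> nat) \<Rightarrow> (nat \<Rightarrow> 's val) \<Rightarrow> nat set \<Rightarrow> 's wval list \<Rightarrow> 's aw \<Rightarrow> 's aw multiset \<Rightarrow> 's aw \<Rightarrow> nat set \<Rightarrow> bool"
  where
  "residual \<eta> \<zeta> X vs Q R P' F \<longleftrightarrow> (\<exists>G. finite G \<and> (\<forall>Y N. conf (\<lambda>i. i) Ix (aw_inst vs Q) Y N \<longrightarrow>
     Y \<inter> G = {} \<longrightarrow> (\<exists>X'. conf \<eta> \<zeta> P' X' (R + N) \<and> X' \<inter> F \<subseteq> X)))"

lemma residualI:
  assumes "finite G"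
    and "\<And>Y N. conf (\<lambda>i. i) Ix (aw_inst vs Q) Y N \<Longrightarrow> Y \<inter> G = {} \<Longrightarrow>
      \<exists>X'. conf \<eta> \<zeta> P' X' (R + N) \<and> X' \<inter> F \<subseteq> X"
  shows "residual \<eta> \<zeta> X vs Q R P' F"
  using assms unfolding residual_def by blast

lemma residualE:
  assumes "residual \<eta> \<zeta> X vs Q R P' F"
  obtains G where "finite G"
    and "\<And>Y N. conf (\<lambda>i. i) Ix (aw_inst vs Q) Y N \<Longrightarrow> Y \<inter> G = {} \<Longrightarrow>
      \<exists>X'. conf \<eta> \<zeta> P' X' (R + N) \<and> X' \<inter> F \<subseteq> X"
  using assms unfolding residual_def by blast

text \<open>Covers both reduction axioms: the continuation stands either in front of the remainder
  or behind a component \<open>T\<close> of it, which is where \<open>r_rep\<close> leaves the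
  replicated input.\<close>

lemma residual_base:
  assumes c: "aw_cong (aw_sub (up_i (count_list ks KI) (case_nat g \<eta>))
        (up (count_list ks KO) (case_nat (Ix g) \<zeta>)) P) Q" "map kind_of vs = ks"
    and R: "conf (case_nat g \<eta>) (case_nat (Ix g) \<zeta>) S X R" "g \<notin> X" and F: "finite F"
    and eq: "P' = AWNu (AWPar (aw_inst vs P) S) \<or> (\<exists>T. P' = AWNu (AWPar T (AWPar (aw_inst vs P) S')) \<and> S = AWPar T S')"
  shows "residual \<eta> \<zeta> (insert g X) (map (sub_wval (case_nat g \<eta>) (case_nat (Ix g) \<zeta>)) vs) Q R P' F"
proof (rule residualI[of "insert g (X \<union> F)"])
  show "finite (insert g (X \<union> F))"
    using F R conf_finite by blast
next
  fix Y N
  assume Y: "conf (\<lambda>i. i) Ix (aw_inst (map (sub_wval (case_nat g \<eta>) (case_nat (Ix g) \<zeta>)) vs) Q) Y N"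
    "Y \<inter> insert g (X \<union> F) = {}"
  have fin: "finite (insert g (X \<union> F))"
    using F R conf_finite by blast
  obtain Y' where Y': "conf (case_nat g \<eta>) (case_nat (Ix g) \<zeta>) (aw_inst vs P) Y' N"
    "Y' \<inter> insert g (X \<union> F) \<subseteq> Y"
    using conf_aw_inst[OF c fin Y(1)] by blast
  with Y(2) have d: "Y' \<inter> X = {}" "g \<notin> Y'" "Y' \<inter> F = {}"
    by blast+
  have 1: "conf \<eta> \<zeta> (AWNu (AWPar (aw_inst vs P) S)) (insert g (Y' \<union> X)) (N + R)"
    using Y'(1) R d by (intro conf_nu conf_par) auto
  moreover have "conf \<eta> \<zeta> (AWNu (AWPar T (AWPar (aw_inst vs P) S'))) (insert g (Y' \<union> X)) (N + R)"
    if S: "S = AWPar T S'" for T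
  proof -
    obtain X1 M1 X2 M2 where "conf (case_nat g \<eta>) (case_nat (Ix g) \<zeta>) T X1 M1"
      "conf (case_nat g \<eta>) (case_nat (Ix g) \<zeta>) S' X2 M2" "X = X1 \<union> X2" "R = M1 + M2" "X1 \<inter> X2 = {}"
      using R(1) unfolding S by (auto simp: conf_simps)
    then have "conf \<eta> \<zeta> (AWNu (AWPar T (AWPar (aw_inst vs P) S'))) (insert g (X1 \<union> (Y' \<union> X2))) (M1 + (N + M2))"
      using Y'(1) R(2) d by (intro conf_nu conf_par) auto
    then show ?thesis
      using \<open>X = X1 \<union> X2\<close> \<open>R = M1 + M2\<close> by (simp add: ac_simps)
  qed
  ultimately have "conf \<eta> \<zeta> P' (insert g (Y' \<union> X)) (R + N)"
    using eq by (auto simp: add.commute)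
  moreover have "insert g (Y' \<union> X) \<inter> F \<subseteq> insert g X"
    using d by blast
  ultimately show "\<exists>X'. conf \<eta> \<zeta> P' X' (R + N) \<and> X' \<inter> F \<subseteq> insert g X"
    by blast
qed

text \<open>The restriction that an axiom requires around its redex turns into the common subject
  \<open>g\<close> of two atoms. The case \<open>r_cong\<close> adds no names inside
  \<open>F\<close>, so the induction passes through it with the same redex.\<close>

lemma aw_red_redex:
  assumes "aw_red P P'" "conf \<eta> \<zeta> P X M" "finite F"
  shows "\<exists>g vs Q R. redex g M vs Q R \<and> residual \<eta> \<zeta> X vs Q R P' F"
  using assms
proof (induction arbitrary: \<eta> \<zeta> X M F rule: aw_red.induct)
  case (r_comm vs ks P S)
  then obtain g Y where
    Y: "conf (case_nat g \<eta>) (case_nat (Ix g) \<zeta>) (AWPar (AWIn 0 ks P) (AWPar (AWOut (Ix 0) vs) S)) Y M"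
    and gY: "g \<notin> Y" and X: "X = insert g Y"
    unfolding conf_simps(3) by blast
  from Y obtain Q R where
    Q: "aw_cong (aw_sub (up_i (count_list ks KI) (case_nat g \<eta>))
        (up (count_list ks KO) (case_nat (Ix g) \<zeta>)) P) Q"
    and R: "conf (case_nat g \<eta>) (case_nat (Ix g) \<zeta>) S Y R" "g \<notin> Y"
    and "M = add_mset (AWOut (Ix g) (map (sub_wval (case_nat g \<eta>) (case_nat (Ix g) \<zeta>)) vs))
      (add_mset (AWIn g ks Q) R)"
    using gY by (fastforce simp: conf_simps)
  then have M: "M = add_mset (AWIn g ks Q)
      (add_mset (AWOut (Ix g) (map (sub_wval (case_nat g \<eta>) (case_nat (Ix g) \<zeta>)) vs)) R)"
    by (simp add: add_mset_commute)
  have "redex g M (map (sub_wval (case_nat g \<eta>) (case_nat (Ix g) \<zeta>)) vs) Q R"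
    unfolding M using r_comm(1) by (intro redex_in) simp
  then show ?case
    using residual_base[OF Q r_comm(1) R \<open>finite F\<close>] unfolding X by blast
next
  case (r_rep vs ks P S)
  then obtain g Y where
    Y: "conf (case_nat g \<eta>) (case_nat (Ix g) \<zeta>) (AWPar (AWRep 0 ks P) (AWPar (AWOut (Ix 0) vs) S)) Y M"
    and gY: "g \<notin> Y" and X: "X = insert g Y"
    unfolding conf_simps(3) by blast
  from Y obtain Q R where
    Q: "aw_cong (aw_sub (up_i (count_list ks KI) (case_nat g \<eta>))
        (up (count_list ks KO) (case_nat (Ix g) \<zeta>)) P) Q"
    and R: "conf (case_nat g \<eta>) (case_nat (Ix g) \<zeta>) S Y R" "g \<notin> Y"
    and "M = add_mset (AWOut (Ix g) (map (sub_wval (case_nat g \<eta>) (case_nat (Ix g) \<zeta>)) vs))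
      (add_mset (AWRep g ks Q) R)"
    using gY by (fastforce simp: conf_simps)
  then have M: "M = add_mset (AWRep g ks Q)
      (add_mset (AWOut (Ix g) (map (sub_wval (case_nat g \<eta>) (case_nat (Ix g) \<zeta>)) vs)) R)"
    by (simp add: add_mset_commute)
  have "redex g M (map (sub_wval (case_nat g \<eta>) (case_nat (Ix g) \<zeta>)) vs) Q (add_mset (AWRep g ks Q) R)"
    unfolding M using r_rep(1) by (intro redex_rep) simp
  moreover have "conf (case_nat g \<eta>) (case_nat (Ix g) \<zeta>) (AWPar (AWRep 0 ks P) S) Y (add_mset (AWRep g ks Q) R)"
    using conf_par[OF conf_rep[OF Q, of 0] R(1)] by simp
  ultimately show ?case
    using residual_base[OF Q r_rep(1) _ R(2) \<open>finite F\<close>] unfolding X by blast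
next
  case (r_par P P' S)
  then obtain X1 M1 X2 M2 where
    c: "conf \<eta> \<zeta> P X1 M1" "conf \<eta> \<zeta> S X2 M2" "X1 \<inter> X2 = {}" and X: "X = X1 \<union> X2" "M = M1 + M2"
    by (auto simp: conf_simps)
  \<comment> \<open>Adding the names of the unchanged component to \<open>F\<close> prevents the
    names of the reduct from colliding with them.\<close>
  have fin: "finite (F \<union> X2)"
    using r_par.prems c(2) conf_finite by blast
  obtain g vs Q R where r: "redex g M1 vs Q R" "residual \<eta> \<zeta> X1 vs Q R P' (F \<union> X2)"
    using r_par.IH[OF c(1) fin] by blast
  from r(2) obtain G where "finite G"
    and G: "\<And>Y N. conf (\<lambda>i. i) Ix (aw_inst vs Q) Y N \<Longrightarrow> Y \<inter> G = {} \<Longrightarrow>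
      \<exists>X'. conf \<eta> \<zeta> P' X' (R + N) \<and> X' \<inter> (F \<union> X2) \<subseteq> X1"
    by (rule residualE) blast
  have "residual \<eta> \<zeta> X vs Q (R + M2) (AWPar P' S) F"
  proof (rule residualI[OF \<open>finite G\<close>])
    fix Y N
    assume "conf (\<lambda>i. i) Ix (aw_inst vs Q) Y N" "Y \<inter> G = {}"
    then obtain X' where X': "conf \<eta> \<zeta> P' X' (R + N)" "X' \<inter> (F \<union> X2) \<subseteq> X1"
      using G by blast
    then have "conf \<eta> \<zeta> (AWPar P' S) (X' \<union> X2) (R + N + M2)"
      using c by (intro conf_par) auto
    moreover have "(X' \<union> X2) \<inter> F \<subseteq> X"
      using X' X by blast
    ultimately show "\<exists>X'. conf \<eta> \<zeta> (AWPar P' S) X' (R + M2 + N) \<and> X' \<inter> F \<subseteq> X"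
      by (auto simp: ac_simps)
  qed
  then show ?case
    using redex_union[OF r(1)] unfolding X by blast
next
  case (r_nu P P')
  then obtain h Y where
    c: "conf (case_nat h \<eta>) (case_nat (Ix h) \<zeta>) P Y M" "h \<notin> Y" and X: "X = insert h Y"
    by (auto simp: conf_simps)
  have fin: "finite (insert h F)"
    using r_nu.prems by blast
  obtain g vs Q R where r: "redex g M vs Q R"
    "residual (case_nat h \<eta>) (case_nat (Ix h) \<zeta>) Y vs Q R P' (insert h F)"
    using r_nu.IH[OF c(1) fin] by blast
  from r(2) obtain G where "finite G"
    and G: "\<And>Y' N. conf (\<lambda>i. i) Ix (aw_inst vs Q) Y' N \<Longrightarrow> Y' \<inter> G = {} \<Longrightarrow>
      \<exists>X'. conf (case_nat h \<eta>) (case_nat (Ix h) \<zeta>) P' X' (R + N) \<and> X' \<inter> insert h F \<subseteq> Y"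
    by (rule residualE) blast
  have "residual \<eta> \<zeta> X vs Q R (AWNu P') F"
  proof (rule residualI[OF \<open>finite G\<close>])
    fix Y' N
    assume "conf (\<lambda>i. i) Ix (aw_inst vs Q) Y' N" "Y' \<inter> G = {}"
    then obtain X' where X': "conf (case_nat h \<eta>) (case_nat (Ix h) \<zeta>) P' X' (R + N)" "X' \<inter> insert h F \<subseteq> Y"
      using G by blast
    then have "conf \<eta> \<zeta> (AWNu P') (insert h X') (R + N)"
      using c by (intro conf_nu) auto
    moreover have "insert h X' \<inter> F \<subseteq> X"
      using X' X by blast
    ultimately show "\<exists>X'. conf \<eta> \<zeta> (AWNu P') X' (R + N) \<and> X' \<inter> F \<subseteq> X"
      by blast
  qed
  then show ?case
    using r(1) by blast
next
  case (r_cong P P1 Q1 P')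
  obtain X1 where X1: "conf \<eta> \<zeta> P1 X1 M" "X1 \<inter> F \<subseteq> X"
    using conf_cong[OF r_cong.prems(1) r_cong.hyps(1) r_cong.prems(2)] by blast
  obtain g vs Q R where r: "redex g M vs Q R" "residual \<eta> \<zeta> X1 vs Q R Q1 F"
    using r_cong.IH[OF X1(1) r_cong.prems(2)] by blast
  from r(2) obtain G where "finite G"
    and G: "\<And>Y N. conf (\<lambda>i. i) Ix (aw_inst vs Q) Y N \<Longrightarrow> Y \<inter> G = {} \<Longrightarrow>
      \<exists>X'. conf \<eta> \<zeta> Q1 X' (R + N) \<and> X' \<inter> F \<subseteq> X1"
    by (rule residualE) blast
  have "residual \<eta> \<zeta> X vs Q R P' F"
  proof (rule residualI[OF \<open>finite G\<close>])
    fix Y N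
    assume "conf (\<lambda>i. i) Ix (aw_inst vs Q) Y N" "Y \<inter> G = {}"
    then obtain X' where X': "conf \<eta> \<zeta> Q1 X' (R + N)" "X' \<inter> F \<subseteq> X1"
      using G by blast
    obtain X'' where "conf \<eta> \<zeta> P' X'' (R + N)" "X'' \<inter> F \<subseteq> X'"
      using conf_cong[OF X'(1) r_cong.hyps(3) r_cong.prems(2)] by blast
    then show "\<exists>X'. conf \<eta> \<zeta> P' X' (R + N) \<and> X' \<inter> F \<subseteq> X"
      using X' X1 by blast
  qed
  then show ?case
    using r(1) by blast
qed

lemma aw_succ_conf:
  assumes "aw_succ s P P'" "conf \<eta> \<zeta> P X M" "finite F"
  shows "\<exists>R X'. M = add_mset (AWOut (Succ s) [WO Star]) R \<and> conf \<eta> \<zeta> P' X' R \<and> X' \<inter> F \<subseteq> X"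
  using assms
proof (induction arbitrary: \<eta> \<zeta> X M F rule: aw_succ.induct)
  case s_out
  then show ?case
    by (auto simp: conf_simps)
next
  case (s_par P P' S)
  then obtain X1 M1 X2 M2 where
    c: "conf \<eta> \<zeta> P X1 M1" "conf \<eta> \<zeta> S X2 M2" "X1 \<inter> X2 = {}" and X: "X = X1 \<union> X2" "M = M1 + M2"
    by (auto simp: conf_simps)
  have fin: "finite (F \<union> X2)"
    using s_par.prems c(2) conf_finite by blast
  obtain R X' where R: "M1 = add_mset (AWOut (Succ s) [WO Star]) R" "conf \<eta> \<zeta> P' X' R"
    "X' \<inter> (F \<union> X2) \<subseteq> X1"
    using s_par.IH[OF c(1) fin] by blast
  then have "conf \<eta> \<zeta> (AWPar P' S) (X' \<union> X2) (R + M2)"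
    using c by (intro conf_par) auto
  then show ?case
    using R X by (intro exI[of _ "R + M2"] exI[of _ "X' \<union> X2"]) auto
next
  case (s_nu P P')
  then obtain h Y where
    c: "conf (case_nat h \<eta>) (case_nat (Ix h) \<zeta>) P Y M" "h \<notin> Y" and X: "X = insert h Y"
    by (auto simp: conf_simps)
  have fin: "finite (insert h F)"
    using s_nu.prems by blast
  obtain R X' where R: "M = add_mset (AWOut (Succ s) [WO Star]) R"
    "conf (case_nat h \<eta>) (case_nat (Ix h) \<zeta>) P' X' R" "X' \<inter> insert h F \<subseteq> Y"
    using s_nu.IH[OF c(1) fin] by blast
  then have "conf \<eta> \<zeta> (AWNu P') (insert h X') R"
    using c by (intro conf_nu) auto
  then show ?case
    using R X by (intro exI[of _ R] exI[of _ "insert h X'"]) auto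
next
  case (s_cong P P1 Q1 P')
  obtain X1 where X1: "conf \<eta> \<zeta> P1 X1 M" "X1 \<inter> F \<subseteq> X"
    using conf_cong[OF s_cong.prems(1) s_cong.hyps(1) s_cong.prems(2)] by blast
  obtain R X2 where R: "M = add_mset (AWOut (Succ s) [WO Star]) R" "conf \<eta> \<zeta> Q1 X2 R" "X2 \<inter> F \<subseteq> X1"
    using s_cong.IH[OF X1(1) s_cong.prems(2)] by blast
  obtain X3 where "conf \<eta> \<zeta> P' X3 R" "X3 \<inter> F \<subseteq> X2"
    using conf_cong[OF R(2) s_cong.hyps(3) s_cong.prems(2)] by blast
  then show ?case
    using R X1 by blast
qed

section \<open>Prenex forms: bringing chosen atoms of an AWpi configuration to the front\<close>

definition nus :: "nat \<Rightarrow> 's aw \<Rightarrow> 's aw" where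
  "nus n P = (AWNu ^^ n) P"

lemma nus_simps [simp]: "nus 0 P = P" "nus (Suc n) P = AWNu (nus n P)"
  by (simp_all add: nus_def)

lemma nus_add: "nus (m + n) P = nus m (nus n P)"
  by (simp add: nus_def funpow_add)

text \<open>Position 0 of the list belongs to the innermost restriction of a block
  \<open>nus (length gs)\<close>.\<close>

definition ext_env :: "'b list \<Rightarrow> (nat \<Rightarrow> 'b) \<Rightarrow> nat \<Rightarrow> 'b" where
  "ext_env gs \<eta> i = (if i < length gs then gs ! i else \<eta> (i - length gs))"

lemma ext_env_Nil [simp]: "ext_env [] \<eta> = \<eta>"
  by (rule ext) (simp add: ext_env_def)

lemma ext_env_Cons: "ext_env (g # gs) \<eta> = case_nat g (ext_env gs \<eta>)"
  by (rule ext) (auto simp: ext_env_def split: nat.split)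

lemma ext_env_append: "ext_env (gs @ hs) \<eta> = ext_env gs (ext_env hs \<eta>)"
  by (induction gs) (auto simp: ext_env_Cons)

lemma ext_env_drop [simp]: "ext_env gs \<eta> (i + length gs) = \<eta> i"
  by (simp add: ext_env_def)

definition lift_aw :: "nat \<Rightarrow> 's aw \<Rightarrow> 's aw" where
  "lift_aw k = aw_sub (\<lambda>i. i + k) (\<lambda>i. Ix (i + k))"

lemma conf_lift_aw:
  "length us = length gs \<Longrightarrow>
   conf (ext_env gs \<eta>) (ext_env us \<zeta>) (lift_aw (length gs) Q) X M \<longleftrightarrow> conf \<eta> \<zeta> Q X M"
  using ext_env_drop[of us \<zeta>] by (simp add: lift_aw_def conf_sub) (simp add: comp_def)

lemma lift_aw_Suc: "lift_aw k (aw_shift Q) = lift_aw (Suc k) Q"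
  by (simp add: lift_aw_def aw_sub_aw_shift)

lemma aw_cong_nus: "aw_cong P Q \<Longrightarrow> aw_cong (nus k P) (nus k Q)"
  by (induction k) (auto intro: c_nu)

lemma aw_red_nus: "aw_red P Q \<Longrightarrow> aw_red (nus k P) (nus k Q)"
  by (induction k) (auto intro: r_nu)

lemma aw_succ_nus: "aw_succ s P Q \<Longrightarrow> aw_succ s (nus k P) (nus k Q)"
  by (induction k) (auto intro: s_nu)

lemma aw_cong_nus_par: "aw_cong (AWPar (nus k P) Q) (nus k (AWPar P (lift_aw k Q)))"
proof (induction k arbitrary: Q)
  case 0
  then show ?case by (simp add: lift_aw_def c_refl)
next
  case (Suc k)
  show ?case
    using c_trans[OF nu_par c_nu[OF Suc.IH[of "aw_shift Q"]]] by (simp add: lift_aw_Suc)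
qed

lemma conf_nus:
  assumes "conf (ext_env gs \<eta>) (ext_env (map Ix gs) \<zeta>) P X M" "distinct gs" "set gs \<inter> X = {}"
  shows "conf \<eta> \<zeta> (nus (length gs) P) (set gs \<union> X) M"
  using assms
proof (induction gs arbitrary: P X)
  case Nil
  then show ?case by simp
next
  case (Cons g gs)
  have "conf (ext_env gs \<eta>) (ext_env (map Ix gs) \<zeta>) (AWNu P) (insert g X) M"
    using Cons.prems by (intro conf_nu) (auto simp: ext_env_Cons)
  from Cons.IH[OF this] Cons.prems show ?case
    using nus_add[of "length gs" 1 P] by (auto simp: insert_commute)
qed

lemma residual_nus:
  assumes "residual (ext_env gs \<eta>) (ext_env (map Ix gs) \<zeta>) X vs Q R P' (F \<union> set gs)"
    and gs: "distinct gs" "set gs \<inter> X = {}"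
  shows "residual \<eta> \<zeta> (set gs \<union> X) vs Q R (nus (length gs) P') F"
proof -
  from assms(1) obtain G where "finite G"
    and G: "\<And>Y N. conf (\<lambda>i. i) Ix (aw_inst vs Q) Y N \<Longrightarrow> Y \<inter> G = {} \<Longrightarrow>
      \<exists>X'. conf (ext_env gs \<eta>) (ext_env (map Ix gs) \<zeta>) P' X' (R + N) \<and> X' \<inter> (F \<union> set gs) \<subseteq> X"
    by (rule residualE) blast
  show ?thesis
  proof (rule residualI[OF \<open>finite G\<close>])
    fix Y N
    assume "conf (\<lambda>i. i) Ix (aw_inst vs Q) Y N" "Y \<inter> G = {}"
    then obtain X' where X': "conf (ext_env gs \<eta>) (ext_env (map Ix gs) \<zeta>) P' X' (R + N)"
      "X' \<inter> (F \<union> set gs) \<subseteq> X"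
      using G by blast
    then have "conf \<eta> \<zeta> (nus (length gs) P') (set gs \<union> X') (R + N)"
      using gs by (intro conf_nus) auto
    moreover have "(set gs \<union> X') \<inter> F \<subseteq> set gs \<union> X"
      using X' by blast
    ultimately show "\<exists>X'. conf \<eta> \<zeta> (nus (length gs) P') X' (R + N) \<and> X' \<inter> F \<subseteq> set gs \<union> X"
      by blast
  qed
qed

primrec prefixed :: "'s aw \<Rightarrow> bool" where
  "prefixed AWNil = False"
| "prefixed (AWPar P Q) = False"
| "prefixed (AWIn a ks P) = True"
| "prefixed (AWOut b vs) = True"
| "prefixed (AWNu P) = False"
| "prefixed (AWRep a ks P) = True"

text \<open>\<open>A0\<close> is the occurrence in the syntax of the global atom \<open>A\<close>.
  The list \<open>gs\<close> names the restrictions that have to be extruded over the rest; those in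
  \<open>X0\<close> stay inside \<open>R\<close>.\<close>

definition pulled where
  "pulled \<eta> \<zeta> P X A M gs A0 R X0 \<longleftrightarrow>
     aw_cong P (nus (length gs) (AWPar A0 R)) \<and> prefixed A0 \<and> distinct gs \<and> set gs \<inter> X0 = {} \<and>
     X = set gs \<union> X0 \<and> conf (ext_env gs \<eta>) (ext_env (map Ix gs) \<zeta>) A0 {} {#A#} \<and>
     conf (ext_env gs \<eta>) (ext_env (map Ix gs) \<zeta>) R X0 M"

lemma pulled_par:
  assumes "pulled \<eta> \<zeta> P X A M gs A0 R X0" "conf \<eta> \<zeta> Q Y N" "X \<inter> Y = {}"
    and "aw_cong S (AWPar P Q)"
  shows "pulled \<eta> \<zeta> S (X \<union> Y) A (M + N) gs A0 (AWPar R (lift_aw (length gs) Q)) (X0 \<union> Y)"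
proof -
  have "aw_cong (AWPar P Q) (AWPar (nus (length gs) (AWPar A0 R)) Q)"
    using assms(1) by (auto simp: pulled_def intro: c_par c_refl)
  then have "aw_cong S (nus (length gs) (AWPar A0 (AWPar R (lift_aw (length gs) Q))))"
    using assms(4) aw_cong_nus_par aw_cong_nus[OF par_assoc] c_trans by meson
  moreover have "conf (ext_env gs \<eta>) (ext_env (map Ix gs) \<zeta>) (AWPar R (lift_aw (length gs) Q)) (X0 \<union> Y) (M + N)"
    using assms by (intro conf_par) (auto simp: pulled_def conf_lift_aw)
  ultimately show ?thesis
    using assms by (auto simp: pulled_def)
qed

lemma pulled_prefixed:
  "prefixed P \<Longrightarrow> conf \<eta> \<zeta> P {} {#A#} \<Longrightarrow> pulled \<eta> \<zeta> P {} A {#} [] P AWNil {}"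
  by (auto simp: pulled_def intro: par_nil[THEN c_sym] conf_nil)

lemma conf_pull:
  "conf \<eta> \<zeta> P X M \<Longrightarrow> A \<in># M \<Longrightarrow> \<exists>gs A0 R X0. pulled \<eta> \<zeta> P X A (M - {#A#}) gs A0 R X0"
proof (induction rule: conf.induct)
  case (conf_par \<eta> \<zeta> P X M Q Y N)
  show ?case
  proof (cases "A \<in># M")
    case True
    then obtain gs A0 R X0 where "pulled \<eta> \<zeta> P X A (M - {#A#}) gs A0 R X0"
      using conf_par.IH by blast
    from pulled_par[OF this conf_par.hyps(2,3) c_refl] True show ?thesis
      by auto
  next
    case False
    then have A: "A \<in># N"
      using conf_par.prems by auto
    then obtain gs A0 R X0 where "pulled \<eta> \<zeta> Q Y A (N - {#A#}) gs A0 R X0"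
      using conf_par.IH by blast
    from pulled_par[OF this conf_par.hyps(1) _ par_comm] A conf_par.hyps(3) show ?thesis
      by (auto simp: Int_commute Un_commute add.commute)
  qed
next
  case (conf_nu g \<eta> \<zeta> P X M)
  then obtain gs A0 R X0 where
    "pulled (case_nat g \<eta>) (case_nat (Ix g) \<zeta>) P X A (M - {#A#}) gs A0 R X0"
    by blast
  \<comment> \<open>Indices count from the innermost binder, so the outer restriction
    \<open>g\<close> goes to the end of the list.\<close>
  then have "pulled \<eta> \<zeta> (AWNu P) (insert g X) A (M - {#A#}) (gs @ [g]) A0 R X0"
    using conf_nu.hyps(2) c_nu by (auto simp: pulled_def ext_env_append ext_env_Cons)
  then show ?case
    by blast
next
  case (conf_out \<eta> \<zeta> b vs)
  then show ?case
    using pulled_prefixed[OF _ conf.conf_out] by simp blast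
next
  case (conf_in ks \<eta> \<zeta> P Q a)
  then show ?case
    using pulled_prefixed[OF _ conf.conf_in[OF conf_in.hyps]] by simp blast
next
  case (conf_rep ks \<eta> \<zeta> P Q a)
  then show ?case
    using pulled_prefixed[OF _ conf.conf_rep[OF conf_rep.hyps]] by simp blast
qed simp

definition rot :: "nat \<Rightarrow> nat \<Rightarrow> nat" where
  "rot k i = (if i < k then Suc i else if i = k then 0 else i)"

lemma aw_sub_nus:
  "aw_sub \<rho> \<sigma> (nus k P) = nus k (aw_sub (up_i k \<rho>) (up k \<sigma>) P)"
proof (induction k arbitrary: \<rho> \<sigma>)
  case (Suc k)
  have "aw_sub \<rho> \<sigma> (nus (Suc k) P) = AWNu (aw_sub (up_i 1 \<rho>) (up 1 \<sigma>) (nus k P))"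
    by simp
  also have "\<dots> = nus (Suc k) (aw_sub (up_i (Suc k) \<rho>) (up (Suc k) \<sigma>) P)"
    unfolding Suc.IH up_up up_i_up_i by simp
  finally show ?case .
qed simp

text \<open>The reduction axioms want the restriction of the subject directly around the redex;
  \<open>k\<close> adjacent swaps move it there, and \<open>rot k\<close> is the resulting
  renaming.\<close>

lemma aw_cong_rot:
  "aw_cong (AWNu (nus k P)) (nus k (AWNu (aw_sub (rot k) (\<lambda>i. Ix (rot k i)) P)))"
proof (induction k arbitrary: P)
  case 0
  have "rot 0 = (\<lambda>i. i)"
    by (auto simp: rot_def)
  then show ?case by (simp add: c_refl)
next
  case (Suc k)
  define P' where "P' = aw_sub (up_i k swap01) (up k (\<lambda>i. Ix (swap01 i))) P"
  have "rot k (up_i k swap01 i) = rot (Suc k) i" for i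
    by (auto simp: rot_def up_i_def swap01_def)
  moreover have "sub_val (\<lambda>i. Ix (rot k i) :: 'a val) (up k (\<lambda>i. Ix (swap01 i)) i) = Ix (rot (Suc k) i)" for i
    by (auto simp: rot_def up_def swap01_def)
  ultimately have P': "aw_sub (rot k) (\<lambda>i. Ix (rot k i)) P' =
      aw_sub (rot (Suc k)) (\<lambda>i. Ix (rot (Suc k) i)) P"
    unfolding P'_def aw_sub_aw_sub comp_def by (simp only:)
  have "aw_cong (AWNu (nus (Suc k) P)) (AWNu (AWNu (nus k P')))"
    using nu_swap[of "nus k P"] by (simp add: aw_swap_def aw_sub_nus P'_def)
  then show ?case
    using c_trans c_nu[OF Suc.IH[of P']] unfolding P' by fastforce
qed

lemma ext_env_rot:
  "(case_nat g (ext_env (xs @ ys) \<eta>)) (rot (length xs) i) = ext_env (xs @ g # ys) \<eta> i"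
  by (auto simp: rot_def ext_env_def nth_append split: nat.split)

text \<open>Outside of the block both environments yield 0, and \<open>g\<close> is not 0, so the
  subjects of the two atoms are indices bound in the block; as \<open>js\<close> is distinct, they
  are the same index \<open>i\<close>. Rotating that binder inwards produces an instance of a
  reduction axiom.\<close>

lemma redex_aw_red_prenex:
  fixes js :: "nat list"
  defines "\<eta> \<equiv> \<lambda>_::nat. 0::nat" and "\<zeta> \<equiv> \<lambda>_::nat. Ix 0 :: 's val"
  assumes P: "aw_cong P (nus (length js) (AWPar A0 (AWPar B0 S)))"
    and js: "distinct js" "set js \<inter> X = {}" and "g \<noteq> 0" "0 \<notin> set js"
    and A0: "prefixed A0" "conf (ext_env js \<eta>) (ext_env (map Ix js) \<zeta>) A0 {} {#A#}"
    and B0: "prefixed B0" "conf (ext_env js \<eta>) (ext_env (map Ix js) \<zeta>) B0 {} {#AWOut (Ix g) vs#}"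
    and S: "conf (ext_env js \<eta>) (ext_env (map Ix js) \<zeta>) S X M"
    and vs: "map kind_of vs = ks"
    and A: "A = AWIn g ks Q \<and> R = M \<or> A = AWRep g ks Q \<and> R = add_mset A M"
    and F: "finite F"
  shows "\<exists>P'. aw_red P P' \<and> residual \<eta> \<zeta> (set js \<union> X) vs Q R P' F"
proof -
  obtain i where i: "ext_env js \<eta> i = g"
    "\<exists>P0. (A0 = AWIn i ks P0 \<and> A = AWIn g ks Q \<or> A0 = AWRep i ks P0 \<and> A = AWRep g ks Q) \<and>
      aw_cong (aw_sub (up_i (count_list ks KI) (ext_env js \<eta>))
        (up (count_list ks KO) (ext_env (map Ix js) \<zeta>)) P0) Q"
    using A A0 by (cases A0) (auto simp: conf_simps)
  then obtain P0 where P0: "A0 = AWIn i ks P0 \<and> A = AWIn g ks Q \<or> A0 = AWRep i ks P0 \<and> A = AWRep g ks Q"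
    and Q: "aw_cong (aw_sub (up_i (count_list ks KI) (ext_env js \<eta>))
        (up (count_list ks KO) (ext_env (map Ix js) \<zeta>)) P0) Q"
    by blast
  obtain b vs0 where b: "B0 = AWOut b vs0" "sub_val (ext_env (map Ix js) \<zeta>) b = Ix g"
    and vs0: "vs = map (sub_wval (ext_env js \<eta>) (ext_env (map Ix js) \<zeta>)) vs0"
    using B0 by (cases B0) (auto simp: conf_simps)
  have "i < length js" "js ! i = g"
    using i(1) \<open>g \<noteq> 0\<close> by (auto simp: ext_env_def \<eta>_def split: if_splits)
  moreover obtain j where "b = Ix j" "j < length js" "js ! j = g"
    using b(2) \<open>g \<noteq> 0\<close> by (cases b) (auto simp: ext_env_def \<zeta>_def split: if_splits)
  ultimately have b_eq: "b = Ix i"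
    using js(1) nth_eq_iff_index_eq by blast
  \<comment> \<open>\<open>xs\<close> belongs to the restrictions inside that of \<open>g\<close>
    and \<open>ys\<close> to those outside; the rotation leaves the block \<open>xs @ ys\<close>
    around the restriction of \<open>g\<close>.\<close>
  define xs ys where "xs = take i js" and "ys = drop (Suc i) js"
  have js_eq: "js = xs @ g # ys" and len: "length xs = i"
    using \<open>i < length js\<close> \<open>js ! i = g\<close> by (auto simp: xs_def ys_def id_take_nth_drop)
  define \<eta>' where "\<eta>' = ext_env (xs @ ys) \<eta>"
  define \<zeta>' where "\<zeta>' = ext_env (map Ix (xs @ ys)) \<zeta>"
  define r where "r = aw_sub (rot i) (\<lambda>k. Ix (rot i k) :: 's val)"
  have env: "case_nat g \<eta>' \<circ> rot i = ext_env js \<eta>"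
    "sub_val (case_nat (Ix g) \<zeta>') \<circ> (\<lambda>k. Ix (rot i k)) = ext_env (map Ix js) \<zeta>"
    using ext_env_rot[of g xs ys \<eta>] ext_env_rot[of "Ix g" "map Ix xs" "map Ix ys" \<zeta>]
    unfolding \<eta>'_def \<zeta>'_def js_eq by (simp_all add: fun_eq_iff len)
  have conf_r: "conf (case_nat g \<eta>') (case_nat (Ix g) \<zeta>') (r P) Y N \<longleftrightarrow>
      conf (ext_env js \<eta>) (ext_env (map Ix js) \<zeta>) P Y N" for P Y N
    unfolding r_def conf_sub env ..
  define P1 where "P1 = aw_sub (up_i (count_list ks KI) (rot i)) (up (count_list ks KO) (\<lambda>k. Ix (rot i k))) P0"
  define vs1 where "vs1 = map (sub_wval (rot i) (\<lambda>k. Ix (rot i k))) vs0"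
  have rA0: "r A0 = AWIn 0 ks P1 \<and> A = AWIn g ks Q \<or> r A0 = AWRep 0 ks P1 \<and> A = AWRep g ks Q"
    using P0 by (auto simp: r_def P1_def rot_def)
  have rB0: "r B0 = AWOut (Ix 0) vs1"
    unfolding b b_eq by (simp add: r_def vs1_def rot_def)
  have vs1: "map kind_of vs1 = ks"
    using vs by (simp add: vs1_def vs0)
  have vs_eq: "map (sub_wval (case_nat g \<eta>') (case_nat (Ix g) \<zeta>')) vs1 = vs"
    by (simp add: vs1_def vs0 sub_wval_sub_wval env)
  have Q1: "aw_cong (aw_sub (up_i (count_list ks KI) (case_nat g \<eta>'))
      (up (count_list ks KO) (case_nat (Ix g) \<zeta>')) P1) Q"
    using Q by (simp add: P1_def aw_sub_aw_sub up_comp up_i_comp env)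
  have g: "g \<notin> X" "set (xs @ ys) \<inter> insert g X = {}" "distinct (xs @ ys)" "0 \<notin> set (xs @ ys)"
    "set js = insert g (set (xs @ ys))"
    using js \<open>0 \<notin> set js\<close> by (auto simp: js_eq)
  have S': "conf (case_nat g \<eta>') (case_nat (Ix g) \<zeta>') (r S) X M"
    using S by (simp only: conf_r)
  define T where "T = AWPar A0 (AWPar B0 S)"
  have "nus (length js) T = nus (length ys) (AWNu (nus i T))"
    using nus_add[of "length ys" "Suc i" T] by (simp add: js_eq len add.commute)
  then have "aw_cong (nus (length js) T) (nus (length ys) (nus i (AWNu (r T))))"
    using aw_cong_nus[OF aw_cong_rot] by (simp add: r_def)
  from c_trans[OF P this[unfolded T_def]] have P': "aw_cong P (nus (length (xs @ ys)) (AWNu (AWPar (r A0) (AWPar (r B0) (r S)))))"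
    by (simp add: r_def len nus_add[symmetric] add.commute)
  have fin: "finite (F \<union> set (xs @ ys))"
    using F by simp
  from rA0 obtain P2 where
    red: "aw_red (AWNu (AWPar (r A0) (AWPar (r B0) (r S)))) P2"
    and res: "residual \<eta>' \<zeta>' (insert g X) vs Q R P2 (F \<union> set (xs @ ys))"
  proof
    assume *: "r A0 = AWIn 0 ks P1 \<and> A = AWIn g ks Q"
    show ?thesis
    proof (rule that)
      show "aw_red (AWNu (AWPar (r A0) (AWPar (r B0) (r S)))) (AWNu (AWPar (aw_inst vs1 P1) (r S)))"
        using * vs1 by (simp add: rB0 r_comm)
      show "residual \<eta>' \<zeta>' (insert g X) vs Q R (AWNu (AWPar (aw_inst vs1 P1) (r S))) (F \<union> set (xs @ ys))"
        using residual_base[OF Q1 vs1 S' g(1) fin] * A by (simp add: vs_eq)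
    qed
  next
    assume *: "r A0 = AWRep 0 ks P1 \<and> A = AWRep g ks Q"
    have "conf (case_nat g \<eta>') (case_nat (Ix g) \<zeta>') (AWPar (AWRep 0 ks P1) (r S)) X R"
      using conf_par[OF conf_rep[OF Q1, of 0] S'] * A by simp
    note base = residual_base[OF Q1 vs1 this g(1) fin, unfolded vs_eq]
    show ?thesis
    proof (rule that)
      show "aw_red (AWNu (AWPar (r A0) (AWPar (r B0) (r S))))
          (AWNu (AWPar (AWRep 0 ks P1) (AWPar (aw_inst vs1 P1) (r S))))"
        using * vs1 by (simp add: rB0 r_rep)
      show "residual \<eta>' \<zeta>' (insert g X) vs Q R
          (AWNu (AWPar (AWRep 0 ks P1) (AWPar (aw_inst vs1 P1) (r S)))) (F \<union> set (xs @ ys))"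
        by (rule base, rule disjI2, rule exI, rule conjI, rule refl, rule refl)
    qed
  qed
  have "aw_red P (nus (length (xs @ ys)) P2)"
    using r_cong[OF P' aw_red_nus[OF red] c_refl] .
  moreover have "residual \<eta> \<zeta> (set (xs @ ys) \<union> insert g X) vs Q R (nus (length (xs @ ys)) P2) F"
    using residual_nus[OF res[unfolded \<eta>'_def \<zeta>'_def] g(3,2)] .
  ultimately show ?thesis
    unfolding g(5) by (metis Un_insert_left Un_insert_right)
qed

text \<open>Converse of \<open>aw_red_redex\<close> at top level. The output is pulled out of the
  rest \<open>R1\<close> left by the input, so its restrictions \<open>hs\<close> end up inside
  \<open>gs\<close>, and the input has to be lifted over them.\<close>

lemma redex_aw_red:
  assumes "redex g M vs Q R" "conf (\<lambda>_. 0) (\<lambda>_. Ix 0) P X M" "g \<noteq> 0" "0 \<notin> X" "finite F"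
  shows "\<exists>P'. aw_red P P' \<and> residual (\<lambda>_. 0) (\<lambda>_. Ix 0) X vs Q R P' F"
proof -
  note c_trans [trans]
  from assms(1) obtain A ks S where
    M: "M = add_mset A (add_mset (AWOut (Ix g) vs) S)" and vs: "map kind_of vs = ks"
    and A: "A = AWIn g ks Q \<and> R = S \<or> A = AWRep g ks Q \<and> R = add_mset A S"
    by (cases rule: redex.cases) auto
  obtain gs A0 R1 X1 where 1: "pulled (\<lambda>_. 0) (\<lambda>_. Ix 0) P X A (add_mset (AWOut (Ix g) vs) S) gs A0 R1 X1"
    using conf_pull[OF assms(2), of A] unfolding M by auto
  define \<eta> \<zeta> where "\<eta> = ext_env gs (\<lambda>_. 0)" and "\<zeta> = ext_env (map Ix gs) (\<lambda>_. Ix 0 :: 'a val)"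
  have "conf \<eta> \<zeta> R1 X1 (add_mset (AWOut (Ix g) vs) S)"
    using 1 by (simp add: pulled_def \<eta>_def \<zeta>_def)
  from conf_pull[OF this, of "AWOut (Ix g) vs"] obtain hs B0 R2 X2 where
    2: "pulled \<eta> \<zeta> R1 X1 (AWOut (Ix g) vs) S hs B0 R2 X2"
    by auto
  define js where "js = hs @ gs"
  have env: "ext_env hs \<eta> = ext_env js (\<lambda>_. 0)" "ext_env (map Ix hs) \<zeta> = ext_env (map Ix js) (\<lambda>_. Ix 0)"
    by (simp_all add: js_def \<eta>_def \<zeta>_def ext_env_append)
  let ?A = "lift_aw (length hs) A0"
  have "aw_cong (AWPar A0 R1) (AWPar (nus (length hs) (AWPar B0 R2)) A0)"
    using 2 by (auto simp: pulled_def intro: c_trans[OF par_comm] c_par c_refl)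
  also have "aw_cong \<dots> (nus (length hs) (AWPar (AWPar B0 R2) ?A))"
    by (rule aw_cong_nus_par)
  also have "aw_cong \<dots> (nus (length hs) (AWPar ?A (AWPar B0 R2)))"
    by (intro aw_cong_nus par_comm)
  finally have "aw_cong (nus (length gs) (AWPar A0 R1)) (nus (length js) (AWPar ?A (AWPar B0 R2)))"
    using aw_cong_nus[of _ _ "length gs"] by (simp add: js_def nus_add add.commute[of "length hs"])
  then have P: "aw_cong P (nus (length js) (AWPar ?A (AWPar B0 R2)))"
    using 1 by (auto simp: pulled_def intro: c_trans)
  have js: "distinct js" "set js \<inter> X2 = {}" "0 \<notin> set js" "X = set js \<union> X2"
    using 1 2 \<open>0 \<notin> X\<close> by (auto simp: pulled_def js_def)
  have A0: "prefixed ?A" "conf (ext_env js (\<lambda>_. 0)) (ext_env (map Ix js) (\<lambda>_. Ix 0)) ?A {} {#A#}"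
    using 1 by (cases A0; simp add: pulled_def lift_aw_def)
      (use 1 in \<open>simp add: pulled_def env[symmetric] conf_lift_aw \<eta>_def \<zeta>_def\<close>)
  have B0: "prefixed B0"
    "conf (ext_env js (\<lambda>_. 0)) (ext_env (map Ix js) (\<lambda>_. Ix 0)) B0 {} {#AWOut (Ix g) vs#}"
    "conf (ext_env js (\<lambda>_. 0)) (ext_env (map Ix js) (\<lambda>_. Ix 0)) R2 X2 S"
    using 2 by (auto simp: pulled_def env)
  show ?thesis
    using redex_aw_red_prenex[OF P js(1,2) \<open>g \<noteq> 0\<close> js(3) A0 B0 vs A \<open>finite F\<close>] unfolding js(4) .
qed

lemma conf_aw_succ:
  assumes "conf (\<lambda>_. 0) (\<lambda>_. Ix 0) P X (add_mset (AWOut (Succ s) [WO Star]) M)"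
  shows "\<exists>P'. aw_succ s P P' \<and> conf (\<lambda>_. 0) (\<lambda>_. Ix 0) P' X M"
proof -
  obtain gs A0 R X0 where
    1: "pulled (\<lambda>_. 0) (\<lambda>_. Ix 0) P X (AWOut (Succ s) [WO Star]) M gs A0 R X0"
    using conf_pull[OF assms, of "AWOut (Succ s) [WO Star]"] by auto
  then obtain b vs where A0: "A0 = AWOut b vs" "sub_val (ext_env (map Ix gs) (\<lambda>_. Ix 0)) b = Succ s"
    "map (sub_wval (ext_env gs (\<lambda>_. 0)) (ext_env (map Ix gs) (\<lambda>_. Ix 0))) vs = [WO Star]"
    by (cases A0) (auto simp: pulled_def conf_simps)
  \<comment> \<open>Environments yield only indices, so the success name and the unit value must
    occur literally in the output.\<close>
  have Ix: "\<exists>k. ext_env (map Ix gs) (\<lambda>_. Ix 0 :: 'a val) i = Ix k" for i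
    by (simp add: ext_env_def)
  obtain w where w: "vs = [w]" "sub_wval (ext_env gs (\<lambda>_. 0)) (ext_env (map Ix gs) (\<lambda>_. Ix 0)) w = WO Star"
    using A0(3) by auto
  obtain v where "w = WO v" "sub_val (ext_env (map Ix gs) (\<lambda>_. Ix 0)) v = Star"
    using w(2) by (cases w) auto
  then have "vs = [WO Star]"
    using Ix w(1) by (cases v) (simp_all, metis val.distinct(3))
  moreover have "b = Succ s"
    using A0(2) Ix by (cases b) (simp_all, metis val.distinct(5))
  ultimately have P: "aw_cong P (nus (length gs) (AWPar (AWOut (Succ s) [WO Star]) R))"
    using 1 by (simp add: pulled_def A0(1))
  have "aw_succ s P (nus (length gs) (AWPar AWNil R))"
    using s_cong[OF P aw_succ_nus[OF s_par[OF s_out]] c_refl] .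
  moreover have "conf (\<lambda>_. 0) (\<lambda>_. Ix 0) (nus (length gs) (AWPar AWNil R)) X M"
    using 1 conf_nus[of gs "\<lambda>_. 0" "\<lambda>_. Ix 0" "AWPar AWNil R" X0 M]
      conf_par[OF conf_nil, of _ _ R X0 M] by (auto simp: pulled_def)
  ultimately show ?thesis
    by blast
qed

section \<open>Configurations and transitions in ALpi\<close>

text \<open>In contrast to \<open>conf\<close>, continuations are stored exactly: the transition
  rules of ALpi do not appeal to a structural congruence.\<close>

inductive aconf :: "(nat \<Rightarrow> 's val) \<Rightarrow> 's al \<Rightarrow> nat set \<Rightarrow> 's al multiset \<Rightarrow> bool" where
  aconf_nil: "aconf \<sigma> ALNil {} {#}"
| aconf_par: "aconf \<sigma> P X M \<Longrightarrow> aconf \<sigma> Q Y N \<Longrightarrow> X \<inter> Y = {} \<Longrightarrow>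
    aconf \<sigma> (ALPar P Q) (X \<union> Y) (M + N)"
| aconf_nu: "aconf (case_nat (Ix g) \<sigma>) P X M \<Longrightarrow> g \<notin> X \<Longrightarrow> aconf \<sigma> (ALNu P) (insert g X) M"
| aconf_out: "aconf \<sigma> (ALOut a v) {} {#ALOut (sub_val \<sigma> a) (sub_val \<sigma> v)#}"
| aconf_in: "aconf \<sigma> (ALIn a P) {} {#ALIn (sub_val \<sigma> a) (al_sub (up 1 \<sigma>) P)#}"
| aconf_rep: "aconf \<sigma> (ALRep a P) {} {#ALRep (sub_val \<sigma> a) (al_sub (up 1 \<sigma>) P)#}"

inductive_simps aconf_simps:
  "aconf \<sigma> ALNil X M"
  "aconf \<sigma> (ALPar P Q) X M"
  "aconf \<sigma> (ALNu P) X M"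
  "aconf \<sigma> (ALOut b v) X M"
  "aconf \<sigma> (ALIn a P) X M"
  "aconf \<sigma> (ALRep a P) X M"

lemma aconf_sub: "aconf \<sigma> (al_sub \<tau> P) X M \<longleftrightarrow> aconf (sub_val \<sigma> \<circ> \<tau>) P X M"
  by (induction P arbitrary: \<sigma> \<tau> X M)
     (simp_all add: aconf_simps al_sub_al_sub up_comp sub_val_sub_val case_nat_comp_up[simplified]
        up_comp[of 1, simplified])

lemma aconf_iff_aconf_Ix: "aconf \<sigma> P X M \<longleftrightarrow> aconf Ix (al_sub \<sigma> P) X M"
  by (simp add: aconf_sub) (simp add: comp_def)

lemma aconf_al_shift [simp]: "aconf (case_nat u \<sigma>) (al_shift P) X M \<longleftrightarrow> aconf \<sigma> P X M"
  by (simp add: al_shift_def aconf_sub) (simp add: comp_def)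

lemma aconf_al_swap:
  "aconf (case_nat u (case_nat v \<sigma>)) (al_swap P) X M \<longleftrightarrow> aconf (case_nat v (case_nat u \<sigma>)) P X M"
  by (simp add: al_swap_def aconf_sub) (simp add: comp_def case_nat_swap01)

lemma aconf_finite: "aconf \<sigma> P X M \<Longrightarrow> finite X"
  by (induction rule: aconf.induct) auto

lemma aconf_al_inst:
  "aconf \<sigma> (al_inst v P) X M \<longleftrightarrow> aconf Ix (al_inst (sub_val \<sigma> v) (al_sub (up 1 \<sigma>) P)) X M"
  using aconf_iff_aconf_Ix[of \<sigma> "al_inst v P"] by (simp add: al_sub_al_inst)

inductive ready :: "'s al multiset \<Rightarrow> 's val \<Rightarrow> 's al \<Rightarrow> 's al multiset \<Rightarrow> bool" where
  ready_in: "ready (add_mset (ALIn a Q) R) a Q R"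
| ready_rep: "ready (add_mset (ALRep a Q) R) a Q (add_mset (ALRep a Q) R)"

inductive comm :: "'s al multiset \<Rightarrow> 's val \<Rightarrow> 's val \<Rightarrow> 's al \<Rightarrow> 's al multiset \<Rightarrow> bool" where
  commI: "ready M a Q R \<Longrightarrow> comm (add_mset (ALOut a v) M) a v Q R"

lemma ready_union: "ready M a Q R \<Longrightarrow> ready (M + N) a Q (R + N)"
  by (induction rule: ready.induct) (auto intro: ready.intros)

lemma comm_union: "comm M a v Q R \<Longrightarrow> comm (M + N) a v Q (R + N)"
  by (induction rule: comm.induct) (auto intro: comm.intros ready_union)

text \<open>Exact counterpart of \<open>residual\<close>: in the absence of garbage, the names after
  the step are the old ones together with those of the released continuation.\<close>

definition al_residual where
  "al_residual \<sigma> X v Q R P' \<longleftrightarrow>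
     (\<forall>Y N. aconf Ix (al_inst v Q) Y N \<longrightarrow> X \<inter> Y = {} \<longrightarrow> aconf \<sigma> P' (X \<union> Y) (R + N))"

lemma al_residual_par:
  assumes "al_residual \<sigma> X v Q R P'" "aconf \<sigma> S Y N" "X \<inter> Y = {}"
  shows "al_residual \<sigma> (X \<union> Y) v Q (R + N) (ALPar P' S)"
    "al_residual \<sigma> (Y \<union> X) v Q (N + R) (ALPar S P')"
proof -
  have "aconf \<sigma> (ALPar P' S) (X \<union> Y' \<union> Y) (R + N' + N)" "aconf \<sigma> (ALPar S P') (Y \<union> (X \<union> Y')) (N + (R + N'))"
    if "aconf Ix (al_inst v Q) Y' N'" "(X \<union> Y) \<inter> Y' = {}" for Y' N'
    using that assms by (intro aconf_par; auto simp: al_residual_def)+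
  then show "al_residual \<sigma> (X \<union> Y) v Q (R + N) (ALPar P' S)"
    "al_residual \<sigma> (Y \<union> X) v Q (N + R) (ALPar S P')"
    unfolding al_residual_def by (auto simp: ac_simps)
qed

lemma al_residual_nu:
  assumes "al_residual (case_nat (Ix g) \<sigma>) X v Q R P'" "g \<notin> X"
  shows "al_residual \<sigma> (insert g X) v Q R (ALNu P')"
  using assms aconf_nu[of g \<sigma> P'] by (auto simp: al_residual_def)

text \<open>Transitions as seen on configurations. In a bound output one name \<open>g\<close>
  leaves the restricted names and becomes the meaning of index 0 of the derivative.\<close>

primrec act_conf where
  "act_conf \<sigma> LTau P' X M \<longleftrightarrow> (\<exists>a v Q R. comm M a v Q R \<and> al_residual \<sigma> X v Q R P')"
| "act_conf \<sigma> (LIn a v) P' X M \<longleftrightarrow>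
    (\<exists>Q R. ready M (sub_val \<sigma> a) Q R \<and> al_residual \<sigma> X (sub_val \<sigma> v) Q R P')"
| "act_conf \<sigma> (LOut a v) P' X M \<longleftrightarrow>
    (\<exists>R. M = add_mset (ALOut (sub_val \<sigma> a) (sub_val \<sigma> v)) R \<and> aconf \<sigma> P' X R)"
| "act_conf \<sigma> (LBOut a) P' X M \<longleftrightarrow>
    (\<exists>g Y R. X = insert g Y \<and> g \<notin> Y \<and> M = add_mset (ALOut (sub_val \<sigma> a) (Ix g)) R \<and>
       aconf (case_nat (Ix g) \<sigma>) P' Y R)"

lemma act_conf_par:
  assumes "act_conf \<sigma> \<alpha> P' X M" "\<not> is_bout \<alpha>" "aconf \<sigma> S Y N" "X \<inter> Y = {}"
  shows "act_conf \<sigma> \<alpha> (ALPar P' S) (X \<union> Y) (M + N)" "act_conf \<sigma> \<alpha> (ALPar S P') (Y \<union> X) (N + M)"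
proof -
  have "act_conf \<sigma> \<alpha> (ALPar P' S) (X \<union> Y) (M + N) \<and> act_conf \<sigma> \<alpha> (ALPar S P') (Y \<union> X) (N + M)"
  proof (cases \<alpha>)
    case LTau
    then show ?thesis
      using assms comm_union[of M _ _ _ _ N] al_residual_par[OF _ assms(3,4)]
      by (simp add: add.commute[of N]) blast
  next
    case (LIn a v)
    then show ?thesis
      using assms ready_union[of M _ _ _ N] al_residual_par[OF _ assms(3,4)]
      by (simp add: add.commute[of N]) blast
  next
    case (LOut a v)
    then show ?thesis
      using assms aconf_par[of \<sigma> P' X _ S Y N] aconf_par[of \<sigma> S Y N P' X] by (auto simp: Int_commute)
  qed (use assms in simp)
  then show "act_conf \<sigma> \<alpha> (ALPar P' S) (X \<union> Y) (M + N)" "act_conf \<sigma> \<alpha> (ALPar S P') (Y \<union> X) (N + M)"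
    by blast+
qed

lemma comm_of_out_in:
  assumes "act_conf \<sigma> (LOut a v) P' X M" "act_conf \<sigma> (LIn a v) Q' Y N" "X \<inter> Y = {}"
  shows "act_conf \<sigma> LTau (ALPar P' Q') (X \<union> Y) (M + N)" "act_conf \<sigma> LTau (ALPar Q' P') (Y \<union> X) (N + M)"
proof -
  obtain R where M: "M = add_mset (ALOut (sub_val \<sigma> a) (sub_val \<sigma> v)) R" and P': "aconf \<sigma> P' X R"
    using assms(1) by auto
  obtain Q S where N: "ready N (sub_val \<sigma> a) Q S" and Q': "al_residual \<sigma> Y (sub_val \<sigma> v) Q S Q'"
    using assms(2) by auto
  have "comm (M + N) (sub_val \<sigma> a) (sub_val \<sigma> v) Q (S + R)"
    unfolding M using commI[OF ready_union[OF N, of R]] by (simp add: add.commute)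
  moreover have "al_residual \<sigma> (X \<union> Y) (sub_val \<sigma> v) Q (S + R) (ALPar P' Q')"
    "al_residual \<sigma> (X \<union> Y) (sub_val \<sigma> v) Q (S + R) (ALPar Q' P')"
    using al_residual_par[OF Q' P'] assms(3) by (simp_all add: ac_simps)
  ultimately show "act_conf \<sigma> LTau (ALPar P' Q') (X \<union> Y) (M + N)" "act_conf \<sigma> LTau (ALPar Q' P') (Y \<union> X) (N + M)"
    by (auto simp: ac_simps)
qed

text \<open>Which name is extruded is known only from the configuration of the output, so the input
  is assumed for all \<open>g\<close>. Once index 0 denotes that name, closing a scope is an
  ordinary communication below a restriction.\<close>

lemma comm_of_bout_in:
  assumes "act_conf \<sigma> (LBOut a) P' X M" "X \<inter> Y = {}"
    and "\<And>g. act_conf (case_nat (Ix g) \<sigma>) (LIn (shift_val 1 a) (Ix 0)) Q' Y N"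
  shows "act_conf \<sigma> LTau (ALNu (ALPar P' Q')) (X \<union> Y) (M + N)"
    "act_conf \<sigma> LTau (ALNu (ALPar Q' P')) (Y \<union> X) (N + M)"
proof -
  obtain g Z R where X: "X = insert g Z" "g \<notin> Z" and M: "M = add_mset (ALOut (sub_val \<sigma> a) (Ix g)) R"
    and P': "aconf (case_nat (Ix g) \<sigma>) P' Z R"
    using assms(1) by auto
  have "act_conf (case_nat (Ix g) \<sigma>) (LOut (shift_val 1 a) (Ix 0)) P' Z M"
    using P' M by simp
  from comm_of_out_in[OF this assms(3)] X assms(2)
  have 1: "act_conf (case_nat (Ix g) \<sigma>) LTau (ALPar P' Q') (Z \<union> Y) (M + N)"
    "act_conf (case_nat (Ix g) \<sigma>) LTau (ALPar Q' P') (Z \<union> Y) (M + N)"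
    by (auto simp: ac_simps)
  have "g \<notin> Z \<union> Y"
    using X assms(2) by auto
  note nu = al_residual_nu[OF _ this]
  show "act_conf \<sigma> LTau (ALNu (ALPar P' Q')) (X \<union> Y) (M + N)"
    "act_conf \<sigma> LTau (ALNu (ALPar Q' P')) (Y \<union> X) (N + M)"
    using 1 nu X by (auto simp: ac_simps) blast+
qed

lemma al_lts_act_conf:
  "al_lts P \<alpha> P' \<Longrightarrow> aconf \<sigma> P X M \<Longrightarrow> act_conf \<sigma> \<alpha> P' X M"
proof (induction arbitrary: \<sigma> X M rule: al_lts.induct)
  case (inp a P v)
  then have "X = {}" "ready M (sub_val \<sigma> a) (al_sub (up 1 \<sigma>) P) {#}"
    using ready_in[of "sub_val \<sigma> a" "al_sub (up 1 \<sigma>) P" "{#}"] by (auto simp: aconf_simps)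
  moreover have "al_residual \<sigma> {} (sub_val \<sigma> v) (al_sub (up 1 \<sigma>) P) {#} (al_inst v P)"
    using aconf_al_inst[of \<sigma> v P] by (simp add: al_residual_def)
  ultimately show ?case
    unfolding act_conf.simps by blast
next
  case (rep a P v)
  let ?A = "ALRep (sub_val \<sigma> a) (al_sub (up 1 \<sigma>) P)"
  from rep have "X = {}" "ready M (sub_val \<sigma> a) (al_sub (up 1 \<sigma>) P) {#?A#}"
    using ready_rep[of "sub_val \<sigma> a" "al_sub (up 1 \<sigma>) P" "{#}"] by (auto simp: aconf_simps)
  moreover have "al_residual \<sigma> {} (sub_val \<sigma> v) (al_sub (up 1 \<sigma>) P) {#?A#} (ALPar (al_inst v P) (ALRep a P))"
    using aconf_par[OF _ aconf_rep[of \<sigma> a P]] aconf_al_inst[of \<sigma> v P]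
    by (simp add: al_residual_def)
  ultimately show ?case
    unfolding act_conf.simps by blast
next
  case (out a v)
  then show ?case
    by (auto simp: aconf_simps)
next
  case (par1 P \<alpha> P' Q)
  from par1.prems show ?case
    unfolding aconf_simps using act_conf_par(1)[OF par1.IH par1.hyps(2)] by blast
next
  case (par2 Q \<alpha> Q' P)
  from par2.prems show ?case
    unfolding aconf_simps using act_conf_par(2)[OF par2.IH par2.hyps(2)] by (metis Int_commute)
next
  case (par1_b P a P' Q)
  from par1_b.prems obtain X1 M1 Y N where
    c: "aconf \<sigma> P X1 M1" "aconf \<sigma> Q Y N" "X1 \<inter> Y = {}" and X: "X = X1 \<union> Y" "M = M1 + N"
    unfolding aconf_simps by blast
  from par1_b.IH[OF c(1)] obtain g Z R where 1: "X1 = insert g Z" "g \<notin> Z"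
    "M1 = add_mset (ALOut (sub_val \<sigma> a) (Ix g)) R" "aconf (case_nat (Ix g) \<sigma>) P' Z R"
    by auto
  have "aconf (case_nat (Ix g) \<sigma>) (ALPar P' (al_shift Q)) (Z \<union> Y) (R + N)"
    using 1 c by (intro aconf_par) auto
  then show ?case
    using 1 X c by (auto intro!: exI[of _ g] exI[of _ "Z \<union> Y"])
next
  case (par2_b Q a Q' P)
  from par2_b.prems obtain X1 M1 Y N where
    c: "aconf \<sigma> P Y N" "aconf \<sigma> Q X1 M1" "X1 \<inter> Y = {}" and X: "X = X1 \<union> Y" "M = M1 + N"
    unfolding aconf_simps by (metis Int_commute Un_commute add.commute)
  from par2_b.IH[OF c(2)] obtain g Z R where 1: "X1 = insert g Z" "g \<notin> Z"
    "M1 = add_mset (ALOut (sub_val \<sigma> a) (Ix g)) R" "aconf (case_nat (Ix g) \<sigma>) Q' Z R"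
    by auto
  have "aconf (case_nat (Ix g) \<sigma>) (ALPar (al_shift P) Q') (Y \<union> Z) (N + R)"
    using 1 c by (intro aconf_par) auto
  then show ?case
    using 1 X c by (auto simp: ac_simps intro!: exI[of _ g] exI[of _ "Y \<union> Z"])
next
  case (comm1 P a v P' Q Q')
  from comm1.prems show ?case
    unfolding aconf_simps using comm_of_out_in(1)[OF comm1.IH] by blast
next
  case (comm2 P a v P' Q Q')
  from comm2.prems show ?case
    unfolding aconf_simps using comm_of_out_in(2)[OF comm2.IH(2,1)] by (metis Int_commute)
next
  case (close1 P a P' Q Q')
  from close1.prems obtain X1 M1 Y N where
    c: "aconf \<sigma> P X1 M1" "aconf \<sigma> Q Y N" "X1 \<inter> Y = {}" and X: "X = X1 \<union> Y" "M = M1 + N"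
    unfolding aconf_simps by blast
  then show ?case
    using comm_of_bout_in(1)[OF close1.IH(1)[OF c(1)] c(3) close1.IH(2)] by simp
next
  case (close2 P a P' Q Q')
  from close2.prems obtain X1 M1 Y N where
    c: "aconf \<sigma> P X1 M1" "aconf \<sigma> Q Y N" "Y \<inter> X1 = {}" and X: "X = X1 \<union> Y" "M = M1 + N"
    unfolding aconf_simps by (metis Int_commute)
  then show ?case
    using comm_of_bout_in(2)[OF close2.IH(2)[OF c(2)] c(3) close2.IH(1)] by simp
next
  case (res P \<alpha> P')
  from res.prems obtain g Y where c: "aconf (case_nat (Ix g) \<sigma>) P Y M" "g \<notin> Y" and X: "X = insert g Y"
    unfolding aconf_simps by blast
  show ?case
    using res.IH[OF c(1)] res.hyps(2) al_residual_nu[OF _ c(2)] aconf_nu[OF _ c(2)] unfolding X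
    by (cases \<alpha>) (auto, blast+)
next
  case (res_b P a P')
  from res_b.prems obtain g Y where c: "aconf (case_nat (Ix g) \<sigma>) P Y M" "g \<notin> Y" and X: "X = insert g Y"
    unfolding aconf_simps by blast
  from res_b.IH[OF c(1)] obtain h Z R where 1: "Y = insert h Z" "h \<notin> Z"
    "M = add_mset (ALOut (sub_val \<sigma> a) (Ix h)) R" "aconf (case_nat (Ix h) (case_nat (Ix g) \<sigma>)) P' Z R"
    by auto
  have "aconf (case_nat (Ix h) \<sigma>) (ALNu (al_swap P')) (insert g Z) R"
    using 1 c by (intro aconf_nu) (auto simp: aconf_al_swap)
  then show ?case
    using 1 X c by (auto simp: insert_commute intro!: exI[of _ h] exI[of _ "insert g Z"])
next
  case (opn P a P')
  from opn.prems obtain g Y where c: "aconf (case_nat (Ix g) \<sigma>) P Y M" "g \<notin> Y" and X: "X = insert g Y"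
    unfolding aconf_simps by blast
  from opn.IH[OF c(1)] show ?case
    using X c(2) by auto
qed

section \<open>From configurations back to ALpi transitions\<close>

text \<open>Name 0 is reserved as the image of free indices, so injectivity is not required there.\<close>

definition good_env :: "(nat \<Rightarrow> 's val) \<Rightarrow> nat set \<Rightarrow> bool" where
  "good_env \<sigma> X \<longleftrightarrow> (\<forall>i. \<exists>n. \<sigma> i = Ix n \<and> n \<notin> X) \<and>
     (\<forall>i j n. \<sigma> i = Ix n \<longrightarrow> \<sigma> j = Ix n \<longrightarrow> n \<noteq> 0 \<longrightarrow> i = j)"

lemma good_env_nu:
  assumes "good_env \<sigma> (insert g X)" "g \<notin> X"
  shows "good_env (case_nat (Ix g) \<sigma>) X"
proof -
  have "\<exists>n. case_nat (Ix g) \<sigma> i = Ix n \<and> n \<notin> X" for i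
    using assms by (cases i) (auto simp: good_env_def)
  moreover have "i = j" if "case_nat (Ix g) \<sigma> i = Ix n" "case_nat (Ix g) \<sigma> j = Ix n" "n \<noteq> 0" for i j n
  proof -
    have "\<sigma> k \<noteq> Ix g" for k
      using assms(1) by (metis good_env_def insertI1 val.inject(2))
    then show ?thesis
      using that assms(1) by (cases i; cases j) (auto simp: good_env_def)
  qed
  ultimately show ?thesis
    by (auto simp: good_env_def)
qed

lemma good_env_mono: "good_env \<sigma> Y \<Longrightarrow> X \<subseteq> Y \<Longrightarrow> good_env \<sigma> X"
  unfolding good_env_def by blast

text \<open>Leads from a global subject back to the syntactic one. This can fail at 0, the common
  image of all free indices.\<close>

lemma good_env_inj:
  assumes "good_env \<sigma> X" "sub_val \<sigma> a = sub_val \<sigma> b" "sub_val \<sigma> b \<noteq> Ix 0"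
  shows "a = b"
proof -
  have "\<exists>n. \<sigma> i = Ix n" for i
    using assms(1) by (auto simp: good_env_def)
  then have "\<sigma> i \<noteq> Star" "Star \<noteq> \<sigma> i" "\<sigma> i \<noteq> Succ s" "Succ s \<noteq> \<sigma> i" for i s
    by (metis val.distinct)+
  moreover have "i = j" if "\<sigma> i = \<sigma> j" "\<sigma> j \<noteq> Ix 0" for i j
    using assms(1) that unfolding good_env_def by metis
  ultimately show ?thesis
    using assms(2,3) by (cases a; cases b) simp_all
qed

primrec al_subject :: "'s al \<Rightarrow> 's val" where
  "al_subject ALNil = Star"
| "al_subject (ALPar P Q) = Star"
| "al_subject (ALIn a P) = a"
| "al_subject (ALOut a v) = a"
| "al_subject (ALNu P) = Star"
| "al_subject (ALRep a P) = a"

text \<open>For the constant environment at 0 and nonzero \<open>n\<close>, only the first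
  alternative remains: \<open>n\<close> is restricted in \<open>P\<close>.\<close>

lemma aconf_subject:
  "aconf \<sigma> P X M \<Longrightarrow> A \<in># M \<Longrightarrow> al_subject A = Ix n \<Longrightarrow> n \<in> X \<or> (\<exists>i. \<sigma> i = Ix n)"
proof (induction rule: aconf.induct)
  case (aconf_nu g \<sigma> P X M)
  then have "n \<in> X \<or> (\<exists>i. case_nat (Ix g) \<sigma> i = Ix n)"
    by blast
  moreover have "n = g \<or> (\<exists>j. \<sigma> j = Ix n)" if "case_nat (Ix g) \<sigma> i = Ix n" for i
    using that by (cases i) auto
  ultimately show ?case
    by blast
next
  case (aconf_out \<sigma> a v)
  then show ?case by (cases a) auto
next
  case (aconf_in \<sigma> a v)
  then show ?case by (cases a) auto
next
  case (aconf_rep \<sigma> a v)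
  then show ?case by (cases a) auto
qed auto

lemma ready_iff:
  "ready M a Q R \<longleftrightarrow> ALIn a Q \<in># M \<and> R = M - {#ALIn a Q#} \<or> ALRep a Q \<in># M \<and> R = M"
proof
  show "ready M a Q R \<Longrightarrow> ALIn a Q \<in># M \<and> R = M - {#ALIn a Q#} \<or> ALRep a Q \<in># M \<and> R = M"
    by (cases rule: ready.cases) auto
next
  assume "ALIn a Q \<in># M \<and> R = M - {#ALIn a Q#} \<or> ALRep a Q \<in># M \<and> R = M"
  then show "ready M a Q R"
    using ready_in[of a Q R] ready_rep[of a Q "M - {#ALRep a Q#}"] by auto
qed

lemma comm_iff: "comm M a v Q R \<longleftrightarrow> ALOut a v \<in># M \<and> ready (M - {#ALOut a v#}) a Q R"
proof
  show "comm M a v Q R \<Longrightarrow> ALOut a v \<in># M \<and> ready (M - {#ALOut a v#}) a Q R"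
    by (cases rule: comm.cases) auto
next
  assume "ALOut a v \<in># M \<and> ready (M - {#ALOut a v#}) a Q R"
  then show "comm M a v Q R"
    using commI[of "M - {#ALOut a v#}" a Q R v] by simp
qed

lemma ready_split:
  assumes "ready (M + N) a Q R"
  obtains R' where "ready M a Q R'" "R = R' + N" | R' where "ready N a Q R'" "R = M + R'"
proof -
  have diff: "M + N - {#A#} = M - {#A#} + N" if "A \<in># M" for A
    using diff_union_single_conv[OF that, of N] by (simp add: add.commute)
  from assms consider "ALIn a Q \<in># M" "R = M + N - {#ALIn a Q#}" | "ALIn a Q \<in># N" "R = M + N - {#ALIn a Q#}"
    | "ALRep a Q \<in># M" "R = M + N" | "ALRep a Q \<in># N" "R = M + N"
    unfolding ready_iff by auto
  then show ?thesis
  proof cases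
    case 1
    have "ready M a Q (M - {#ALIn a Q#})" "R = M - {#ALIn a Q#} + N"
      unfolding ready_iff using 1 diff[OF 1(1)] by blast+
    then show ?thesis by (rule that(1))
  next
    case 2
    have "ready N a Q (N - {#ALIn a Q#})" "R = M + (N - {#ALIn a Q#})"
      unfolding ready_iff using 2 diff_union_single_conv[OF 2(1)] by blast+
    then show ?thesis by (rule that(2))
  next
    case 3
    then show ?thesis using that(1)[of M] by (simp add: ready_iff)
  next
    case 4
    then show ?thesis using that(2)[of N] by (simp add: ready_iff)
  qed
qed

text \<open>In the two mixed cases the transition of a parallel composition has to be built by a
  communication or close rule; in the others it comes from one side alone.\<close>

lemma comm_split:
  assumes "comm (M + N) a v Q R"
  obtains
    (left) R' where "comm M a v Q R'" "R = R' + N"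
  | (right) R' where "comm N a v Q R'" "R = M + R'"
  | (left_right) M' R' where "M = add_mset (ALOut a v) M'" "ready N a Q R'" "R = M' + R'"
  | (right_left) N' R' where "N = add_mset (ALOut a v) N'" "ready M a Q R'" "R = R' + N'"
proof -
  from assms have o: "ALOut a v \<in># M + N" and r: "ready (M + N - {#ALOut a v#}) a Q R"
    by (auto simp: comm_iff)
  show ?thesis
  proof (cases "ALOut a v \<in># M")
    case True
    then obtain M' where M: "M = add_mset (ALOut a v) M'"
      by (metis insert_DiffM)
    with r have "ready (M' + N) a Q R"
      by simp
    then show ?thesis
    proof (cases rule: ready_split)
      case (1 R')
      then show ?thesis using left[of R'] by (simp add: M commI)
    next
      case (2 R')
      then show ?thesis using left_right M by blast
    qed
  next
    case False
    then obtain N' where N: "N = add_mset (ALOut a v) N'"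
      using o by (metis insert_DiffM union_iff)
    with r have "ready (M + N') a Q R"
      by simp
    then show ?thesis
    proof (cases rule: ready_split)
      case (1 R')
      then show ?thesis using right_left N by blast
    next
      case (2 R')
      then show ?thesis using right[of R'] by (simp add: N commI)
    qed
  qed
qed

text \<open>Whether an output is free or bound depends on where the restriction of its object stands
  in the syntax, which the configuration does not show; hence two alternatives.\<close>

definition out_conf where
  "out_conf \<sigma> P X a v R \<longleftrightarrow>
     (\<exists>w P'. al_lts P (LOut a w) P' \<and> sub_val \<sigma> w = v \<and> aconf \<sigma> P' X R) \<or>
     (\<exists>m Y P'. v = Ix m \<and> X = insert m Y \<and> m \<notin> Y \<and> al_lts P (LBOut a) P' \<and>
        aconf (case_nat (Ix m) \<sigma>) P' Y R)"

lemma out_conf_free: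
  "al_lts P (LOut a w) P' \<Longrightarrow> aconf \<sigma> P' X R \<Longrightarrow> out_conf \<sigma> P X a (sub_val \<sigma> w) R"
  unfolding out_conf_def by blast

lemma out_conf_bound:
  "al_lts P (LBOut a) P' \<Longrightarrow> aconf (case_nat (Ix m) \<sigma>) P' Y R \<Longrightarrow> m \<notin> Y \<Longrightarrow>
   out_conf \<sigma> P (insert m Y) a (Ix m) R"
  unfolding out_conf_def by blast

lemma out_conf_par:
  assumes "out_conf \<sigma> P X a v R" "aconf \<sigma> Q Y N" "X \<inter> Y = {}"
  shows "out_conf \<sigma> (ALPar P Q) (X \<union> Y) a v (R + N)" "out_conf \<sigma> (ALPar Q P) (Y \<union> X) a v (N + R)"
proof -
  have "out_conf \<sigma> (ALPar P Q) (X \<union> Y) a v (R + N) \<and> out_conf \<sigma> (ALPar Q P) (Y \<union> X) a v (N + R)"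
    using assms(1)[unfolded out_conf_def]
  proof (elim disjE exE conjE)
    fix w P'
    assume l: "al_lts P (LOut a w) P'" "sub_val \<sigma> w = v" and c: "aconf \<sigma> P' X R"
    have "aconf \<sigma> (ALPar P' Q) (X \<union> Y) (R + N)" "aconf \<sigma> (ALPar Q P') (Y \<union> X) (N + R)"
      using c assms by (auto intro!: aconf_par)
    then show ?thesis
      using al_lts.par1[OF l(1), of Q] al_lts.par2[OF l(1), of Q] l(2) out_conf_free by fastforce
  next
    fix m Z P'
    assume l: "al_lts P (LBOut a) P'" and v: "v = Ix m" and X: "X = insert m Z" "m \<notin> Z"
      and c: "aconf (case_nat (Ix m) \<sigma>) P' Z R"
    have "aconf (case_nat (Ix m) \<sigma>) (ALPar P' (al_shift Q)) (Z \<union> Y) (R + N)"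
      "aconf (case_nat (Ix m) \<sigma>) (ALPar (al_shift Q) P') (Y \<union> Z) (N + R)"
      using c assms X by (auto intro!: aconf_par)
    moreover have "X \<union> Y = insert m (Z \<union> Y)" "Y \<union> X = insert m (Y \<union> Z)" "m \<notin> Z \<union> Y" "m \<notin> Y \<union> Z"
      using X assms(3) by auto
    ultimately show ?thesis
      using out_conf_bound[OF al_lts.par1_b[OF l]] out_conf_bound[OF al_lts.par2_b[OF l]] v by simp
  qed
  then show "out_conf \<sigma> (ALPar P Q) (X \<union> Y) a v (R + N)" "out_conf \<sigma> (ALPar Q P) (Y \<union> X) a v (N + R)"
    by blast+
qed

lemma out_conf_nu:
  assumes "out_conf (case_nat (Ix g) \<sigma>) P X (shift_val 1 a) v R" "g \<notin> X"
  shows "out_conf \<sigma> (ALNu P) (insert g X) a v R"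
  using assms(1)[unfolded out_conf_def]
proof (elim disjE exE conjE)
  fix w P'
  assume l: "al_lts P (LOut (shift_val 1 a) w) P'" and w: "sub_val (case_nat (Ix g) \<sigma>) w = v"
    and c: "aconf (case_nat (Ix g) \<sigma>) P' X R"
  \<comment> \<open>Index 0 is the name restricted here, so sending it opens the scope; any other
    object is a shifted value and leaves the restriction in place.\<close>
  show ?thesis
  proof (cases "w = Ix 0")
    case True
    then have "al_lts (ALNu P) (LBOut a) P'" "v = Ix g"
      using al_lts.opn[of P a P'] l w by auto
    then show ?thesis
      using out_conf_bound c assms(2) by blast
  next
    case False
    then obtain u where u: "w = shift_val 1 u"
      by (cases w) (auto intro: that[of Star] that[of "Succ _"] that[of "Ix (_ - 1)"], metis One_nat_def Suc_pred neq0_conv shift_val_simps(3) add.commute plus_1_eq_Suc)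
    then have "al_lts (ALNu P) (LOut a u) (ALNu P')"
      using al_lts.res[of P "LOut a u" P'] l by simp
    moreover have "sub_val \<sigma> u = v"
      using w u by simp
    ultimately show ?thesis
      using out_conf_free aconf_nu[OF c assms(2)] by blast
  qed
next
  fix m Z P'
  assume l: "al_lts P (LBOut (shift_val 1 a)) P'" and v: "v = Ix m" and X: "X = insert m Z" "m \<notin> Z"
    and c: "aconf (case_nat (Ix m) (case_nat (Ix g) \<sigma>)) P' Z R"
  have "aconf (case_nat (Ix m) \<sigma>) (ALNu (al_swap P')) (insert g Z) R"
    using c X assms(2) by (intro aconf_nu) (auto simp: aconf_al_swap)
  moreover have "insert g X = insert m (insert g Z)" "m \<notin> insert g Z"
    using X assms(2) by auto
  ultimately show ?thesis
    using out_conf_bound[OF al_lts.res_b[OF l]] v by simp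
qed

lemma aconf_out_lts:
  "aconf \<sigma> P X M \<Longrightarrow> good_env \<sigma> X \<Longrightarrow> M = add_mset (ALOut (sub_val \<sigma> a) v) R \<Longrightarrow>
   sub_val \<sigma> a \<noteq> Ix 0 \<Longrightarrow> out_conf \<sigma> P X a v R"
proof (induction arbitrary: a R rule: aconf.induct)
  case (aconf_par \<sigma> P X M Q Y N)
  let ?A = "ALOut (sub_val \<sigma> a) v"
  have g: "good_env \<sigma> X" "good_env \<sigma> Y"
    using aconf_par.prems(1) by (auto intro: good_env_mono)
  show ?case
  proof (cases "?A \<in># M")
    case True
    then obtain M' where M: "M = add_mset ?A M'"
      by (metis insert_DiffM)
    then have "R = M' + N"
      using aconf_par.prems(2) by simp
    then show ?thesis
      using out_conf_par(1)[OF aconf_par.IH(1)[OF g(1) M aconf_par.prems(3)] aconf_par.hyps(2,3)] by simp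
  next
    case False
    then have "?A \<in># N"
      using aconf_par.prems(2) by (metis union_iff union_single_eq_member)
    then obtain N' where N: "N = add_mset ?A N'"
      by (metis insert_DiffM)
    then have "R = M + N'"
      using aconf_par.prems(2) by simp
    then show ?thesis
      using out_conf_par(2)[OF aconf_par.IH(2)[OF g(2) N aconf_par.prems(3)] aconf_par.hyps(1)]
        aconf_par.hyps(3) by (simp add: Int_commute)
  qed
next
  case (aconf_nu g \<sigma> P X M)
  then show ?case
    by (intro out_conf_nu aconf_nu.IH good_env_nu) auto
next
  case (aconf_out \<sigma> b w)
  then have "b = a" "v = sub_val \<sigma> w" "R = {#}"
    using good_env_inj[of \<sigma> "{}" b a] by auto
  then show ?case
    using al_lts.out[of a w] aconf_nil[of \<sigma>] unfolding out_conf_def by blast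
qed auto

lemma aconf_in_lts:
  "aconf \<sigma> P X M \<Longrightarrow> good_env \<sigma> X \<Longrightarrow> ready M (sub_val \<sigma> a) Q R \<Longrightarrow> sub_val \<sigma> a \<noteq> Ix 0 \<Longrightarrow>
   \<exists>P'. al_lts P (LIn a w) P' \<and> al_residual \<sigma> X (sub_val \<sigma> w) Q R P'"
proof (induction arbitrary: a w R rule: aconf.induct)
  case (aconf_par \<sigma> P X M S Y N)
  have g: "good_env \<sigma> X" "good_env \<sigma> Y"
    using aconf_par.prems(1) by (auto intro: good_env_mono)
  from aconf_par.prems(2) show ?case
  proof (cases rule: ready_split)
    case (1 R')
    from aconf_par.IH(1)[OF g(1) 1(1) aconf_par.prems(3), of w] obtain P' where
      "al_lts P (LIn a w) P'" "al_residual \<sigma> X (sub_val \<sigma> w) Q R' P'"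
      by blast
    then show ?thesis
      using al_lts.par1[of P "LIn a w" P' S] al_residual_par(1)[OF _ aconf_par.hyps(2,3)] 1 by auto
  next
    case (2 R')
    from aconf_par.IH(2)[OF g(2) 2(1) aconf_par.prems(3), of w] obtain P' where
      "al_lts S (LIn a w) P'" "al_residual \<sigma> Y (sub_val \<sigma> w) Q R' P'"
      by blast
    then show ?thesis
      using al_lts.par2[of S "LIn a w" P' P] al_residual_par(2)[OF _ aconf_par.hyps(1)] aconf_par.hyps(3) 2
      by (auto simp: Int_commute)
  qed
next
  case (aconf_nu g \<sigma> P X M)
  have "\<exists>P'. al_lts P (LIn (shift_val 1 a) (shift_val 1 w)) P' \<and>
      al_residual (case_nat (Ix g) \<sigma>) X (sub_val (case_nat (Ix g) \<sigma>) (shift_val 1 w)) Q R P'"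
    using aconf_nu.prems aconf_nu.hyps by (intro aconf_nu.IH good_env_nu) auto
  then obtain P' where "al_lts P (LIn (shift_val 1 a) (shift_val 1 w)) P'"
    and "al_residual (case_nat (Ix g) \<sigma>) X (sub_val \<sigma> w) Q R P'"
    by auto
  then show ?case
    using al_lts.res[of P "LIn a w" P'] al_residual_nu[of g \<sigma>, OF _ aconf_nu.hyps(2)]
    by (intro exI[of _ "ALNu P'"]) auto
next
  case (aconf_in \<sigma> b S)
  then have "b = a" "Q = al_sub (up 1 \<sigma>) S" "R = {#}"
    using good_env_inj[of \<sigma> "{}" b a] by (auto simp: ready_iff)
  then show ?case
    using al_lts.inp[of a S w] aconf_al_inst[of \<sigma> w S] by (auto simp: al_residual_def)
next
  case (aconf_rep \<sigma> b S)
  then have *: "b = a" "Q = al_sub (up 1 \<sigma>) S" "R = {#ALRep (sub_val \<sigma> a) (al_sub (up 1 \<sigma>) S)#}"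
    using good_env_inj[of \<sigma> "{}" b a] by (auto simp: ready_iff)
  have "al_residual \<sigma> {} (sub_val \<sigma> w) Q R (ALPar (al_inst w S) (ALRep a S))"
    unfolding al_residual_def * using aconf_par[OF _ aconf.aconf_rep[of \<sigma> a S]]
      aconf_al_inst[of \<sigma> w S] by auto
  then show ?case
    using al_lts.rep[of a S w] * by blast
qed (auto simp: ready_iff)

lemma aconf_comm_out_in:
  assumes "aconf \<sigma> P X (add_mset (ALOut a v) R)" "aconf \<sigma> S Y N" "ready N a Q R'"
    and "good_env \<sigma> (X \<union> Y)" "X \<inter> Y = {}" and a: "a = Ix n" "n \<noteq> 0"
  shows "\<exists>P'. al_lts (ALPar P S) LTau P' \<and> al_residual \<sigma> (X \<union> Y) v Q (R + R') P'"
    "\<exists>P'. al_lts (ALPar S P) LTau P' \<and> al_residual \<sigma> (X \<union> Y) v Q (R + R') P'"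
proof -
  have "n \<in> X \<or> (\<exists>i. \<sigma> i = Ix n)"
    using aconf_subject[OF assms(1), of "ALOut a v"] a by auto
  moreover have "n \<in> Y \<or> (\<exists>i. \<sigma> i = Ix n)"
    using aconf_subject[OF assms(2), of "ALIn a Q"] aconf_subject[OF assms(2), of "ALRep a Q"] a assms(3)
    by (auto simp: ready_iff)
  \<comment> \<open>The common subject cannot be restricted on both sides, so it comes from the
    environment, and both sides refer to it by the same index.\<close>
  ultimately obtain i where i: "\<sigma> i = Ix n"
    using assms(5) by blast
  have a_eq: "sub_val \<sigma> (Ix i) = a" "sub_val \<sigma> (Ix i) \<noteq> Ix 0"
    using i a by auto
  have g: "good_env \<sigma> X" "good_env \<sigma> Y"
    using assms(4) by (auto intro: good_env_mono)
  have "out_conf \<sigma> P X (Ix i) v R"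
    using aconf_out_lts[OF assms(1) g(1)] a_eq by simp
  then have "(\<exists>P'. al_lts (ALPar P S) LTau P' \<and> al_residual \<sigma> (X \<union> Y) v Q (R + R') P') \<and>
      (\<exists>P'. al_lts (ALPar S P) LTau P' \<and> al_residual \<sigma> (X \<union> Y) v Q (R + R') P')"
    unfolding out_conf_def
  proof (elim disjE exE conjE)
    fix w P'
    assume l: "al_lts P (LOut (Ix i) w) P'" and w: "sub_val \<sigma> w = v" and c: "aconf \<sigma> P' X R"
    obtain S' where S': "al_lts S (LIn (Ix i) w) S'" "al_residual \<sigma> Y v Q R' S'"
      using aconf_in_lts[OF assms(2) g(2), of "Ix i" Q R' w] assms(3) a_eq w by auto
    show ?thesis
      using comm1[OF l S'(1)] comm2[OF S'(1) l] al_residual_par[OF S'(2) c] assms(5)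
      by (auto simp: ac_simps)
  next
    fix m Z P'
    assume l: "al_lts P (LBOut (Ix i)) P'" and v: "v = Ix m" and X: "X = insert m Z" "m \<notin> Z"
      and c: "aconf (case_nat (Ix m) \<sigma>) P' Z R"
    have m: "m \<notin> Y" "Z \<inter> Y = {}" "m \<notin> Z \<union> Y"
      using X assms(5) by auto
    have "good_env (case_nat (Ix m) \<sigma>) Y"
      using good_env_mono[OF assms(4)] X m by (intro good_env_nu) auto
    from aconf_in_lts[OF _ this, of "al_shift S" N "Ix (Suc i)" Q R' "Ix 0"] obtain S' where
      S': "al_lts (al_shift S) (LIn (shift_val 1 (Ix i)) (Ix 0)) S'"
        "al_residual (case_nat (Ix m) \<sigma>) Y v Q R' S'"
      using assms(2,3) a_eq i v by auto
    have "al_residual (case_nat (Ix m) \<sigma>) (Z \<union> Y) v Q (R + R') (ALPar P' S')"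
      "al_residual (case_nat (Ix m) \<sigma>) (Z \<union> Y) v Q (R + R') (ALPar S' P')"
      using al_residual_par[OF S'(2) c] m by (simp_all add: ac_simps)
    from this[THEN al_residual_nu[OF _ m(3)]] show ?thesis
      using close1[OF l S'(1)] close2[OF S'(1) l] X by auto
  qed
  then show "\<exists>P'. al_lts (ALPar P S) LTau P' \<and> al_residual \<sigma> (X \<union> Y) v Q (R + R') P'"
    "\<exists>P'. al_lts (ALPar S P) LTau P' \<and> al_residual \<sigma> (X \<union> Y) v Q (R + R') P'"
    by blast+
qed

text \<open>Converse of the case \<open>LTau\<close> of \<open>al_lts_act_conf\<close>;
  \<open>n \<noteq> 0\<close> rules out atoms whose distinct free subjects are identified by the
  environment.\<close>

lemma aconf_tau_lts:
  "aconf \<sigma> P X M \<Longrightarrow> good_env \<sigma> X \<Longrightarrow> comm M (Ix n) v Q R \<Longrightarrow> n \<noteq> 0 \<Longrightarrow>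
   \<exists>P'. al_lts P LTau P' \<and> al_residual \<sigma> X v Q R P'"
proof (induction arbitrary: R rule: aconf.induct)
  case (aconf_par \<sigma> P X M S Y N)
  have g: "good_env \<sigma> X" "good_env \<sigma> Y"
    using aconf_par.prems(1) by (auto intro: good_env_mono)
  from aconf_par.prems(2) show ?case
  proof (cases rule: comm_split)
    case (left R')
    from aconf_par.IH(1)[OF g(1) left(1) aconf_par.prems(3)] obtain P' where
      "al_lts P LTau P'" "al_residual \<sigma> X v Q R' P'"
      by blast
    then show ?thesis
      using al_lts.par1[of P LTau P' S] al_residual_par(1)[OF _ aconf_par.hyps(2,3)] left by auto
  next
    case (right R')
    from aconf_par.IH(2)[OF g(2) right(1) aconf_par.prems(3)] obtain P' where
      "al_lts S LTau P'" "al_residual \<sigma> Y v Q R' P'"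
      by blast
    then show ?thesis
      using al_lts.par2[of S LTau P' P] al_residual_par(2)[OF _ aconf_par.hyps(1)] aconf_par.hyps(3) right
      by (auto simp: Int_commute)
  next
    case (left_right M' R')
    then show ?thesis
      using aconf_comm_out_in(1)[of \<sigma> P X "Ix n" v M' S Y N Q R' n] aconf_par by simp
  next
    case (right_left N' R')
    then show ?thesis
      using aconf_comm_out_in(2)[of \<sigma> S Y "Ix n" v N' P X M Q R' n] aconf_par by (simp add: ac_simps)
  qed
next
  case (aconf_nu g \<sigma> P X M)
  have "\<exists>P'. al_lts P LTau P' \<and> al_residual (case_nat (Ix g) \<sigma>) X v Q R P'"
    using aconf_nu.prems aconf_nu.hyps by (intro aconf_nu.IH good_env_nu) auto
  then obtain P' where "al_lts P LTau P'" "al_residual (case_nat (Ix g) \<sigma>) X v Q R P'"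
    by blast
  then show ?case
    using al_lts.res[of P LTau P'] al_residual_nu[of g \<sigma>, OF _ aconf_nu.hyps(2)]
    by (intro exI[of _ "ALNu P'"]) auto
qed (auto simp: comm_iff ready_iff)

section \<open>The encoding under substitutions\<close>

text \<open>What the encoding needs of typing and localisation: subjects of inputs are names, not
  success names or the unit value, and received names are no input subjects. It refers to no typing
  environment, and \<open>wf_al_al_sub\<close> transfers it along substitutions.\<close>

primrec wf_al :: "'s al \<Rightarrow> bool" where
  "wf_al ALNil \<longleftrightarrow> True"
| "wf_al (ALPar P Q) \<longleftrightarrow> wf_al P \<and> wf_al Q"
| "wf_al (ALIn a P) \<longleftrightarrow> (\<exists>i. a = Ix i) \<and> 0 \<notin> al_inputs P \<and> wf_al P"
| "wf_al (ALOut a v) \<longleftrightarrow> True"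
| "wf_al (ALNu P) \<longleftrightarrow> wf_al P"
| "wf_al (ALRep a P) \<longleftrightarrow> (\<exists>i. a = Ix i) \<and> 0 \<notin> al_inputs P \<and> wf_al P"

lemma wf_al_of_typed: "al_typed \<Gamma> P \<Longrightarrow> localised P \<Longrightarrow> wf_al P"
  by (induction rule: al_typed.induct) auto

lemma up_1_eq_Ix_0: "up (Suc 0) \<sigma> i = Ix 0 \<longleftrightarrow> i = 0"
proof (cases i)
  case (Suc k)
  then show ?thesis
    by (cases "\<sigma> k") (auto simp: up_1)
qed (simp add: up_1)

lemma up_1_eq_Ix_Suc: "up (Suc 0) \<sigma> i = Ix (Suc j) \<longleftrightarrow> (\<exists>k. i = Suc k \<and> \<sigma> k = Ix j)"
proof (cases i)
  case (Suc k)
  then show ?thesis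
    by (cases "\<sigma> k") (auto simp: up_1)
qed (simp add: up_1)

lemma al_inputs_al_sub: "j \<in> al_inputs (al_sub \<sigma> P) \<Longrightarrow> \<exists>i\<in>al_inputs P. \<sigma> i = Ix j"
proof (induction P arbitrary: \<sigma> j)
  case (ALIn a P)
  then show ?case
    using ALIn.IH[of "Suc j" "up 1 \<sigma>"]
    by (cases a) (auto simp: val_fn_def unbind_def up_1_eq_Ix_Suc)
next
  case (ALRep a P)
  then show ?case
    using ALRep.IH[of "Suc j" "up 1 \<sigma>"]
    by (cases a) (auto simp: val_fn_def unbind_def up_1_eq_Ix_Suc)
next
  case (ALNu P)
  then show ?case
    using ALNu.IH[of "Suc j" "up 1 \<sigma>"] by (auto simp: unbind_def up_1_eq_Ix_Suc)
next
  case (ALPar P Q)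
  then show ?case by (auto, blast+)
qed auto

lemma up_1_name: "(\<And>k. i = Suc k \<Longrightarrow> \<exists>j. \<sigma> k = Ix j) \<Longrightarrow> \<exists>j. up (Suc 0) \<sigma> i = Ix j"
  by (cases i) (force simp: up_1)+

lemma wf_al_al_sub:
  "wf_al P \<Longrightarrow> (\<And>i. i \<in> al_inputs P \<Longrightarrow> \<exists>j. \<sigma> i = Ix j) \<Longrightarrow> wf_al (al_sub \<sigma> P)"
proof (induction P arbitrary: \<sigma>)
  case (ALIn a P)
  have "wf_al (al_sub (up (Suc 0) \<sigma>) P)"
    using ALIn.prems by (intro ALIn.IH up_1_name) (auto simp: unbind_def)
  moreover have "0 \<notin> al_inputs (al_sub (up (Suc 0) \<sigma>) P)"
    using al_inputs_al_sub ALIn.prems(1) by (fastforce simp: up_1_eq_Ix_0)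
  ultimately show ?case
    using ALIn.prems by (auto simp: val_fn_def)
next
  case (ALRep a P)
  have "wf_al (al_sub (up (Suc 0) \<sigma>) P)"
    using ALRep.prems by (intro ALRep.IH up_1_name) (auto simp: unbind_def)
  moreover have "0 \<notin> al_inputs (al_sub (up (Suc 0) \<sigma>) P)"
    using al_inputs_al_sub ALRep.prems(1) by (fastforce simp: up_1_eq_Ix_0)
  ultimately show ?case
    using ALRep.prems by (auto simp: val_fn_def)
next
  case (ALNu P)
  then show ?case
    by (auto intro!: ALNu.IH up_1_name simp: unbind_def)
qed auto

lemma wf_al_al_inst: "wf_al P \<Longrightarrow> 0 \<notin> al_inputs P \<Longrightarrow> wf_al (al_inst v P)"
  unfolding al_inst_def
proof (rule wf_al_al_sub)
  fix i assume "0 \<notin> al_inputs P" "i \<in> al_inputs P"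
  then show "\<exists>j. (case i of 0 \<Rightarrow> v | Suc j \<Rightarrow> Ix j) = Ix j"
    by (cases i) auto
qed

lemma sub_val_enter_shift:
  "sub_val (\<lambda>i. Ix (enter r n \<rho> i)) (shift_val (Suc 0) v) = shift_val n (sub_val (\<lambda>i. Ix (\<rho> i)) v)"
  by (cases v) (auto simp: enter_def)

lemma up_add [simp]: "up n \<zeta> (i + n) = shift_val n (\<zeta> i)"
  by (simp add: up_def)

text \<open>This and \<open>inputs_agree\<close> are the commuting squares for
  \<open>aw_sub_encode\<close>: \<open>\<sigma>\<close> acts on ALpi names and
  \<open>\<zeta>\<close> on O-names. They are required only at names that occur, since
  \<open>f\<close> has no entry for received names.\<close>

definition names_agree where
  "names_agree \<zeta> \<sigma> \<rho> \<rho>' P \<longleftrightarrow> (\<forall>i\<in>al_fn P. \<zeta> (\<rho> i) = sub_val (\<lambda>j. Ix (\<rho>' j)) (\<sigma> i))"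

definition inputs_agree where
  "inputs_agree \<zeta> \<sigma> f f' P \<longleftrightarrow>
     (\<forall>i\<in>al_inputs P. \<exists>j k k'. \<sigma> i = Ix j \<and> f i = Some k \<and> f' j = Some k' \<and> \<zeta> k = Ix k')"

lemma names_agreeI:
  assumes "0 \<in> al_fn P \<Longrightarrow> \<zeta> (\<rho> 0) = sub_val (\<lambda>j. Ix (\<rho>' j)) (\<sigma> 0)"
    and "\<And>i. Suc i \<in> al_fn P \<Longrightarrow> \<zeta> (\<rho> (Suc i)) = sub_val (\<lambda>j. Ix (\<rho>' j)) (\<sigma> (Suc i))"
  shows "names_agree \<zeta> \<sigma> \<rho> \<rho>' P"
  unfolding names_agree_def
proof
  show "\<zeta> (\<rho> i) = sub_val (\<lambda>j. Ix (\<rho>' j)) (\<sigma> i)" if "i \<in> al_fn P" for i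
    using assms that by (cases i) auto
qed

lemma inputs_agreeI:
  assumes "0 \<notin> al_inputs P"
    and "\<And>i. Suc i \<in> al_inputs P \<Longrightarrow>
      \<exists>j k k'. \<sigma> (Suc i) = Ix j \<and> f (Suc i) = Some k \<and> f' j = Some k' \<and> \<zeta> k = Ix k'"
  shows "inputs_agree \<zeta> \<sigma> f f' P"
  unfolding inputs_agree_def
proof
  show "\<exists>j k k'. \<sigma> i = Ix j \<and> f i = Some k \<and> f' j = Some k' \<and> \<zeta> k = Ix k'" if "i \<in> al_inputs P" for i
    using assms that by (cases i) auto
qed

lemma names_agree_enter:
  assumes "\<And>i. Suc i \<in> al_fn P \<Longrightarrow> \<zeta> (\<rho> i) = sub_val (\<lambda>j. Ix (\<rho>' j)) (\<sigma> i)" "r < n"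
  shows "names_agree (up n \<zeta>) (up 1 \<sigma>) (enter r n \<rho>) (enter r n \<rho>') P"
  unfolding names_agree_def
proof
  fix i assume i: "i \<in> al_fn P"
  show "up n \<zeta> (enter r n \<rho> i) = sub_val (\<lambda>j. Ix (enter r n \<rho>' j)) (up 1 \<sigma> i)"
  proof (cases i)
    case 0
    then show ?thesis using assms(2) by (simp add: enter_def up_def)
  next
    case (Suc k)
    then have "up n \<zeta> (enter r n \<rho> i) = shift_val n (\<zeta> (\<rho> k))"
      by (simp add: enter_def)
    also have "\<dots> = sub_val (\<lambda>j. Ix (enter r n \<rho>' j)) (up 1 \<sigma> i)"
      using assms(1) i Suc by (simp add: up_1 sub_val_enter_shift)
    finally show ?thesis .
  qed
qed

lemma inputs_agree_enter:
  assumes "\<And>i. Suc i \<in> al_inputs P \<Longrightarrow>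
      \<exists>j k k'. \<sigma> i = Ix j \<and> f i = Some k \<and> f' j = Some k' \<and> \<zeta> k = Ix k'"
    and "0 \<in> al_inputs P \<Longrightarrow> \<exists>r<n. x = Some r"
  shows "inputs_agree (up n \<zeta>) (up 1 \<sigma>) (enter_f x n f) (enter_f x n f') P"
  unfolding inputs_agree_def
proof
  fix i assume i: "i \<in> al_inputs P"
  show "\<exists>j k k'. up 1 \<sigma> i = Ix j \<and> enter_f x n f i = Some k \<and> enter_f x n f' j = Some k' \<and> up n \<zeta> k = Ix k'"
  proof (cases i)
    case 0
    then obtain r where "r < n" "x = Some r"
      using assms(2) i by blast
    then show ?thesis
      using 0 by (auto simp: enter_f_def up_def)
  next
    case (Suc l)
    then obtain j k k' where "\<sigma> l = Ix j" "f l = Some k" "f' j = Some k'" "\<zeta> k = Ix k'"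
      using assms(1) i by blast
    then have "up 1 \<sigma> i = Ix (Suc j)" "enter_f x n f i = Some (k + n)"
      "enter_f x n f' (Suc j) = Some (k' + n)" "up n \<zeta> (k + n) = Ix (k' + n)"
      using Suc by (simp_all add: enter_f_def shift_f_def up_1)
    then show ?thesis
      by blast
  qed
qed

lemma aw_sub_handler [simp]:
  "aw_sub (up_i (Suc 0) (up_i (Suc 0) (up_i (Suc 0) \<eta>))) (up (Suc (Suc (Suc 0))) \<zeta>) handler = handler"
  by (simp add: handler_def up_def up_i_def)

text \<open>The encoding introduces its auxiliary names without inspecting the names it is applied
  to, so substitution passes through as an equality. Encoded processes have no free I-names, hence
  the arbitrary \<open>\<eta>\<close>. All encodings arising under various \<open>\<rho>\<close> and
  \<open>f\<close> are thereby reduced to one over global names.\<close>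

lemma aw_sub_encode:
  "wf_al P \<Longrightarrow> names_agree \<zeta> \<sigma> \<rho> \<rho>' P \<Longrightarrow> inputs_agree \<zeta> \<sigma> f f' P \<Longrightarrow>
   aw_sub \<eta> \<zeta> (encode \<rho> f P) = encode \<rho>' f' (al_sub \<sigma> P)"
proof (induction \<rho> f P arbitrary: \<eta> \<zeta> \<rho>' f' \<sigma> rule: encode.induct)
  case (1 \<rho> f)
  then show ?case by simp
next
  case (2 \<rho> f P Q)
  then show ?case by (simp add: names_agree_def inputs_agree_def)
next
  case (3 \<rho> f a v)
  have "sub_val \<zeta> (sub_val (\<lambda>i. Ix (\<rho> i)) u) = sub_val (\<lambda>i. Ix (\<rho>' i)) (sub_val \<sigma> u)"
    if "u = a \<or> u = v" for u
    using 3 that by (cases u) (auto simp: names_agree_def val_fn_def)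
  then show ?case by simp
next
  case (4 \<rho> f P)
  have "names_agree (up 3 \<zeta>) (up 1 \<sigma>) (enter 2 3 \<rho>) (enter 2 3 \<rho>') P"
    using 4 by (intro names_agree_enter) (auto simp: names_agree_def unbind_def)
  moreover have "inputs_agree (up 3 \<zeta>) (up 1 \<sigma>) (enter_f (Some 1) 3 f) (enter_f (Some 1) 3 f') P"
    using 4 by (intro inputs_agree_enter) (auto simp: inputs_agree_def unbind_def)
  ultimately show ?case
    using 4 up_up[of 1 2 \<zeta>] up_up[of 1 1 \<zeta>] by (simp add: numeral_2_eq_2 numeral_3_eq_3)
next
  case (5 \<rho> f a P)
  then obtain i where a: "a = Ix i"
    by auto
  then obtain j k k' where f: "\<sigma> i = Ix j" "f i = Some k" "f' j = Some k'" "\<zeta> k = Ix k'"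
    using 5 by (auto simp: inputs_agree_def val_fn_def)
  have "names_agree (up 2 \<zeta>) (up 1 \<sigma>) (enter 0 2 \<rho>) (enter 0 2 \<rho>') P"
    using 5 by (intro names_agree_enter) (auto simp: names_agree_def unbind_def)
  moreover have "inputs_agree (up 2 \<zeta>) (up 1 \<sigma>) (enter_f None 2 f) (enter_f None 2 f') P"
    using 5 by (intro inputs_agree_enter) (auto simp: inputs_agree_def unbind_def)
  ultimately show ?case
    using 5 up_up[of 1 1 \<zeta>] a f by (simp add: f_at_def up_i_1 up_1 numeral_2_eq_2)
next
  case (6 \<rho> f a P)
  have "aw_sub \<eta>' (up 2 \<zeta>) (encode (\<lambda>i. \<rho> i + 2) (shift_f 2 f) (ALIn a P)) =
      encode (\<lambda>i. \<rho>' i + 2) (shift_f 2 f') (al_sub \<sigma> (ALIn a P))" for \<eta>'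
  proof (rule 6)
    show "names_agree (up 2 \<zeta>) \<sigma> (\<lambda>i. \<rho> i + 2) (\<lambda>i. \<rho>' i + 2) (ALIn a P)"
      unfolding names_agree_def
    proof
      fix i assume "i \<in> al_fn (ALIn a P)"
      then have "\<zeta> (\<rho> i) = sub_val (\<lambda>j. Ix (\<rho>' j)) (\<sigma> i)"
        using 6 by (simp add: names_agree_def)
      then show "up 2 \<zeta> (\<rho> i + 2) = sub_val (\<lambda>j. Ix (\<rho>' j + 2)) (\<sigma> i)"
        unfolding up_add by (cases "\<sigma> i") simp_all
    qed
    show "inputs_agree (up 2 \<zeta>) \<sigma> (shift_f 2 f) (shift_f 2 f') (ALIn a P)"
      unfolding inputs_agree_def
    proof
      fix i assume "i \<in> al_inputs (ALIn a P)"
      then obtain j k k' where "\<sigma> i = Ix j" "f i = Some k" "f' j = Some k'" "\<zeta> k = Ix k'"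
        using 6(4) unfolding inputs_agree_def al_inputs.simps by meson
      then have "\<sigma> i = Ix j" "shift_f 2 f i = Some (k + 2)" "shift_f 2 f' j = Some (k' + 2)"
        "up 2 \<zeta> (k + 2) = Ix (k' + 2)"
        unfolding up_add by (simp_all add: shift_f_def)
      then show "\<exists>j k k'. \<sigma> i = Ix j \<and> shift_f 2 f i = Some k \<and> shift_f 2 f' j = Some k' \<and> up 2 \<zeta> k = Ix k'"
        by blast
    qed
  qed (use 6 in simp)
  moreover have "up 1 \<zeta> 0 = Ix 0" "up 2 \<zeta> 1 = Ix 1"
    by (simp_all add: up_def)
  ultimately show ?case
    using up_up[of 1 1 \<zeta>] by (simp del: encode.simps(5) add: numeral_2_eq_2 up_i_1)
qed

section \<open>Global AWpi names and the encoding over them\<close>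

datatype role = RA | RB | RC | RZ | RD

text \<open>Global AWpi names: \<open>nm RA n\<close>, \<open>nm RB n\<close>, \<open>nm RC n\<close> are the three names of the ALpi name
  \<open>n\<close>; the roles \<open>RZ\<close> and \<open>RD\<close> are for the names introduced by inputs and replicated inputs.\<close>

definition nm :: "role \<Rightarrow> nat \<Rightarrow> nat" where
  "nm r n = Suc (5 * n + (case r of RA \<Rightarrow> 0 | RB \<Rightarrow> 1 | RC \<Rightarrow> 2 | RZ \<Rightarrow> 3 | RD \<Rightarrow> 4))"

lemma nm_eq_iff [simp]: "nm r m = nm s n \<longleftrightarrow> r = s \<and> m = n"
  by (cases r; cases s; simp add: nm_def; presburger)

lemma nm_neq_0 [simp]: "nm r n \<noteq> 0" "0 \<noteq> nm r n"
  by (simp_all add: nm_def)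

definition glob :: "'s val \<Rightarrow> 's val" where
  "glob = sub_val (\<lambda>i. Ix (nm RA i))"

lemma glob_simps [simp]: "glob Star = Star" "glob (Succ s) = Succ s" "glob (Ix i) = Ix (nm RA i)"
  by (simp_all add: glob_def)

lemma glob_eq_simps [simp]:
  "glob x = Star \<longleftrightarrow> x = Star" "glob x = Succ s \<longleftrightarrow> x = Succ s"
  "glob x = Ix (nm r n) \<longleftrightarrow> r = RA \<and> x = Ix n"
  by (cases x; auto)+

text \<open>Encodings in a context where the ALpi name \<open>n\<close> is the O-name
  \<open>nm RA n\<close> and inputs at \<open>n\<close> send requests on \<open>nm RB n\<close>.
  \<open>genc_body\<close> stands under the parameter of an input and \<open>genc_copy\<close> under
  the unit parameter of a server, which accounts for the additional O-index.\<close>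

definition genc :: "'s al \<Rightarrow> 's aw" where
  "genc P = encode (nm RA) (\<lambda>i. Some (nm RB i)) P"

definition genc_body :: "'s al \<Rightarrow> 's aw" where
  "genc_body P = encode (enter 0 1 (nm RA)) (enter_f None 1 (\<lambda>i. Some (nm RB i))) P"

definition genc_copy :: "nat \<Rightarrow> 's al \<Rightarrow> 's aw" where
  "genc_copy n P = encode (\<lambda>i. nm RA i + 1) (\<lambda>i. Some (nm RB i + 1)) (ALIn (Ix n) P)"

text \<open>Localisation is essential here: the map has no entry for the parameter while the
  instance may be any value, and \<open>0 \<notin> al_inputs P\<close> ensures that no entry is
  looked up.\<close>

lemma aw_inst_genc_body:
  assumes "wf_al P" "0 \<notin> al_inputs P"
  shows "aw_inst [WO (glob v)] (genc_body P) = genc (al_inst v P)"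
  unfolding genc_body_def genc_def aw_inst_def al_inst_def Let_def
proof (rule aw_sub_encode[OF assms(1)])
  let ?\<sigma> = "\<lambda>i. case i of 0 \<Rightarrow> v | Suc j \<Rightarrow> Ix j"
  let ?\<zeta> = "\<lambda>i. if i < length (o_args [WO (glob v)]) then o_args [WO (glob v)] ! i
      else Ix (i - length (o_args [WO (glob v)]))"
  show "names_agree ?\<zeta> ?\<sigma> (enter 0 1 (nm RA)) (nm RA) P"
    by (rule names_agreeI) (simp_all add: o_args_def enter_def glob_def)
  show "inputs_agree ?\<zeta> ?\<sigma> (enter_f None 1 (\<lambda>i. Some (nm RB i))) (\<lambda>i. Some (nm RB i)) P"
    using assms(2) by (intro inputs_agreeI) (simp_all add: o_args_def enter_f_def shift_f_def)
qed

lemma aw_inst_genc_copy: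
  assumes "wf_al P" "0 \<notin> al_inputs P"
  shows "aw_inst [WO Star] (genc_copy n P) = genc (ALIn (Ix n) P)"
proof -
  have "aw_inst [WO Star] (genc_copy n P) = genc (al_sub Ix (ALIn (Ix n) P))"
    unfolding genc_copy_def genc_def aw_inst_def Let_def
    by (rule aw_sub_encode) (use assms in \<open>auto simp: names_agree_def inputs_agree_def o_args_def\<close>)
  then show ?thesis
    by simp
qed

text \<open>Naming the restriction removes one of the two O-binders above the body, which takes
  \<open>enter 0 2\<close> to the \<open>enter 0 1\<close> of \<open>genc_body\<close>.\<close>

lemma conf_genc_in:
  assumes "wf_al P" "0 \<notin> al_inputs P"
  shows "conf \<eta> Ix (genc (ALIn (Ix n) P)) {nm RZ z}
    {#AWOut (Ix (nm RB n)) [WO (Ix (nm RZ z))], AWIn (nm RZ z) [KO] (genc_body P)#}"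
proof -
  let ?\<zeta> = "case_nat (Ix (nm RZ z)) Ix"
  have agree: "names_agree (up 1 ?\<zeta>) Ix (enter 0 2 (nm RA)) (enter 0 1 (nm RA)) P"
    by (rule names_agreeI) (simp_all add: enter_def up_1)
  have agree': "inputs_agree (up 1 ?\<zeta>) Ix (enter_f None 2 (\<lambda>i. Some (nm RB i)))
      (enter_f None 1 (\<lambda>i. Some (nm RB i))) P"
    using assms(2) by (intro inputs_agreeI) (simp_all add: enter_f_def shift_f_def up_1)
  have "aw_sub \<eta>' (up 1 ?\<zeta>) (encode (enter 0 2 (nm RA)) (enter_f None 2 (\<lambda>i. Some (nm RB i))) P) =
      genc_body P" for \<eta>'
    using aw_sub_encode[OF assms(1) agree agree', of \<eta>'] by (simp add: genc_body_def)
  then have "conf (case_nat (nm RZ z) \<eta>) ?\<zeta>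
    (AWIn 0 [KO] (encode (enter 0 2 (nm RA)) (enter_f None 2 (\<lambda>i. Some (nm RB i))) P)) {}
    {#AWIn (nm RZ z) [KO] (genc_body P)#}"
    using conf_in[of "[KO]" "case_nat (nm RZ z) \<eta>" ?\<zeta> _ "genc_body P" 0] by (simp add: c_refl)
  from conf_par[OF conf_out[of _ _ "Ix (Suc (nm RB n))" "[WO (Ix 0)]"] this]
  have "conf (case_nat (nm RZ z) \<eta>) ?\<zeta>
    (AWPar (AWOut (Ix (Suc (nm RB n))) [WO (Ix 0)])
      (AWIn 0 [KO] (encode (enter 0 2 (nm RA)) (enter_f None 2 (\<lambda>i. Some (nm RB i))) P))) {}
    {#AWOut (Ix (nm RB n)) [WO (Ix (nm RZ z))], AWIn (nm RZ z) [KO] (genc_body P)#}"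
    by (simp add: add_mset_commute)
  from conf_nu[OF this] show ?thesis
    by (simp add: genc_def f_at_def)
qed

section \<open>Components of an encoded process\<close>

datatype 's chan_state = Idle | Waiting | Holding "'s val"

text \<open>
  The flag of a request or a delivery tells whether the input is an atom of the ALpi process, or
  a copy of a replicated input, which has no counterpart there. The first number is an index that
  identifies the component, the second one (if any) is the ALpi name of the input.
\<close>

datatype 's comp =
    Chan nat "'s chan_state"
  | Msg "'s val" "'s val"
  | Req bool nat nat "'s al"
  | Dlv bool nat "'s val" nat "'s al"
  | Rp nat nat "'s al"

definition relay :: "nat \<Rightarrow> 's aw" where
  "relay n = AWRep (nm RC n) [KI, KI] (AWIn 0 [KO] (AWIn 1 [KO]
     (AWPar (AWOut (Ix (nm RC n + 2)) [WI 0, WI 1]) (AWOut (Ix 0) [WO (Ix 1)]))))"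

text \<open>The output on \<open>nm RC n\<close> acts as a token. Consuming it makes the relay
  listen on \<open>nm RA n\<close> and then on \<open>nm RB n\<close>, and only the last step
  returns it, so a relay handles one message at a time. The offsets added to \<open>nm RC n\<close>
  count the enclosing O-binders.\<close>

primrec chan_atom :: "nat \<Rightarrow> 's chan_state \<Rightarrow> 's aw" where
  "chan_atom n Idle = AWOut (Ix (nm RC n)) [WI (nm RA n), WI (nm RB n)]"
| "chan_atom n Waiting = AWIn (nm RA n) [KO] (AWIn (nm RB n) [KO]
     (AWPar (AWOut (Ix (nm RC n + 2)) [WI (nm RA n), WI (nm RB n)]) (AWOut (Ix 0) [WO (Ix 1)])))"
| "chan_atom n (Holding v) = AWIn (nm RB n) [KO]
     (AWPar (AWOut (Ix (nm RC n + 1)) [WI (nm RA n), WI (nm RB n)])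
       (AWOut (Ix 0) [WO (shift_val 1 (glob v))]))"

definition server :: "nat \<Rightarrow> nat \<Rightarrow> 's al \<Rightarrow> 's aw" where
  "server d n P = AWRep (nm RD d) [KO] (AWPar (AWOut (Ix (nm RD d + 1)) [WO Star]) (genc_copy n P))"

primrec aw_atoms :: "'s comp \<Rightarrow> 's aw multiset" where
  "aw_atoms (Chan n s) = {#chan_atom n s, relay n#}"
| "aw_atoms (Msg a v) = {#AWOut (glob a) [WO (glob v)]#}"
| "aw_atoms (Req l z n P) =
    {#AWOut (Ix (nm RB n)) [WO (Ix (nm RZ z))], AWIn (nm RZ z) [KO] (genc_body P)#}"
| "aw_atoms (Dlv l z v n P) =
    {#AWOut (Ix (nm RZ z)) [WO (glob v)], AWIn (nm RZ z) [KO] (genc_body P)#}"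
| "aw_atoms (Rp d n P) = {#AWOut (Ix (nm RD d)) [WO Star], server d n P#}"

primrec chan_msgs :: "nat \<Rightarrow> 's chan_state \<Rightarrow> 's al multiset" where
  "chan_msgs n Idle = {#}"
| "chan_msgs n Waiting = {#}"
| "chan_msgs n (Holding v) = {#ALOut (Ix n) v#}"

primrec al_atoms :: "'s comp \<Rightarrow> 's al multiset" where
  "al_atoms (Chan n s) = chan_msgs n s"
| "al_atoms (Msg a v) = {#ALOut a v#}"
| "al_atoms (Req l z n P) = (if l then {#ALIn (Ix n) P#} else {#})"
| "al_atoms (Dlv l z v n P) = add_mset (ALOut (Ix n) v) (if l then {#ALIn (Ix n) P#} else {#})"
| "al_atoms (Rp d n P) = {#ALRep (Ix n) P#}"

primrec ids :: "'s comp \<Rightarrow> nat multiset" where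
  "ids (Chan n s) = {#n#}"
| "ids (Msg a v) = {#}"
| "ids (Req l z n P) = {#z#}"
| "ids (Dlv l z v n P) = {#z#}"
| "ids (Rp d n P) = {#d#}"

abbreviation sum_comps :: "('s comp \<Rightarrow> 'b multiset) \<Rightarrow> 's comp multiset \<Rightarrow> 'b multiset" where
  "sum_comps f K \<equiv> (\<Sum>k\<in>#K. f k)"

text \<open>Below the parameter, index 1 is the global name 0, which has no relay and therefore must
  not be an input subject.\<close>

definition wf_body :: "'s al \<Rightarrow> bool" where
  "wf_body P \<longleftrightarrow> wf_al P \<and> 0 \<notin> al_inputs P \<and> Suc 0 \<notin> al_inputs P"

primrec wf_comp :: "'s comp \<Rightarrow> bool" where
  "wf_comp (Chan n s) \<longleftrightarrow> n \<noteq> 0"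
| "wf_comp (Msg a v) \<longleftrightarrow> True"
| "wf_comp (Req l z n P) \<longleftrightarrow> wf_body P \<and> n \<noteq> 0"
| "wf_comp (Dlv l z v n P) \<longleftrightarrow> wf_body P \<and> n \<noteq> 0"
| "wf_comp (Rp d n P) \<longleftrightarrow> wf_body P \<and> n \<noteq> 0"

primrec initial :: "'s comp \<Rightarrow> bool" where
  "initial (Chan n s) \<longleftrightarrow> s = Idle"
| "initial (Msg a v) \<longleftrightarrow> True"
| "initial (Req l z n P) \<longleftrightarrow> l"
| "initial (Dlv l z v n P) \<longleftrightarrow> False"
| "initial (Rp d n P) \<longleftrightarrow> True"

text \<open>Unique identifiers let the private subjects of atoms determine their component. The last
  clause provides each copy with a server for the same input, which accounts for it on the ALpi
  side.\<close>

definition wf_comps :: "'s comp multiset \<Rightarrow> bool" where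
  "wf_comps K \<longleftrightarrow> (\<forall>k\<in>#K. wf_comp k) \<and> (\<forall>i. count (sum_comps ids K) i \<le> 1) \<and>
     (\<forall>z n P v. Req False z n P \<in># K \<or> Dlv False z v n P \<in># K \<longrightarrow> (\<exists>d. Rp d n P \<in># K))"

text \<open>\<open>F\<close> collects identifiers in use elsewhere. \<open>Y\<close> is given
  exactly because relays correspond to ALpi restrictions; for the AWpi names \<open>X\<close> it
  suffices that they are built from the new identifiers.\<close>

definition fresh_comps :: "nat set \<Rightarrow> 's comp multiset \<Rightarrow> nat set \<Rightarrow> nat set \<Rightarrow> bool" where
  "fresh_comps F K X Y \<longleftrightarrow> (\<forall>k\<in>#K. wf_comp k \<and> initial k) \<and> (\<forall>i. count (sum_comps ids K) i \<le> 1) \<and>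
     set_mset (sum_comps ids K) \<inter> F = {} \<and> (\<forall>x\<in>X. \<exists>r. \<exists>i\<in>#sum_comps ids K. x = nm r i) \<and>
     Y = {n. Chan n Idle \<in># K}"

lemma mem_sum_comps: "x \<in># sum_comps f K \<longleftrightarrow> (\<exists>k\<in>#K. x \<in># f k)"
  by (induction K) auto

lemma fresh_comps_wf: "fresh_comps F K X Y \<Longrightarrow> wf_comps K"
  unfolding fresh_comps_def wf_comps_def by (metis initial.simps(3,4))

lemma fresh_comps_chans: "fresh_comps F K X Y \<Longrightarrow> n \<in> Y \<Longrightarrow> n \<in># sum_comps ids K"
  unfolding fresh_comps_def mem_sum_comps by (metis ids.simps(1) mem_Collect_eq union_single_eq_member)

lemma count_le_1_union:
  assumes "\<forall>i. count M i \<le> 1" "\<forall>i. count N i \<le> 1" "set_mset M \<inter> set_mset N = {}"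
  shows "\<forall>i. count (M + N) i \<le> 1"
proof
  fix i
  have "i \<notin># M \<or> i \<notin># N"
    using assms(3) by blast
  then show "count (M + N) i \<le> 1"
    using assms(1,2) by (auto simp: not_in_iff)
qed

lemma fresh_comps_union:
  assumes "fresh_comps F K1 X1 Y1" "fresh_comps (F \<union> set_mset (sum_comps ids K1)) K2 X2 Y2"
  shows "fresh_comps F (K1 + K2) (X1 \<union> X2) (Y1 \<union> Y2)"
proof -
  note defs = assms[unfolded fresh_comps_def]
  have "set_mset (sum_comps ids K1) \<inter> set_mset (sum_comps ids K2) = {}"
    using defs by blast
  moreover have "\<forall>i. count (sum_comps ids K1) i \<le> 1" "\<forall>i. count (sum_comps ids K2) i \<le> 1"
    using defs by blast+
  ultimately have "\<forall>i. count (sum_comps ids (K1 + K2)) i \<le> 1"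
    using count_le_1_union[of "sum_comps ids K1" "sum_comps ids K2"] by simp
  moreover have "\<forall>k\<in>#K1 + K2. wf_comp k \<and> initial k"
    using defs by auto
  moreover have "set_mset (sum_comps ids (K1 + K2)) \<inter> F = {}"
    using defs by (simp only: image_mset_union sum_mset.union set_mset_union) blast
  moreover have "\<forall>x\<in>X1 \<union> X2. \<exists>r. \<exists>i\<in>#sum_comps ids (K1 + K2). x = nm r i"
  proof
    fix x assume "x \<in> X1 \<union> X2"
    then obtain r i where "x = nm r i" "i \<in># sum_comps ids K1 \<or> i \<in># sum_comps ids K2"
      using defs by (meson UnE)
    then show "\<exists>r. \<exists>i\<in>#sum_comps ids (K1 + K2). x = nm r i"
      by (simp only: image_mset_union sum_mset.union set_mset_union) blast
  qed
  moreover have "Y1 \<union> Y2 = {n. Chan n Idle \<in># K1 + K2}"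
    using defs by auto
  ultimately show ?thesis
    unfolding fresh_comps_def by blast
qed

lemma conf_handler:
  "conf (case_nat (nm RC n) (case_nat (nm RB n) (case_nat (nm RA n) \<eta>)))
    (case_nat (Ix (nm RC n)) \<zeta>) handler {} {#chan_atom n Idle, relay n#}"
proof -
  let ?\<eta> = "case_nat (nm RC n) (case_nat (nm RB n) (case_nat (nm RA n) \<eta>))"
  let ?\<zeta> = "case_nat (Ix (nm RC n)) \<zeta> :: nat \<Rightarrow> 'a val"
  have "conf ?\<eta> ?\<zeta> (AWRep 0 [KI, KI] (AWIn 0 [KO] (AWIn 1 [KO]
     (AWPar (AWOut (Ix 2) [WI 0, WI 1]) (AWOut (Ix 0) [WO (Ix 1)]))))) {} {#relay n#}"
    unfolding relay_def conf_simps
    by (simp add: up_def up_i_def numeral_2_eq_2 c_refl)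
  from conf_par[OF conf_out[of ?\<eta> ?\<zeta> "Ix 0" "[WI 2, WI 1]"] this]
  show ?thesis
    by (simp add: handler_def numeral_2_eq_2 add_mset_commute)
qed

lemma names_agree_nm:
  "(\<And>i. i \<in> al_fn P \<Longrightarrow> \<zeta> (\<rho> i) = glob (\<sigma> i)) \<Longrightarrow> names_agree \<zeta> \<sigma> \<rho> (nm RA) P"
  by (simp add: names_agree_def glob_def)

definition representable where
  "representable F \<eta> \<zeta> W \<sigma> P \<longleftrightarrow> (\<exists>X Y K. aconf \<sigma> P Y (sum_comps al_atoms K) \<and>
     conf \<eta> \<zeta> W X (sum_comps aw_atoms K) \<and> fresh_comps F K X Y)"

lemma representableI:
  "aconf \<sigma> P Y N \<Longrightarrow> conf \<eta> \<zeta> W X M \<Longrightarrow> fresh_comps F K X Y \<Longrightarrow>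
   N = sum_comps al_atoms K \<Longrightarrow> M = sum_comps aw_atoms K \<Longrightarrow> representable F \<eta> \<zeta> W \<sigma> P"
  unfolding representable_def by blast

text \<open>One multiset of components must describe both processes, so the induction builds the two
  configurations together. \<open>0 \<in> F\<close> protects the reserved name, and the last
  assumption says that \<open>f\<close> leads from an input subject to the request name of the same
  relay.\<close>

lemma representable_encode:
  assumes "wf_al P" "finite F" "0 \<in> F"
    and "\<And>i. i \<in> al_fn P \<Longrightarrow> \<zeta> (\<rho> i) = glob (\<sigma> i)"
    and "\<And>i. i \<in> al_inputs P \<Longrightarrow> 
      \<exists>j k. \<sigma> i = Ix j \<and> j \<noteq> 0 \<and> f i = Some k \<and> \<zeta> k = Ix (nm RB j)"
  shows "representable F \<eta> \<zeta> (encode \<rho> f P) \<sigma> P"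
  using assms
proof (induction P arbitrary: \<rho> f \<sigma> \<zeta> \<eta> F)
  case ALNil
  show ?case
    by (rule representableI[where X = "{}" and Y = "{}" and K = "{#}"])
       (auto simp: fresh_comps_def aconf_simps conf_simps)
next
  case (ALPar P Q)
  have "representable F \<eta> \<zeta> (encode \<rho> f P) \<sigma> P"
    using ALPar.prems by (intro ALPar.IH(1)) auto
  then obtain X1 Y1 K1 where
    1: "aconf \<sigma> P Y1 (sum_comps al_atoms K1)" "conf \<eta> \<zeta> (encode \<rho> f P) X1 (sum_comps aw_atoms K1)"
      "fresh_comps F K1 X1 Y1"
    unfolding representable_def by blast
  have "representable (F \<union> set_mset (sum_comps ids K1)) \<eta> \<zeta> (encode \<rho> f Q) \<sigma> Q"
    using ALPar.prems by (intro ALPar.IH(2)) auto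
  then obtain X2 Y2 K2 where
    2: "aconf \<sigma> Q Y2 (sum_comps al_atoms K2)" "conf \<eta> \<zeta> (encode \<rho> f Q) X2 (sum_comps aw_atoms K2)"
      "fresh_comps (F \<union> set_mset (sum_comps ids K1)) K2 X2 Y2"
    unfolding representable_def by blast
  have disj: "set_mset (sum_comps ids K1) \<inter> set_mset (sum_comps ids K2) = {}"
    using 2(3) by (auto simp: fresh_comps_def)
  have Y: "Y1 \<inter> Y2 = {}"
    using fresh_comps_chans[OF 1(3)] fresh_comps_chans[OF 2(3)] disj by blast
  have X: "X1 \<inter> X2 = {}"
    using 1(3) 2(3) disj unfolding fresh_comps_def by fastforce
  have "fresh_comps F (K1 + K2) (X1 \<union> X2) (Y1 \<union> Y2)"
    by (rule fresh_comps_union[OF 1(3) 2(3)])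
  then show ?case
    using aconf_par[OF 1(1) 2(1) Y] conf_par[OF 1(2) 2(2) X]
    by (intro representableI[where K = "K1 + K2"]) auto
next
  case (ALIn a P)
  then obtain i where a: "a = Ix i" and P: "wf_al P" "0 \<notin> al_inputs P"
    by auto
  then obtain n where n: "\<sigma> i = Ix n" and n0: "n \<noteq> 0"
    using ALIn.prems(5) by (fastforce simp: val_fn_def)
  obtain z where z: "z \<notin> F"
    using ex_new_if_finite[OF infinite_UNIV_nat ALIn.prems(2)] by blast
  let ?P = "al_sub (up 1 \<sigma>) P"
  have "wf_al (al_sub \<sigma> (ALIn a P))"
    using ALIn.prems(1,5) by (intro wf_al_al_sub) blast+
  moreover have "Suc 0 \<notin> al_inputs ?P"
  proof
    assume "Suc 0 \<in> al_inputs ?P"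
    then obtain j where "j \<in> al_inputs P" "up 1 \<sigma> j = Ix (Suc 0)"
      using al_inputs_al_sub by blast
    then obtain l where "j = Suc l" "\<sigma> l = Ix 0" "Suc l \<in> al_inputs P"
      by (auto simp: up_1_eq_Ix_Suc)
    then show False
      using ALIn.prems(5)[of l] by (auto simp: unbind_def)
  qed
  ultimately have wf: "wf_body ?P"
    by (simp add: wf_body_def)
  have enc: "aw_sub \<eta> \<zeta> (encode \<rho> f (ALIn a P)) = genc (ALIn (Ix n) ?P)"
  proof -
    have "inputs_agree \<zeta> \<sigma> f (\<lambda>i. Some (nm RB i)) (ALIn a P)"
      using ALIn.prems(5) unfolding inputs_agree_def by blast
    then have "aw_sub \<eta> \<zeta> (encode \<rho> f (ALIn a P)) = genc (al_sub \<sigma> (ALIn a P))"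
      unfolding genc_def by (intro aw_sub_encode names_agree_nm ALIn.prems)
    then show ?thesis
      using a n by simp
  qed
  have "conf \<eta> \<zeta> (encode \<rho> f (ALIn a P)) {nm RZ z} (aw_atoms (Req True z n ?P))"
    using conf_genc_in[of ?P "\<lambda>i. i" n z] wf[unfolded wf_body_def] enc unfolding conf_iff_conf_id[of \<eta> \<zeta>] by simp
  moreover have "aconf \<sigma> (ALIn a P) {} {#ALIn (Ix n) ?P#}"
    using aconf_in[of \<sigma> a P] a n by simp
  moreover have "fresh_comps F {#Req True z n ?P#} {nm RZ z} {}"
    using wf z n0 by (auto simp: fresh_comps_def)
  ultimately show ?case
    by (rule_tac representableI[where K = "{#Req True z n ?P#}"]) auto
next
  case (ALOut a v)
  have "sub_val \<zeta> (sub_val (\<lambda>i. Ix (\<rho> i)) u) = glob (sub_val \<sigma> u)" if "u = a \<or> u = v" for u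
    using ALOut.prems(4) that by (cases u) (auto simp: val_fn_def)
  then have "conf \<eta> \<zeta> (encode \<rho> f (ALOut a v)) {} (aw_atoms (Msg (sub_val \<sigma> a) (sub_val \<sigma> v)))"
    by (simp add: conf_simps)
  moreover have "aconf \<sigma> (ALOut a v) {} {#ALOut (sub_val \<sigma> a) (sub_val \<sigma> v)#}"
    by (rule aconf_out)
  moreover have "fresh_comps F {#Msg (sub_val \<sigma> a) (sub_val \<sigma> v)#} {} {}"
    by (auto simp: fresh_comps_def)
  ultimately show ?case
    by (rule_tac representableI[where K = "{#Msg (sub_val \<sigma> a) (sub_val \<sigma> v)#}"]) auto
next
  case (ALNu P)
  obtain n where n: "n \<notin> F"
    using ex_new_if_finite[OF infinite_UNIV_nat ALNu.prems(2)] by blast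
  with ALNu.prems(3) have n0: "n \<noteq> 0"
    by metis
  let ?\<eta> = "case_nat (nm RC n) (case_nat (nm RB n) (case_nat (nm RA n) \<eta>))"
  let ?\<zeta> = "case_nat (Ix (nm RC n)) (case_nat (Ix (nm RB n)) (case_nat (Ix (nm RA n)) \<zeta>))"
  have "representable (insert n F) ?\<eta> ?\<zeta>
    (encode (enter 2 3 \<rho>) (enter_f (Some 1) 3 f) P) (case_nat (Ix n) \<sigma>) P"
  proof (rule ALNu.IH)
    fix i assume "i \<in> al_fn P"
    then show "?\<zeta> (enter 2 3 \<rho> i) = glob (case_nat (Ix n) \<sigma> i)"
      using ALNu.prems(4) by (cases i) (simp_all add: enter_def unbind_def numeral_2_eq_2 numeral_3_eq_3)
  next
    fix i assume "i \<in> al_inputs P"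
    then show "\<exists>j k. case_nat (Ix n) \<sigma> i = Ix j \<and> j \<noteq> 0 \<and> enter_f (Some 1) 3 f i = Some k \<and> ?\<zeta> k = Ix (nm RB j)"
      using ALNu.prems(5) n0
      by (cases i) (force simp: enter_f_def shift_f_def unbind_def numeral_2_eq_2 numeral_3_eq_3)+
  qed (use ALNu.prems in auto)
  then obtain X Y K where
    1: "aconf (case_nat (Ix n) \<sigma>) P Y (sum_comps al_atoms K)"
      "conf ?\<eta> ?\<zeta> (encode (enter 2 3 \<rho>) (enter_f (Some 1) 3 f) P) X (sum_comps aw_atoms K)"
    and fresh: "fresh_comps (insert n F) K X Y"
    unfolding representable_def by blast
  have n': "n \<notin># sum_comps ids K"
    using fresh by (auto simp: fresh_comps_def)
  have X: "nm RA n \<notin> X" "nm RB n \<notin> X" "nm RC n \<notin> X"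
    using fresh n' by (fastforce simp: fresh_comps_def)+
  have "conf ?\<eta> ?\<zeta> (AWPar (encode (enter 2 3 \<rho>) (enter_f (Some 1) 3 f) P) handler) (X \<union> {})
      (sum_comps aw_atoms K + {#chan_atom n Idle, relay n#})"
    by (rule conf_par[OF 1(2) conf_handler]) simp
  then have "conf \<eta> \<zeta> (encode \<rho> f (ALNu P)) (insert (nm RA n) (insert (nm RB n) (insert (nm RC n) X)))
      (sum_comps aw_atoms K + {#chan_atom n Idle, relay n#})"
    using X unfolding encode.simps by (intro conf_nu) auto
  moreover have "n \<notin> Y"
    using fresh_comps_chans[OF fresh] n' by blast
  then have "aconf \<sigma> (ALNu P) (insert n Y) (sum_comps al_atoms K)"
    by (rule aconf_nu[OF 1(1)])
  moreover have "fresh_comps F {#Chan n Idle#} {nm RA n, nm RB n, nm RC n} {n}"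
    using n n0 by (auto simp: fresh_comps_def)
  from fresh_comps_union[OF this, of K X Y] have "fresh_comps F (add_mset (Chan n Idle) K)
      (insert (nm RA n) (insert (nm RB n) (insert (nm RC n) X))) (insert n Y)"
    using fresh by simp
  ultimately show ?case
    by (rule_tac representableI[where K = "add_mset (Chan n Idle) K"]) auto
next
  case (ALRep a P)
  then obtain i where a: "a = Ix i" and P: "wf_al P" "0 \<notin> al_inputs P"
    by auto
  then obtain n k where n: "\<sigma> i = Ix n" "f i = Some k" "\<zeta> k = Ix (nm RB n)" and n0: "n \<noteq> 0"
    using ALRep.prems(5) by (fastforce simp: val_fn_def)
  obtain d where d: "d \<notin> F"
    using ex_new_if_finite[OF infinite_UNIV_nat ALRep.prems(2)] by blast
  let ?P = "al_sub (up 1 \<sigma>) P"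
  have "wf_al (al_sub \<sigma> (ALRep a P))"
    using ALRep.prems(1,5) by (intro wf_al_al_sub) blast+
  moreover have "Suc 0 \<notin> al_inputs ?P"
  proof
    assume "Suc 0 \<in> al_inputs ?P"
    then obtain j where "j \<in> al_inputs P" "up 1 \<sigma> j = Ix (Suc 0)"
      using al_inputs_al_sub by blast
    then obtain l where "j = Suc l" "\<sigma> l = Ix 0" "Suc l \<in> al_inputs P"
      by (auto simp: up_1_eq_Ix_Suc)
    then show False
      using ALRep.prems(5)[of l] by (auto simp: unbind_def)
  qed
  ultimately have wf: "wf_body ?P"
    by (simp add: wf_body_def)
  let ?\<eta> = "case_nat (nm RD d) \<eta>" and ?\<zeta> = "case_nat (Ix (nm RD d)) \<zeta>"
  have "aw_sub \<eta>' (up 1 ?\<zeta>) (encode (\<lambda>i. \<rho> i + 2) (shift_f 2 f) (ALIn a P)) =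
      encode (\<lambda>i. nm RA i + 1) (\<lambda>i. Some (nm RB i + 1)) (al_sub \<sigma> (ALIn a P))" for \<eta>'
  proof (rule aw_sub_encode)
    show "names_agree (up 1 ?\<zeta>) \<sigma> (\<lambda>i. \<rho> i + 2) (\<lambda>i. nm RA i + 1) (ALIn a P)"
      unfolding names_agree_def
    proof
      fix i assume "i \<in> al_fn (ALIn a P)"
      then have "\<zeta> (\<rho> i) = glob (\<sigma> i)"
        using ALRep.prems(4) by simp
      then show "up 1 ?\<zeta> (\<rho> i + 2) = sub_val (\<lambda>j. Ix (nm RA j + 1)) (\<sigma> i)"
        by (cases "\<sigma> i") (simp_all add: up_1)
    qed
    show "inputs_agree (up 1 ?\<zeta>) \<sigma> (shift_f 2 f) (\<lambda>i. Some (nm RB i + 1)) (ALIn a P)"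
      unfolding inputs_agree_def
    proof
      fix i assume "i \<in> al_inputs (ALIn a P)"
      then obtain j k where "\<sigma> i = Ix j" "f i = Some k" "\<zeta> k = Ix (nm RB j)"
        using ALRep.prems(5)[of i] by auto
      then show "\<exists>j k k'. \<sigma> i = Ix j \<and> shift_f 2 f i = Some k \<and> Some (nm RB j + 1) = Some k' \<and> up 1 ?\<zeta> k = Ix k'"
        by (simp add: shift_f_def up_1)
    qed
  qed (use ALRep.prems(1) in simp)
  moreover have "al_sub \<sigma> (ALIn a P) = ALIn (Ix n) ?P"
    using a n by simp
  ultimately have "aw_sub \<eta>' (up 1 ?\<zeta>) (encode (\<lambda>i. \<rho> i + 2) (shift_f 2 f) (ALIn a P)) = genc_copy n ?P" for \<eta>'
    unfolding genc_copy_def by metis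
  then have "conf ?\<eta> ?\<zeta> (AWRep 0 [KO] (AWPar (AWOut (Ix 1) [WO Star])
      (encode (\<lambda>i. \<rho> i + 2) (shift_f 2 f) (ALIn a P)))) {} {#server d n ?P#}"
    unfolding server_def conf_simps by (simp add: up_1 c_refl del: encode.simps(5))
  from conf_par[OF conf_out[of ?\<eta> ?\<zeta> "Ix 0" "[WO Star]"] this] have
    "conf ?\<eta> ?\<zeta> (AWPar (AWOut (Ix 0) [WO Star]) (AWRep 0 [KO] (AWPar (AWOut (Ix 1) [WO Star])
      (encode (\<lambda>i. \<rho> i + 2) (shift_f 2 f) (ALIn a P))))) {} (aw_atoms (Rp d n ?P))"
    by (simp add: add_mset_commute)
  from conf_nu[OF this] have "conf \<eta> \<zeta> (encode \<rho> f (ALRep a P)) {nm RD d} (aw_atoms (Rp d n ?P))"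
    by simp
  moreover have "aconf \<sigma> (ALRep a P) {} {#ALRep (Ix n) ?P#}"
    using aconf_rep[of \<sigma> a P] a n by simp
  moreover have "fresh_comps F {#Rp d n ?P#} {nm RD d} {}"
    using wf d n0 by (auto simp: fresh_comps_def)
  ultimately show ?case
    by (rule_tac representableI[where K = "{#Rp d n ?P#}"]) auto
qed

section \<open>Redexes of components\<close>

definition relay_body :: "nat \<Rightarrow> 's aw" where
  "relay_body n = AWIn 0 [KO] (AWIn 1 [KO]
     (AWPar (AWOut (Ix (nm RC n + 2)) [WI 0, WI 1]) (AWOut (Ix 0) [WO (Ix 1)])))"

definition waiting_body :: "nat \<Rightarrow> 's aw" where
  "waiting_body n = AWIn (nm RB n) [KO]
     (AWPar (AWOut (Ix (nm RC n + 2)) [WI (nm RA n), WI (nm RB n)]) (AWOut (Ix 0) [WO (Ix 1)]))"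

definition holding_body :: "nat \<Rightarrow> 's val \<Rightarrow> 's aw" where
  "holding_body n v = AWPar (AWOut (Ix (nm RC n + 1)) [WI (nm RA n), WI (nm RB n)])
       (AWOut (Ix 0) [WO (shift_val 1 (glob v))])"

definition server_body :: "nat \<Rightarrow> nat \<Rightarrow> 's al \<Rightarrow> 's aw" where
  "server_body d n P = AWPar (AWOut (Ix (nm RD d + 1)) [WO Star]) (genc_copy n P)"

text \<open>The steps of the protocol. In \<open>cr_request\<close> the private input of the request
  stays in the remainder: the relay learns only the name on which to deliver.\<close>

inductive comp_redex ::
  "'s comp multiset \<Rightarrow> nat \<Rightarrow> 's wval list \<Rightarrow> 's aw \<Rightarrow> 's aw multiset \<Rightarrow> bool" where
  cr_relay: "comp_redex (add_mset (Chan n Idle) K) (nm RC n) [WI (nm RA n), WI (nm RB n)] (relay_body n)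
     (add_mset (relay n) (sum_comps aw_atoms K))"
| cr_take: "comp_redex (add_mset (Chan n Waiting) (add_mset (Msg (Ix n) v) K)) (nm RA n) [WO (glob v)]
     (waiting_body n) (add_mset (relay n) (sum_comps aw_atoms K))"
| cr_request: "comp_redex (add_mset (Chan n (Holding v)) (add_mset (Req l z n P) K)) (nm RB n) [WO (Ix (nm RZ z))]
     (holding_body n v)
     (add_mset (relay n) (add_mset (AWIn (nm RZ z) [KO] (genc_body P)) (sum_comps aw_atoms K)))"
| cr_deliver: "comp_redex (add_mset (Dlv l z v n P) K) (nm RZ z) [WO (glob v)] (genc_body P) (sum_comps aw_atoms K)"
| cr_copy: "comp_redex (add_mset (Rp d n P) K) (nm RD d) [WO Star] (server_body d n P)
     (add_mset (server d n P) (sum_comps aw_atoms K))"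

lemma comp_redex_redex: "comp_redex K g vs Q R \<Longrightarrow> redex g (sum_comps aw_atoms K) vs Q R"
proof (induction rule: comp_redex.induct)
  case (cr_relay n K)
  show ?case
    using redex_rep[of "[WI (nm RA n), WI (nm RB n)]" "[KI, KI]" "nm RC n" "relay_body n" "sum_comps aw_atoms K"]
    by (simp add: relay_def relay_body_def add_mset_commute)
next
  case (cr_take n v K)
  show ?case
    using redex_in[of "[WO (glob v)]" "[KO]" "nm RA n" "waiting_body n" "add_mset (relay n) (sum_comps aw_atoms K)"]
    by (simp add: waiting_body_def add_mset_commute)
next
  case (cr_request n v l z P K)
  show ?case
    using redex_in[of "[WO (Ix (nm RZ z))]" "[KO]" "nm RB n" "holding_body n v"
        "add_mset (relay n) (add_mset (AWIn (nm RZ z) [KO] (genc_body P)) (sum_comps aw_atoms K))"]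
    by (simp add: holding_body_def add_mset_commute)
next
  case (cr_deliver l z v n P K)
  show ?case
    using redex_in[of "[WO (glob v)]" "[KO]" "nm RZ z" "genc_body P" "sum_comps aw_atoms K"]
    by (simp add: add_mset_commute)
next
  case (cr_copy d n P K)
  show ?case
    using redex_rep[of "[WO Star]" "[KO]" "nm RD d" "server_body d n P" "sum_comps aw_atoms K"]
    by (simp add: server_def server_body_def add_mset_commute)
qed

lemma out_atom:
  assumes "AWOut (Ix (nm r i)) vs \<in># aw_atoms k"
  obtains v where "r = RA" "k = Msg (Ix i) v" "vs = [WO (glob v)]"
  | l z P where "r = RB" "k = Req l z i P" "vs = [WO (Ix (nm RZ z))]"
  | "r = RC" "k = Chan i Idle" "vs = [WI (nm RA i), WI (nm RB i)]"
  | l v n P where "r = RZ" "k = Dlv l i v n P" "vs = [WO (glob v)]"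
  | n P where "r = RD" "k = Rp i n P" "vs = [WO Star]"
proof (cases k)
  case (Chan n s)
  then show ?thesis
    using assms that(3) by (cases s) (auto simp: relay_def)
next
  case (Msg a v)
  then have "Ix (nm r i) = glob a" "vs = [WO (glob v)]"
    using assms by auto
  then show ?thesis
    using that(1) Msg glob_eq_simps(3)[of a r i] by metis
next
  case (Req l z n P)
  then show ?thesis
    using assms that(2) by auto
next
  case (Dlv l z v n P)
  then show ?thesis
    using assms that(4) by auto
next
  case (Rp d n P)
  then show ?thesis
    using assms that(5) by (auto simp: server_def)
qed

lemma in_atom:
  assumes "AWIn g ks Q \<in># aw_atoms k"
  obtains n where "k = Chan n Waiting" "g = nm RA n" "ks = [KO]" "Q = waiting_body n"
  | n v where "k = Chan n (Holding v)" "g = nm RB n" "ks = [KO]" "Q = holding_body n v"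
  | l z n P where "k = Req l z n P" "g = nm RZ z"
  | l z v n P where "k = Dlv l z v n P" "g = nm RZ z" "ks = [KO]" "Q = genc_body P"
proof (cases k)
  case (Chan n s)
  then show ?thesis
    using assms that(1,2) by (cases s) (auto simp: relay_def waiting_body_def holding_body_def)
qed (use assms that(3,4) in \<open>auto simp: server_def\<close>)

lemma rep_atom:
  assumes "AWRep g ks Q \<in># aw_atoms k"
  obtains n s where "k = Chan n s" "g = nm RC n" "ks = [KI, KI]" "Q = relay_body n"
  | d n P where "k = Rp d n P" "g = nm RD d" "ks = [KO]" "Q = server_body d n P"
proof (cases k)
  case (Chan n s)
  then show ?thesis
    using assms that(1) by (cases s) (auto simp: relay_def relay_body_def)
qed (use assms that(2) in \<open>auto simp: server_def server_body_def\<close>)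

lemma unique_owner:
  assumes "\<forall>i. count (sum_comps ids (add_mset k K)) i \<le> 1" "k' \<in># K"
  shows "i \<in># ids k \<Longrightarrow> i \<in># ids k' \<Longrightarrow> False"
proof -
  assume i: "i \<in># ids k" "i \<in># ids k'"
  obtain K' where "K = add_mset k' K'"
    using assms(2) by (metis insert_DiffM)
  then have "count (ids k) i + count (ids k') i \<le> 1"
    using assms(1)[rule_format, of i] by simp
  moreover have "0 < count (ids k) i" "0 < count (ids k') i"
    using i by auto
  ultimately show False
    by linarith
qed

text \<open>Roles leave only five pairings. Subjects of role \<open>RA\<close> or \<open>RB\<close>
  connect a relay with a message or a request; for the roles \<open>RC\<close>, \<open>RZ\<close>
  and \<open>RD\<close>, uniqueness of identifiers puts both atoms into one component.\<close>

lemma redex_comp_redex: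
  assumes "redex g (sum_comps aw_atoms K) vs Q R" and u: "\<forall>i. count (sum_comps ids K) i \<le> 1"
  shows "comp_redex K g vs Q R"
proof -
  let ?M = "sum_comps aw_atoms K"
  from assms(1) obtain A ks S where M: "?M = add_mset A (add_mset (AWOut (Ix g) vs) S)"
    and A: "A = AWIn g ks Q \<and> R = S \<or> A = AWRep g ks Q \<and> R = add_mset A S"
    by (cases rule: redex.cases) auto
  obtain k K1 where kA: "A \<in># aw_atoms k" and K: "K = add_mset k K1"
    using M by (metis mem_sum_comps insert_DiffM union_single_eq_member)
  obtain ko where ko: "ko \<in># K" "AWOut (Ix g) vs \<in># aw_atoms ko"
    using M by (metis mem_sum_comps insert_iff set_mset_add_mset_insert)
  have same: "ko = k" if "ids ko = {#i#}" "ids k = {#i#}" for i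
    using unique_owner[OF u[unfolded K], of ko i] ko(1) that unfolding K by auto
  have other: "\<exists>K0. K1 = add_mset ko K0" if "ko \<noteq> k"
    using ko(1) that unfolding K by (metis insert_DiffM insert_noteq_member)
  from A show ?thesis
  proof
    assume A: "A = AWIn g ks Q \<and> R = S"
    then have "AWIn g ks Q \<in># aw_atoms k"
      using kA by simp
    then show ?thesis
    proof (cases rule: in_atom)
      case (1 n)
      obtain v where v: "ko = Msg (Ix n) v" "vs = [WO (glob v)]"
        using ko(2) unfolding 1(2) by (cases rule: out_atom) auto
      then obtain K0 where K0: "K1 = add_mset ko K0"
        using other 1 by auto
      have "R = add_mset (relay n) (sum_comps aw_atoms K0)"
        using M A 1 v K0 K by (simp add: waiting_body_def add_mset_commute)
      then show ?thesis
        using cr_take[of n v K0] K K0 1 v by simp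
    next
      case (2 n v)
      obtain l z P where v: "ko = Req l z n P" "vs = [WO (Ix (nm RZ z))]"
        using ko(2) unfolding 2(2) by (cases rule: out_atom) auto
      then obtain K0 where K0: "K1 = add_mset ko K0"
        using other 2 by auto
      have "R = add_mset (relay n) (add_mset (AWIn (nm RZ z) [KO] (genc_body P)) (sum_comps aw_atoms K0))"
        using M A 2 v K0 K by (simp add: holding_body_def add_mset_commute)
      then show ?thesis
        using cr_request[of n v l z P K0] K K0 2 v by simp
    next
      \<comment> \<open>A request cannot yet receive: an output on its private name belongs to a
        delivery with the same identifier, contradicting uniqueness.\<close>
      case (3 l z n P)
      obtain l' v' n' P' where v: "ko = Dlv l' z v' n' P'"
        using ko(2) unfolding 3(2) by (cases rule: out_atom) auto
      then show ?thesis
        using same[of z] 3 by simp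
    next
      case (4 l z v n P)
      obtain l' v' n' P' where v: "ko = Dlv l' z v' n' P'" "vs = [WO (glob v')]"
        using ko(2) unfolding 4(2) by (cases rule: out_atom) auto
      then have "ko = k"
        using same[of z] 4 by simp
      moreover from this have "R = sum_comps aw_atoms K1"
        using M A 4 v K by (simp add: add_mset_commute)
      ultimately show ?thesis
        using cr_deliver[of l z v n P K1] K 4 v by simp
    qed
  next
    assume A: "A = AWRep g ks Q \<and> R = add_mset A S"
    then have "AWRep g ks Q \<in># aw_atoms k"
      using kA by simp
    then show ?thesis
    proof (cases rule: rep_atom)
      case (1 n s)
      have v: "ko = Chan n Idle" "vs = [WI (nm RA n), WI (nm RB n)]"
        using ko(2) unfolding 1(2) by (cases rule: out_atom; auto)+
      then have "ko = k"
        using same[of n] 1 by simp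
      moreover from this have "R = add_mset (relay n) (sum_comps aw_atoms K1)"
        using M A 1 v K by (simp add: add_mset_commute)
      ultimately show ?thesis
        using cr_relay[of n K1] K 1 v by simp
    next
      case (2 d n P)
      obtain n' P' where v: "ko = Rp d n' P'" "vs = [WO Star]"
        using ko(2) unfolding 2(2) by (cases rule: out_atom) auto
      then have "ko = k"
        using same[of d] 2 by simp
      moreover from this have "R = add_mset (server d n P) (sum_comps aw_atoms K1)"
        using M A 2 v K by (simp add: add_mset_commute)
      ultimately show ?thesis
        using cr_copy[of d n P K1] K 2 v by simp
    qed
  qed
qed

section \<open>Firing a redex of a multiset of components\<close>

definition aw_top :: "'s aw \<Rightarrow> 's aw multiset \<Rightarrow> bool" where
  "aw_top W M \<longleftrightarrow> (\<exists>X. conf (\<lambda>_. 0) (\<lambda>_. Ix 0) W X M \<and> 0 \<notin> X)"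

text \<open>Some choice of names for the released continuation, away from \<open>G\<close>, turns
  the result into components again. \<open>G\<close> is a parameter because the names to avoid are
  dictated by \<open>residual\<close>.\<close>

definition fires where
  "fires G vs Q R \<Phi> \<longleftrightarrow> (\<exists>X M K'. conf (\<lambda>i. i) Ix (aw_inst vs Q) X M \<and> X \<inter> G = {} \<and>
     sum_comps aw_atoms K' = R + M \<and> \<Phi> K')"

lemma firesI:
  "conf (\<lambda>i. i) Ix (aw_inst vs Q) X M \<Longrightarrow> X \<inter> G = {} \<Longrightarrow> sum_comps aw_atoms K' = R + M \<Longrightarrow> \<Phi> K' \<Longrightarrow>
   fires G vs Q R \<Phi>"
  unfolding fires_def by blast

lemma fires_mono:
  "fires G vs Q R \<Phi> \<Longrightarrow> (\<And>K'. \<Phi> K' \<Longrightarrow> \<Psi> K') \<Longrightarrow> fires G vs Q R \<Psi>"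
  unfolding fires_def by blast

lemma aw_fire:
  assumes "comp_redex K g vs Q R" "aw_top W (sum_comps aw_atoms K)"
    and fires: "\<And>G. finite G \<Longrightarrow> fires G vs Q R \<Phi>"
  obtains W' K' where "aw_red W W'" "aw_top W' (sum_comps aw_atoms K')" "\<Phi> K'"
proof -
  from assms(2) obtain X where X: "conf (\<lambda>_. 0) (\<lambda>_. Ix 0) W X (sum_comps aw_atoms K)" "0 \<notin> X"
    unfolding aw_top_def by blast
  have "g \<noteq> 0"
    using assms(1) by (cases rule: comp_redex.cases) auto
  from redex_aw_red[OF comp_redex_redex[OF assms(1)] X(1) this X(2), of "{0}"] obtain W' where
    W': "aw_red W W'" "residual (\<lambda>_. 0) (\<lambda>_. Ix 0) X vs Q R W' {0}"
    by auto
  from W'(2) obtain G where "finite G" and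
    G: "\<And>Y N. conf (\<lambda>i. i) Ix (aw_inst vs Q) Y N \<Longrightarrow> Y \<inter> G = {} \<Longrightarrow>
      \<exists>X'. conf (\<lambda>_. 0) (\<lambda>_. Ix 0) W' X' (R + N) \<and> X' \<inter> {0} \<subseteq> X"
    by (rule residualE) blast
  from fires[OF \<open>finite G\<close>] obtain Y N K' where K': "conf (\<lambda>i. i) Ix (aw_inst vs Q) Y N" "Y \<inter> G = {}"
    "sum_comps aw_atoms K' = R + N" "\<Phi> K'"
    unfolding fires_def by blast
  from G[OF K'(1,2)] obtain X' where "conf (\<lambda>_. 0) (\<lambda>_. Ix 0) W' X' (R + N)" "X' \<inter> {0} \<subseteq> X"
    by blast
  then have "aw_top W' (sum_comps aw_atoms K')"
    unfolding aw_top_def K'(3) using X(2) by blast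
  then show ?thesis
    using that W'(1) K'(4) by blast
qed

text \<open>The same facts about \<open>fires\<close> serve to execute a chosen redex, in
  \<open>aw_fire\<close>, and to describe the result of a given reduction, here.
  \<open>\<Phi>\<close> is quantified after the redex, since it depends on the protocol step
  found.\<close>

lemma aw_red_fire:
  assumes "aw_red W W'" "aw_top W (sum_comps aw_atoms K)" "\<forall>i. count (sum_comps ids K) i \<le> 1"
  obtains g vs Q R where "comp_redex K g vs Q R"
    "\<And>\<Phi>. (\<And>G. finite G \<Longrightarrow> fires G vs Q R \<Phi>) \<Longrightarrow> \<exists>K'. aw_top W' (sum_comps aw_atoms K') \<and> \<Phi> K'"
proof -
  from assms(2) obtain X where X: "conf (\<lambda>_. 0) (\<lambda>_. Ix 0) W X (sum_comps aw_atoms K)" "0 \<notin> X"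
    unfolding aw_top_def by blast
  from aw_red_redex[OF assms(1) X(1), of "{0}"] obtain g vs Q R where
    r: "redex g (sum_comps aw_atoms K) vs Q R" and "residual (\<lambda>_. 0) (\<lambda>_. Ix 0) X vs Q R W' {0}"
    by auto
  then obtain G where "finite G" and
    G: "\<And>Y N. conf (\<lambda>i. i) Ix (aw_inst vs Q) Y N \<Longrightarrow> Y \<inter> G = {} \<Longrightarrow>
      \<exists>X'. conf (\<lambda>_. 0) (\<lambda>_. Ix 0) W' X' (R + N) \<and> X' \<inter> {0} \<subseteq> X"
    by (auto elim!: residualE)
  show ?thesis
  proof (rule that)
    show "comp_redex K g vs Q R"
      by (rule redex_comp_redex[OF r assms(3)])
    fix \<Phi> assume "\<And>G. finite G \<Longrightarrow> fires G vs Q R \<Phi>"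
    from this[OF \<open>finite G\<close>] obtain Y N K' where
      K': "conf (\<lambda>i. i) Ix (aw_inst vs Q) Y N" "Y \<inter> G = {}" "sum_comps aw_atoms K' = R + N" "\<Phi> K'"
      unfolding fires_def by blast
    from G[OF K'(1,2)] obtain X' where "conf (\<lambda>_. 0) (\<lambda>_. Ix 0) W' X' (R + N)" "X' \<inter> {0} \<subseteq> X"
      by blast
    then have "aw_top W' (sum_comps aw_atoms K')"
      unfolding aw_top_def K'(3) using X(2) by blast
    then show "\<exists>K'. aw_top W' (sum_comps aw_atoms K') \<and> \<Phi> K'"
      using K'(4) by blast
  qed
qed

lemma fires_relay:
  "fires G [WI (nm RA n), WI (nm RB n)] (relay_body n) (add_mset (relay n) (sum_comps aw_atoms K))
    (\<lambda>K'. K' = add_mset (Chan n Waiting) K)"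
proof (rule firesI)
  show "conf (\<lambda>i. i) Ix (aw_inst [WI (nm RA n), WI (nm RB n)] (relay_body n)) {} {#chan_atom n Waiting#}"
    by (simp add: aw_inst_def Let_def relay_body_def i_args_def o_args_def conf_simps up_def up_i_def c_refl)
qed auto

lemma fires_take:
  "fires G [WO (glob v)] (waiting_body n) (add_mset (relay n) (sum_comps aw_atoms K))
    (\<lambda>K'. K' = add_mset (Chan n (Holding v)) K)"
proof (rule firesI)
  show "conf (\<lambda>i. i) Ix (aw_inst [WO (glob v)] (waiting_body n)) {} {#chan_atom n (Holding v)#}"
    by (simp add: aw_inst_def Let_def waiting_body_def i_args_def o_args_def conf_simps up_def up_i_def c_refl)
qed auto

lemma fires_request:
  "fires G [WO (Ix (nm RZ z))] (holding_body n v)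
    (add_mset (relay n) (add_mset (AWIn (nm RZ z) [KO] (genc_body P)) (sum_comps aw_atoms K)))
    (\<lambda>K'. K' = add_mset (Chan n Idle) (add_mset (Dlv l z v n P) K))"
proof (rule firesI)
  have "sub_val (\<lambda>i. if i = 0 then ys ! i else Ix (i - length ys)) (shift_val (Suc 0) w) = w"
    if "length ys = Suc 0" for ys and w :: "'a val"
    using that by (cases w) auto
  then show "conf (\<lambda>i. i) Ix (aw_inst [WO (Ix (nm RZ z))] (holding_body n v)) {}
    {#AWOut (Ix (nm RZ z)) [WO (glob v)], chan_atom n Idle#}"
    by (simp add: aw_inst_def Let_def holding_body_def i_args_def o_args_def conf_simps)
qed auto

lemma finite_nm_vimage: "finite G \<Longrightarrow> finite {i. \<exists>r. nm r i \<in> G}"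
proof -
  assume G: "finite G"
  have "UNIV = {RA, RB, RC, RZ, RD}"
  proof -
    have "r \<in> {RA, RB, RC, RZ, RD}" for r
      by (cases r) auto
    then show ?thesis
      by blast
  qed
  then have "{i. \<exists>r. nm r i \<in> G} = (\<Union>r\<in>{RA, RB, RC, RZ, RD}. nm r -` G)"
    by blast
  moreover have "finite (nm r -` G)" for r
    using G by (rule finite_vimageI) (simp add: inj_def)
  ultimately show ?thesis
    by simp
qed

text \<open>The instantiated body is again an encoded process, so
  \<open>representable_encode\<close> applies to it. Identifiers having some name in
  \<open>G\<close> are excluded in addition to \<open>F\<close>.\<close>

lemma fires_deliver:
  assumes P: "wf_body P" and F: "finite F" "0 \<in> F" and G: "finite G"
  shows "fires G [WO (glob v)] (genc_body P) (sum_comps aw_atoms K)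
    (\<lambda>K'. \<exists>K0 X Y. K' = K0 + K \<and> aconf Ix (al_inst v P) Y (sum_comps al_atoms K0) \<and> fresh_comps F K0 X Y)"
proof -
  let ?F = "F \<union> {i. \<exists>r. nm r i \<in> G}"
  have P': "wf_al P" "0 \<notin> al_inputs P" "Suc 0 \<notin> al_inputs P"
    using P by (auto simp: wf_body_def)
  have "representable ?F (\<lambda>i. i) Ix (encode (nm RA) (\<lambda>i. Some (nm RB i)) (al_inst v P)) Ix (al_inst v P)"
  proof (rule representable_encode)
    fix i assume "i \<in> al_inputs (al_inst v P)"
    then obtain j where "j \<in> al_inputs P" "(case j of 0 \<Rightarrow> v | Suc k \<Rightarrow> Ix k) = Ix i"
      using al_inputs_al_sub unfolding al_inst_def by blast
    then have "i \<noteq> 0"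
      using P'(2,3) by (cases j; cases i) auto
    then show "\<exists>j k. Ix i = Ix j \<and> j \<noteq> 0 \<and> Some (nm RB i) = Some k \<and> Ix k = Ix (nm RB j)"
      by auto
  qed (use F G P' finite_nm_vimage wf_al_al_inst in auto)
  then obtain X Y K0 where K0: "aconf Ix (al_inst v P) Y (sum_comps al_atoms K0)"
    "conf (\<lambda>i. i) Ix (genc (al_inst v P)) X (sum_comps aw_atoms K0)" "fresh_comps ?F K0 X Y"
    unfolding representable_def genc_def by blast
  have fresh: "fresh_comps F K0 X Y"
    using K0(3) unfolding fresh_comps_def by blast
  have "X \<inter> G = {}"
  proof (rule ccontr)
    assume "X \<inter> G \<noteq> {}"
    then obtain x where "x \<in> X" "x \<in> G"
      by blast
    then obtain r i where "i \<in># sum_comps ids K0" "nm r i \<in> G"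
      using K0(3) unfolding fresh_comps_def by metis
    then show False
      using K0(3) unfolding fresh_comps_def by blast
  qed
  then show ?thesis
  proof (rule firesI[rotated])
    show "conf (\<lambda>i. i) Ix (aw_inst [WO (glob v)] (genc_body P)) X (sum_comps aw_atoms K0)"
      using K0(2) P' by (simp add: aw_inst_genc_body)
    show "\<exists>K1 X Y. K0 + K = K1 + K \<and> aconf Ix (al_inst v P) Y (sum_comps al_atoms K1) \<and> fresh_comps F K1 X Y"
      using K0(1) fresh by blast
  qed (simp add: add.commute)
qed

lemma fires_copy:
  assumes P: "wf_body P" and F: "finite F" and G: "finite G"
  shows "fires G [WO Star] (server_body d n P) (add_mset (server d n P) (sum_comps aw_atoms K))
    (\<lambda>K'. \<exists>z. z \<notin> F \<and> K' = add_mset (Rp d n P) (add_mset (Req False z n P) K))"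
proof -
  obtain z where z: "z \<notin> F \<union> {i. \<exists>r. nm r i \<in> G}"
    using ex_new_if_finite[OF infinite_UNIV_nat] F finite_nm_vimage[OF G] by blast
  have P': "wf_al P" "0 \<notin> al_inputs P"
    using P by (auto simp: wf_body_def)
  have inst: "aw_inst [WO Star] (server_body d n P) =
      AWPar (AWOut (Ix (nm RD d)) [WO Star]) (genc (ALIn (Ix n) P))"
    using aw_inst_genc_copy[OF P', of n] by (simp add: aw_inst_def Let_def server_body_def o_args_def i_args_def)
  have "conf (\<lambda>i. i) Ix (AWPar (AWOut (Ix (nm RD d)) [WO Star]) (genc (ALIn (Ix n) P))) {nm RZ z}
    (add_mset (AWOut (Ix (nm RD d)) [WO Star]) (aw_atoms (Req False z n P)))"
    using conf_par[OF conf_out[of _ _ "Ix (nm RD d)" "[WO Star]"] conf_genc_in[OF P', of "\<lambda>i. i" n z]]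
    by (simp add: add_mset_commute)
  then show ?thesis
    unfolding inst[symmetric]
  proof (rule firesI)
    show "\<exists>z'. z' \<notin> F \<and> add_mset (Rp d n P) (add_mset (Req False z n P) K) =
        add_mset (Rp d n P) (add_mset (Req False z' n P) K)"
      using z by blast
    show "{nm RZ z} \<inter> G = {}"
      using z by blast
  qed (simp add: add_mset_commute)
qed

text \<open>Removing a delivery removes no server, and the new components, being initial, contain no
  copies that would need one.\<close>

lemma wf_comps_deliver:
  assumes "wf_comps (add_mset (Dlv l z v n P) K)" "fresh_comps F K1 X Y" "set_mset (sum_comps ids K) \<subseteq> F"
  shows "wf_comps (K1 + K)"
proof -
  have wf1: "wf_comps K1" and K1: "\<forall>k\<in>#K1. initial k"
    using fresh_comps_wf[OF assms(2)] assms(2) by (auto simp: fresh_comps_def)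
  have "\<forall>i. count (sum_comps ids K) i \<le> 1"
  proof
    fix i show "count (sum_comps ids K) i \<le> 1"
      using assms(1)[unfolded wf_comps_def, THEN conjunct2, THEN conjunct1, rule_format, of i]
      by (simp split: if_splits)
  qed
  moreover have "set_mset (sum_comps ids K1) \<inter> set_mset (sum_comps ids K) = {}"
    using assms(2,3) unfolding fresh_comps_def by blast
  ultimately have "\<forall>i. count (sum_comps ids (K1 + K)) i \<le> 1"
    using wf1 count_le_1_union[of "sum_comps ids K1" "sum_comps ids K"] by (simp add: wf_comps_def)
  moreover have "\<exists>d. Rp d n' P' \<in># K1 + K"
    if "Req False z' n' P' \<in># K1 + K \<or> Dlv False z' v' n' P' \<in># K1 + K" for z' n' P' v'
  proof -
    have "Req False z' n' P' \<notin># K1" "Dlv False z' v' n' P' \<notin># K1"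
      using K1 by force+
    then have "Req False z' n' P' \<in># K \<or> Dlv False z' v' n' P' \<in># K"
      using that by auto
    then obtain d where "Rp d n' P' \<in># add_mset (Dlv l z v n P) K"
      using assms(1) unfolding wf_comps_def by (metis union_iff add_mset_add_single)
    then show ?thesis
      by auto
  qed
  moreover have "\<forall>k\<in>#K1 + K. wf_comp k"
    using assms(1) wf1 by (auto simp: wf_comps_def)
  ultimately show ?thesis
    unfolding wf_comps_def by blast
qed

text \<open>All steps except delivery preserve the ALpi atoms: a message moves into the relay and
  from there into the delivery, a request takes its input atom, if it has one, along, and a new copy
  has no atom.\<close>

lemma comp_redex_fires:
  assumes "comp_redex K g vs Q R" and wf: "wf_comps K" and F: "finite F" "set_mset (sum_comps ids K) \<subseteq> F" "0 \<in> F"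
  obtains (silent) "\<And>G. finite G \<Longrightarrow>
      fires G vs Q R (\<lambda>K'. sum_comps al_atoms K' = sum_comps al_atoms K \<and> wf_comps K')"
  | (deliver) l z v n P K0 where "K = add_mset (Dlv l z v n P) K0"
    "\<And>G. finite G \<Longrightarrow> fires G vs Q R (\<lambda>K'. \<exists>K1 X Y. K' = K1 + K0 \<and>
       aconf Ix (al_inst v P) Y (sum_comps al_atoms K1) \<and> fresh_comps F K1 X Y)"
  using assms(1)
proof (cases rule: comp_redex.cases)
  case (cr_relay n K0)
  then have "wf_comps (add_mset (Chan n Waiting) K0)"
    using wf unfolding wf_comps_def by simp
  then show ?thesis
    unfolding cr_relay by (intro silent[unfolded cr_relay] fires_mono[OF fires_relay]) simp
next
  case (cr_take n v K0)
  then have "wf_comps (add_mset (Chan n (Holding v)) K0)"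
    using wf unfolding wf_comps_def by simp
  then show ?thesis
    unfolding cr_take by (intro silent[unfolded cr_take] fires_mono[OF fires_take]) simp
next
  case (cr_request n v l z P K0)
  then have "wf_comps (add_mset (Chan n Idle) (add_mset (Dlv l z v n P) K0))"
    using wf unfolding wf_comps_def by (simp add: add.left_commute)
  then show ?thesis
    unfolding cr_request by (intro silent[unfolded cr_request] fires_mono[OF fires_request[where l = l]]) simp
next
  case (cr_deliver l z v n P K0)
  then have "wf_body P"
    using wf by (simp add: wf_comps_def)
  then show ?thesis
    using deliver[OF cr_deliver(1)] fires_deliver[OF _ F(1,3)] cr_deliver by blast
next
  case (cr_copy d n P K0)
  then have P: "wf_body P" "n \<noteq> 0"
    using wf by (simp_all add: wf_comps_def)
  have "wf_comps (add_mset (Rp d n P) (add_mset (Req False z n P) K0))" if "z \<notin> F" for z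
  proof -
    have "z \<notin># sum_comps ids K"
      using that F(2) by blast
    then have "\<forall>i. count (sum_comps ids (add_mset (Req False z n P) K)) i \<le> 1"
      using count_le_1_union[of "{#z#}" "sum_comps ids K"] wf by (simp add: wf_comps_def)
    then show ?thesis
      using wf P unfolding cr_copy wf_comps_def by (simp add: add_mset_commute) metis
  qed
  then show ?thesis
    unfolding cr_copy
    by (intro silent[unfolded cr_copy] fires_mono[OF fires_copy[OF P(1) F(1)]]) auto
qed

section \<open>The two simulations\<close>

lemma taus_aw [simp]: "taus aw_obs = aw_red\<^sup>*\<^sup>*"
  by (simp add: taus_def aw_obs_def)

lemma taus_al [simp]: "taus al_obs = (\<lambda>P P'. al_lts P LTau P')\<^sup>*\<^sup>*"
  by (simp add: taus_def al_obs_def)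

lemma weak_Success: "tr P (Success s) P' \<Longrightarrow> weak tr P (Success s) P'"
  by (auto simp: weak_def taus_def)

lemma good_env_top: "0 \<notin> Y \<Longrightarrow> good_env (\<lambda>_. Ix 0) Y"
  by (simp add: good_env_def)

lemma fresh_comps_Y: "fresh_comps F K X Y \<Longrightarrow> Y \<inter> F = {}"
proof -
  assume fresh: "fresh_comps F K X Y"
  have "set_mset (sum_comps ids K) \<inter> F = {}"
    using fresh unfolding fresh_comps_def by blast
  then show ?thesis
    using fresh_comps_chans[OF fresh] by blast
qed

definition aw_al_rel :: "'s aw \<Rightarrow> 's al \<Rightarrow> bool" where
  "aw_al_rel W P \<longleftrightarrow> (\<exists>K Y. aw_top W (sum_comps aw_atoms K) \<and>
     aconf (\<lambda>_. Ix 0) P Y (sum_comps al_atoms K) \<and> 0 \<notin> Y \<and> wf_comps K)"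

lemma al_atoms_Succ:
  "ALOut (Succ s) v \<in># al_atoms k \<longleftrightarrow> k = Msg (Succ s) v"
proof (cases k)
  case (Chan n c)
  then show ?thesis by (cases c) auto
qed auto

lemma aw_atoms_Succ:
  "AWOut (Succ s) [WO Star] \<in># aw_atoms k \<longleftrightarrow> k = Msg (Succ s) Star"
proof (cases k)
  case (Chan n c)
  then show ?thesis by (cases c) (auto simp: relay_def)
next
  case (Msg a v)
  have "Succ s = glob a \<longleftrightarrow> a = Succ s" "Star = glob v \<longleftrightarrow> v = Star"
    using glob_eq_simps by metis+
  then show ?thesis
    using Msg by auto
qed (auto simp: server_def)

lemma aw_al_simulation: "weak_simulation aw_obs al_obs aw_al_rel"
  unfolding weak_simulation_def
proof (intro allI impI)
  fix W :: "'s aw" and P :: "'s al" and \<mu> W'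
  assume rel: "aw_al_rel W P" and step: "aw_obs W \<mu> W'"
  from rel obtain K Y where W: "aw_top W (sum_comps aw_atoms K)"
    and P: "aconf (\<lambda>_. Ix 0) P Y (sum_comps al_atoms K)" and Y: "0 \<notin> Y" and wf: "wf_comps K"
    unfolding aw_al_rel_def by blast
  show "\<exists>P'. weak al_obs P \<mu> P' \<and> aw_al_rel W' P'"
  proof (cases \<mu>)
    case Tau
    have red: "aw_red W W'"
      using step Tau by (simp add: aw_obs_def)
    have count: "\<forall>i. count (sum_comps ids K) i \<le> 1"
      using wf by (simp add: wf_comps_def)
    obtain g vs Q R where r: "comp_redex K g vs Q R" and
      fire: "\<And>\<Phi>. (\<And>G. finite G \<Longrightarrow> fires G vs Q R \<Phi>) \<Longrightarrow> \<exists>K'. aw_top W' (sum_comps aw_atoms K') \<and> \<Phi> K'"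
      using aw_red_fire[OF red W count] by blast
    define F where "F = insert 0 (Y \<union> set_mset (sum_comps ids K))"
    have F: "finite F" "set_mset (sum_comps ids K) \<subseteq> F" "0 \<in> F"
      using aconf_finite[OF P] by (auto simp: F_def)
    from r wf F show ?thesis
    proof (cases rule: comp_redex_fires)
      case silent
      from fire[OF silent] obtain K' where "aw_top W' (sum_comps aw_atoms K')"
        "sum_comps al_atoms K' = sum_comps al_atoms K" "wf_comps K'"
        by blast
      then have "aw_al_rel W' P"
        unfolding aw_al_rel_def using P Y by metis
      then show ?thesis
        using Tau by (auto simp: weak_def)
    next
      case (deliver l z v n S K0)
      from fire[OF deliver(2)] obtain K1 X1 Y1 where
        K1: "aw_top W' (sum_comps aw_atoms (K1 + K0))"
          "aconf Ix (al_inst v S) Y1 (sum_comps al_atoms K1)" "fresh_comps F K1 X1 Y1"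
        by blast
      have n: "n \<noteq> 0"
        using wf unfolding deliver(1) by (simp add: wf_comps_def)
      \<comment> \<open>For a copy, the receiver in ALpi is the replicated input of its server,
        which persists in the remainder.\<close>
      have comm: "comm (sum_comps al_atoms K) (Ix n) v S (sum_comps al_atoms K0)"
      proof (cases l)
        case True
        then show ?thesis
          unfolding deliver(1) by (simp add: commI ready_in)
      next
        case False
        then obtain d where "Rp d n S \<in># K"
          using wf unfolding deliver(1) wf_comps_def by (metis union_single_eq_member)
        then have "Rp d n S \<in># K0"
          unfolding deliver(1) by simp
        then have "ALRep (Ix n) S \<in># sum_comps al_atoms K0"
          unfolding mem_sum_comps by force
        then have "ready (sum_comps al_atoms K0) (Ix n) S (sum_comps al_atoms K0)"
          by (simp add: ready_iff)
        then show ?thesis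
          unfolding deliver(1) using False by (simp add: commI)
      qed
      obtain P' where P': "al_lts P LTau P'"
        "al_residual (\<lambda>_. Ix 0) Y v S (sum_comps al_atoms K0) P'"
        using aconf_tau_lts[OF P good_env_top[OF Y] comm n] by blast
      have Y1: "Y \<inter> Y1 = {}" "0 \<notin> Y1"
        using fresh_comps_Y[OF K1(3)] by (auto simp: F_def)
      have "aconf (\<lambda>_. Ix 0) P' (Y \<union> Y1) (sum_comps al_atoms (K1 + K0))"
        using P'(2)[unfolded al_residual_def, rule_format, OF K1(2) Y1(1)] by (simp add: add.commute)
      moreover have "wf_comps (K1 + K0)"
        using wf_comps_deliver[OF _ K1(3)] wf F(2) unfolding deliver(1) by auto
      ultimately have "aw_al_rel W' P'"
        unfolding aw_al_rel_def using K1(1) Y Y1(2) by blast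
      then show ?thesis
        using Tau P'(1) by (auto simp: weak_def)
    qed
  next
    case (Success s)
    from W obtain X where X: "conf (\<lambda>_. 0) (\<lambda>_. Ix 0) W X (sum_comps aw_atoms K)" "0 \<notin> X"
      unfolding aw_top_def by blast
    have "aw_succ s W W'"
      using step Success by (simp add: aw_obs_def)
    from aw_succ_conf[OF this X(1), of "{0}"] obtain R X' where
      R: "sum_comps aw_atoms K = add_mset (AWOut (Succ s) [WO Star]) R"
      and W': "conf (\<lambda>_. 0) (\<lambda>_. Ix 0) W' X' R" "X' \<inter> {0} \<subseteq> X"
      by auto
    have "AWOut (Succ s) [WO Star] \<in># sum_comps aw_atoms K"
      unfolding R by simp
    then have "Msg (Succ s) Star \<in># K"
      by (simp add: mem_sum_comps aw_atoms_Succ)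
    then obtain K0 where K: "K = add_mset (Msg (Succ s) Star) K0"
      by (metis insert_DiffM)
    then have "R = sum_comps aw_atoms K0"
      using R by simp
    then have "aw_top W' (sum_comps aw_atoms K0)"
      unfolding aw_top_def using W' X(2) by blast
    moreover have "out_conf (\<lambda>_. Ix 0) P Y (Succ s) Star (sum_comps al_atoms K0)"
      using aconf_out_lts[OF P good_env_top[OF Y], of "Succ s" Star] K by simp
    then obtain w P' where "al_lts P (LOut (Succ s) w) P'" "sub_val (\<lambda>_. Ix 0) w = (Star :: 's val)"
      and P': "aconf (\<lambda>_. Ix 0) P' Y (sum_comps al_atoms K0)"
      unfolding out_conf_def by blast
    then have "al_lts P (LOut (Succ s) Star) P'"
      by (cases w) auto
    moreover have "wf_comps K0"
      using wf unfolding K wf_comps_def by simp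
    ultimately show ?thesis
      using P' Y Success weak_Success[of al_obs P s P'] unfolding aw_al_rel_def al_obs_def by auto
  qed
qed

text \<open>No protocol run is in progress between two ALpi transitions; the last clause gives every
  restricted name a relay that can start one.\<close>

definition al_aw_rel :: "'s al \<Rightarrow> 's aw \<Rightarrow> bool" where
  "al_aw_rel P W \<longleftrightarrow> (\<exists>K Y. aw_top W (sum_comps aw_atoms K) \<and>
     aconf (\<lambda>_. Ix 0) P Y (sum_comps al_atoms K) \<and> 0 \<notin> Y \<and> (\<forall>k\<in>#K. wf_comp k \<and> initial k) \<and>
     (\<forall>n\<in>Y. Chan n Idle \<in># K))"

text \<open>A complete protocol run in four reductions: token, message, request, delivery. The third
  returns the token, which restores the idle relay demanded by \<open>al_aw_rel\<close>.\<close>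

lemma aw_deliver:
  assumes W: "aw_top W (sum_comps aw_atoms (add_mset (Chan n Idle) (add_mset (Msg (Ix n) v) (add_mset (Req l z n P) K))))"
    and P: "wf_body P" and F: "finite F" "0 \<in> F"
  obtains W' K1 X Y where "aw_red\<^sup>*\<^sup>* W W'" "aw_top W' (sum_comps aw_atoms (K1 + add_mset (Chan n Idle) K))"
    "aconf Ix (al_inst v P) Y (sum_comps al_atoms K1)" "fresh_comps F K1 X Y"
proof -
  obtain W1 where 1: "aw_red W W1"
    "aw_top W1 (sum_comps aw_atoms (add_mset (Chan n Waiting) (add_mset (Msg (Ix n) v) (add_mset (Req l z n P) K))))"
    using aw_fire[OF cr_relay W fires_relay] by metis
  obtain W2 where 2: "aw_red W1 W2"
    "aw_top W2 (sum_comps aw_atoms (add_mset (Chan n (Holding v)) (add_mset (Req l z n P) K)))"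
    using aw_fire[OF cr_take 1(2) fires_take] by metis
  obtain W3 where 3: "aw_red W2 W3"
    "aw_top W3 (sum_comps aw_atoms (add_mset (Dlv l z v n P) (add_mset (Chan n Idle) K)))"
    using aw_fire[OF cr_request 2(2) fires_request[where l = l]] unfolding add_mset_commute[of "Chan n Idle"] by metis
  obtain W4 K1 X Y where 4: "aw_red W3 W4" "aw_top W4 (sum_comps aw_atoms (K1 + add_mset (Chan n Idle) K))"
    "aconf Ix (al_inst v P) Y (sum_comps al_atoms K1)" "fresh_comps F K1 X Y"
    using aw_fire[OF cr_deliver 3(2) fires_deliver[OF P F]] by metis
  have "aw_red\<^sup>*\<^sup>* W W4"
    by (rule converse_rtranclp_into_rtranclp[OF 1(1) converse_rtranclp_into_rtranclp[OF 2(1)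
          converse_rtranclp_into_rtranclp[OF 3(1) r_into_rtranclp[of aw_red, OF 4(1)]]]])
  then show ?thesis
    using that 4 by blast
qed

lemma initial_al_atoms:
  assumes "initial k"
  shows "ALOut a v \<in># al_atoms k \<Longrightarrow> k = Msg a v"
    "ALIn a Q \<in># al_atoms k \<Longrightarrow> \<exists>z n. a = Ix n \<and> k = Req True z n Q"
    "ALRep a Q \<in># al_atoms k \<Longrightarrow> \<exists>d n. a = Ix n \<and> k = Rp d n Q"
  using assms by (cases k; auto)+

lemma al_aw_deliver:
  assumes W: "aw_top W (sum_comps aw_atoms (add_mset (Chan n Idle) (add_mset (Msg (Ix n) v) (add_mset (Req l z n Q) K))))"
    and Q: "wf_body Q" and K: "\<forall>k\<in>#add_mset (Chan n Idle) K. wf_comp k \<and> initial k"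
    and Y: "0 \<notin> Y" "finite Y" "\<forall>m\<in>Y. Chan m Idle \<in># add_mset (Chan n Idle) K"
    and P': "al_residual (\<lambda>_. Ix 0) Y v Q (sum_comps al_atoms K) P'"
  shows "\<exists>W'. aw_red\<^sup>*\<^sup>* W W' \<and> al_aw_rel P' W'"
proof -
  have F: "finite (insert 0 Y)" "0 \<in> insert 0 Y"
    using Y by auto
  obtain W' K1 X1 Y1 where
    1: "aw_red\<^sup>*\<^sup>* W W'" "aw_top W' (sum_comps aw_atoms (K1 + add_mset (Chan n Idle) K))"
      "aconf Ix (al_inst v Q) Y1 (sum_comps al_atoms K1)" and fresh: "fresh_comps (insert 0 Y) K1 X1 Y1"
    by (rule aw_deliver[OF W Q F])
  have Y1: "Y \<inter> Y1 = {}" "0 \<notin> Y1"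
    using fresh_comps_Y[OF fresh] by auto
  have "aconf (\<lambda>_. Ix 0) P' (Y \<union> Y1) (sum_comps al_atoms (K1 + add_mset (Chan n Idle) K))"
    using P'[unfolded al_residual_def, rule_format, OF 1(3) Y1(1)] by (simp add: add.commute)
  moreover have "\<forall>k\<in>#K1 + add_mset (Chan n Idle) K. wf_comp k \<and> initial k"
    using K fresh by (auto simp: fresh_comps_def)
  moreover have "\<forall>m\<in>Y \<union> Y1. Chan m Idle \<in># K1 + add_mset (Chan n Idle) K"
    using Y(3) fresh by (auto simp: fresh_comps_def)
  ultimately have "al_aw_rel P' W'"
    unfolding al_aw_rel_def using 1(2) Y(1) Y1(2) by blast
  then show ?thesis
    using 1(1) by blast
qed

lemma al_aw_simulation: "weak_simulation al_obs aw_obs al_aw_rel"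
  unfolding weak_simulation_def
proof (intro allI impI)
  fix P :: "'s al" and W :: "'s aw" and \<mu> P'
  assume rel: "al_aw_rel P W" and step: "al_obs P \<mu> P'"
  from rel obtain K Y where W: "aw_top W (sum_comps aw_atoms K)"
    and P: "aconf (\<lambda>_. Ix 0) P Y (sum_comps al_atoms K)" and Y: "0 \<notin> Y"
    and K: "\<forall>k\<in>#K. wf_comp k \<and> initial k" and chans: "\<forall>n\<in>Y. Chan n Idle \<in># K"
    unfolding al_aw_rel_def by blast
  show "\<exists>W'. weak aw_obs W \<mu> W' \<and> al_aw_rel P' W'"
  proof (cases \<mu>)
    case Tau
    then have "al_lts P LTau P'"
      using step by (simp add: al_obs_def)
    from al_lts_act_conf[OF this P] obtain a v Q R where
      comm: "comm (sum_comps al_atoms K) a v Q R" and res: "al_residual (\<lambda>_. Ix 0) Y v Q R P'"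
      by auto
    obtain k where "k \<in># K" "ALOut a v \<in># al_atoms k"
      using comm unfolding comm_iff mem_sum_comps by blast
    then have "Msg a v \<in># K"
      using initial_al_atoms(1) K by blast
    then obtain K1 where K1: "K = add_mset (Msg a v) K1"
      by (metis insert_DiffM)
    have ready: "ready (sum_comps al_atoms K1) a Q R"
      using comm unfolding comm_iff K1 by simp
    then obtain k where k: "k \<in># K1" "ALIn a Q \<in># al_atoms k \<or> ALRep a Q \<in># al_atoms k"
      unfolding ready_iff mem_sum_comps by blast
    moreover have "wf_comp k" "initial k"
      using k(1) K unfolding K1 by auto
    ultimately obtain n where a: "a = Ix n" and n: "n \<noteq> 0" and Q: "wf_body Q"
      using initial_al_atoms(2,3)[of k a Q] by fastforce
    \<comment> \<open>The environment sends every free index to 0, so the nonzero subject is a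
      restricted name and has a relay.\<close>
    have "n \<in> Y"
      using aconf_subject[OF P, of "ALOut (Ix n) v" n] comm n unfolding a comm_iff by simp
    then have "Chan n Idle \<in># K1"
      using chans unfolding K1 by auto
    then obtain K2 where K2: "K1 = add_mset (Chan n Idle) K2"
      by (metis insert_DiffM)
    have ready2: "ready (sum_comps al_atoms K2) (Ix n) Q R"
      using ready unfolding a K2 by simp
    have "finite Y"
      using aconf_finite[OF P] .
    have "\<exists>W'. aw_red\<^sup>*\<^sup>* W W' \<and> al_aw_rel P' W'"
      using ready2[unfolded ready_iff]
    proof (elim disjE conjE)
      assume "ALIn (Ix n) Q \<in># sum_comps al_atoms K2" and R: "R = sum_comps al_atoms K2 - {#ALIn (Ix n) Q#}"
      then obtain k where "k \<in># K2" "ALIn (Ix n) Q \<in># al_atoms k"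
        unfolding mem_sum_comps by blast
      then obtain z where "Req True z n Q \<in># K2"
        using initial_al_atoms(2)[of k "Ix n" Q] K unfolding K1 K2 by auto
      then obtain K3 where K3: "K2 = add_mset (Req True z n Q) K3"
        by (metis insert_DiffM)
      have "R = sum_comps al_atoms K3"
        using R by (simp add: K3)
      then show ?thesis
        using al_aw_deliver[of W n v True z Q K3 Y P'] W Q K Y \<open>finite Y\<close> chans res
        unfolding K1 K2 K3 a by (simp add: add_mset_commute)
    next
      assume "ALRep (Ix n) Q \<in># sum_comps al_atoms K2" and R: "R = sum_comps al_atoms K2"
      then obtain k where "k \<in># K2" "ALRep (Ix n) Q \<in># al_atoms k"
        unfolding mem_sum_comps by blast
      then obtain d where "Rp d n Q \<in># K2"
        using initial_al_atoms(3)[of k "Ix n" Q] K unfolding K1 K2 by auto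
      then obtain K3 where K3: "K2 = add_mset (Rp d n Q) K3"
        by (metis insert_DiffM)
      have "K = add_mset (Rp d n Q) (add_mset (Chan n Idle) (add_mset (Msg (Ix n) v) K3))"
        unfolding K1 K2 K3 a by (simp add: add_mset_commute)
      with W have "aw_top W (sum_comps aw_atoms (add_mset (Rp d n Q) (add_mset (Chan n Idle) (add_mset (Msg (Ix n) v) K3))))"
        by (simp only:)
      \<comment> \<open>A replicated input is served by a copy made on demand, which the following
        run consumes, so none is left over. \<open>al_aw_rel\<close> imposes no freshness on
        identifiers, hence the empty set of indices to avoid.\<close>
      from aw_fire[OF cr_copy this fires_copy[OF Q finite.emptyI]] obtain W1 z where
        W1: "aw_red W W1" "aw_top W1 (sum_comps aw_atoms (add_mset (Rp d n Q) (add_mset (Req False z n Q)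
          (add_mset (Chan n Idle) (add_mset (Msg (Ix n) v) K3)))))"
        by metis
      have "add_mset (Rp d n Q) (add_mset (Req False z n Q) (add_mset (Chan n Idle) (add_mset (Msg (Ix n) v) K3))) =
          add_mset (Chan n Idle) (add_mset (Msg (Ix n) v) (add_mset (Req False z n Q) K2))"
        unfolding K3 by (simp add: add_mset_commute)
      with W1(2) have "aw_top W1 (sum_comps aw_atoms (add_mset (Chan n Idle) (add_mset (Msg (Ix n) v)
          (add_mset (Req False z n Q) K2))))"
        by (simp only:)
      then have "\<exists>W'. aw_red\<^sup>*\<^sup>* W1 W' \<and> al_aw_rel P' W'"
        by (rule al_aw_deliver[OF _ Q _ Y \<open>finite Y\<close>])
          (use K chans res in \<open>auto simp: K1 K2 a R\<close>)
      then show ?thesis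
        using W1(1) converse_rtranclp_into_rtranclp by metis
    qed
    then show ?thesis
      using Tau by (simp add: weak_def)
  next
    case (Success s)
    then have "al_lts P (LOut (Succ s) Star) P'"
      using step by (simp add: al_obs_def)
    from al_lts_act_conf[OF this P] obtain R where
      R: "sum_comps al_atoms K = add_mset (ALOut (Succ s) Star) R" and P': "aconf (\<lambda>_. Ix 0) P' Y R"
      by auto
    have "ALOut (Succ s) Star \<in># sum_comps al_atoms K"
      unfolding R by simp
    then have "Msg (Succ s) Star \<in># K"
      by (simp add: mem_sum_comps al_atoms_Succ)
    then obtain K0 where K0: "K = add_mset (Msg (Succ s) Star) K0"
      by (metis insert_DiffM)
    then have R0: "R = sum_comps al_atoms K0"
      using R by simp
    obtain X where X: "conf (\<lambda>_. 0) (\<lambda>_. Ix 0) W X (sum_comps aw_atoms K)" "0 \<notin> X"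
      using W unfolding aw_top_def by blast
    then obtain W' where "aw_succ s W W'" "conf (\<lambda>_. 0) (\<lambda>_. Ix 0) W' X (sum_comps aw_atoms K0)"
      using conf_aw_succ[of W X s "sum_comps aw_atoms K0"] unfolding K0 by auto
    moreover from this X have "aw_top W' (sum_comps aw_atoms K0)"
      unfolding aw_top_def by blast
    moreover have "\<forall>k\<in>#K0. wf_comp k \<and> initial k" "\<forall>n\<in>Y. Chan n Idle \<in># K0"
      using K chans unfolding K0 by auto
    ultimately show ?thesis
      using P' Y Success weak_Success[of aw_obs W s W'] unfolding al_aw_rel_def R0 aw_obs_def by auto
  qed
qed

lemma al_inputs_subset_al_fn: "al_inputs P \<subseteq> al_fn P"
  by (induction P) (auto simp: unbind_def)

theorem theorem6p2:
  fixes P :: "'s al"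
  assumes "al_process P"
    and "al_closed P"
  shows "encode (\<lambda>i. i) Map.empty P \<simeq> P"
proof -
  have wf: "wf_al P"
    using assms(1) wf_al_of_typed by (auto simp: al_process_def)
  have fn: "al_fn P = {}" "al_inputs P = {}"
    using assms(2) al_inputs_subset_al_fn[of P] by (auto simp: al_closed_def)
  let ?W = "encode (\<lambda>i. i) Map.empty P"
  \<comment> \<open>Closedness makes the conditions on free names and on input subjects vacuous,
    which admits the constant environments and the empty map; \<open>{0}\<close> keeps the reserved
    name out of the restricted ones.\<close>
  have "representable {0} (\<lambda>_. 0) (\<lambda>_. Ix 0) ?W (\<lambda>_. Ix 0) P"
    by (rule representable_encode[OF wf]) (simp_all add: fn)
  then obtain X Y K where P: "aconf (\<lambda>_. Ix 0) P Y (sum_comps al_atoms K)"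
    and W: "conf (\<lambda>_. 0) (\<lambda>_. Ix 0) ?W X (sum_comps aw_atoms K)" and fresh: "fresh_comps {0} K X Y"
    unfolding representable_def by blast
  have "0 \<notin> X"
    using fresh unfolding fresh_comps_def by (metis nm_neq_0(2))
  then have W': "aw_top ?W (sum_comps aw_atoms K)"
    unfolding aw_top_def using W by blast
  have Y: "0 \<notin> Y"
    using fresh_comps_Y[OF fresh] by auto
  have "aw_al_rel ?W P"
    unfolding aw_al_rel_def using W' P Y fresh_comps_wf[OF fresh] by blast
  moreover have "al_aw_rel P ?W"
    unfolding al_aw_rel_def using W' P Y fresh unfolding fresh_comps_def by blast
  ultimately show ?thesis
    unfolding sim_equiv_def weakly_simulated_def
    using aw_al_simulation al_aw_simulation by blast
qed

end
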